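(* Let $k$ be a field of arbitrary characteristic and let $k^{[3]}$ be the polynomial ring in three variables over $k$. Then every exponential map $\delta\in \mathrm{EXP}_k(k^{[3]})$ is rigid.
   Context: All rings are commutative with unity. For a domain $A$, $A^{[n]}$ denotes the polynomial ring in $n$ variables over $A$. Exponential map: for domains $A\subset B$, an exponential map on $B$ (over $A$) is an $A$-algebra homomorphism $\delta=\delta_t:B\to B[t]$ ($t$ an indeterminate) such that (1) composing $\delta_t$ with evaluation at $t=0$ gives the identity of $B$, and (2) $\delta_s\circ\delta_t=\delta_{s+t}$, where $\delta_s$ is extended to a homomorphism $B[t]\to B[s,t]$ by $\delta_s(t)=t$. $\mathrm{EXP}_A(B)$ is the set of all of these. The ring of invariants is $B^\delta=\{x\in B:\delta(x)=x\}$. Coordinate systems, rank: for $B=A^{[n]}$, a coordinate system of $B$ over $A$ is a system $\{X_1,\dots,X_n\}$ of elements of $B$ (listed in order) with $B=A[X_1,\dots,X_n]$; $\Gamma(B)$ is the set of all coordinate systems. For $\delta\in\mathrm{EXP}_A(B)$, $\mathrm{rank}(\delta)$ is the least integer $r\ge 0$ for which there is $\{X_1,\dots,X_n\}\in\Gamma(B)$ with $A[X_1,\dots,X_{n-r}]\subset B^\delta$. If $\mathrm{rank}(\delta)=r$, $\Gamma_\delta(B)$ is the set of $\{X_1,\dots,X_n\}\in\Gamma(B)$ with $A[X_1,\dots,X_{n-r}]\subset B^\delta$. Rigid: $\delta\in\mathrm{EXP}_A(A^{[n]})$ of rank $r$ is rigid if $A[X_1,\dots,X_{n-r}]=A[X_1',\dots,X_{n-r}']$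 whenever $\{X_1,\dots,X_n\},\{X_1',\dots,X_n'\}\in\Gamma_\delta(B)$. Here this is applied with $A=k$, $n=3$. *)

theory Defs
  imports "HOL-Computational_Algebra.Polynomial"
begin

definition unital_subring :: "'b::comm_ring_1 set \<Rightarrow> bool" where
  "unital_subring S \<longleftrightarrow>
     1 \<in> S \<and> (\<forall>x\<in>S. \<forall>y\<in>S. x - y \<in> S) \<and> (\<forall>x\<in>S. \<forall>y\<in>S. x * y \<in> S)"

text \<open>\<open>adjoin A xs\<close> is $A[x_1,\dots,x_m]$ inside the ambient ring.\<close>

definition adjoin :: "'b::comm_ring_1 set \<Rightarrow> 'b list \<Rightarrow> 'b set" where
  "adjoin A xs = unital_subring hull (A \<union> set xs)"

text \<open>
  Throughout, the ring \<open>B\<close> is a whole type \<open>'b\<close> and \<open>A\<close> is a subset of it (in the intended use a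
  subring). The rings $B[t]$ and $B[s,t] = B[s][t]$ are \<open>'b poly\<close> and \<open>'b poly poly\<close>; in the
  latter, \<open>s\<close> is the inner variable \<open>[:[:0, 1:]:]\<close> and \<open>t\<close> the outer variable \<open>[:0, 1:]\<close>.
  The extension of \<open>\<delta>\<^sub>s\<close> to $B[t] \to B[s,t]$ fixing \<open>t\<close> is \<open>map_poly \<delta>\<close>. The map
  \<open>\<delta>\<^bsub>s+t\<^esub>\<close> sends \<open>b\<close> to the value of \<open>\<delta> b\<close> at \<open>s + t = [:[:0, 1:], 1:]\<close>.
\<close>

definition exp_maps :: "'b::idom set \<Rightarrow> ('b \<Rightarrow> 'b poly) set" where
  "exp_maps A = {\<delta>.
     (\<forall>x y. \<delta> (x + y) = \<delta> x + \<delta> y) \<and>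
     (\<forall>x y. \<delta> (x * y) = \<delta> x * \<delta> y) \<and>
     (\<forall>a\<in>A. \<delta> a = [:a:]) \<and>
     \<delta> 1 = 1 \<and>
     (\<forall>b. poly (\<delta> b) 0 = b) \<and>
     (\<forall>b. map_poly \<delta> (\<delta> b) = poly (map_poly (\<lambda>c. [:[:c:]:]) (\<delta> b)) [:[:0, 1:], 1:])}"

definition invariants :: "('b::idom \<Rightarrow> 'b poly) \<Rightarrow> 'b set" where
  "invariants \<delta> = {x. \<delta> x = [:x:]}"

text \<open>In the following, \<open>'b\<close> is meant to be a polynomial ring in \<open>n\<close> variables over \<open>A\<close>.\<close>

definition coord_systems :: "'b::idom set \<Rightarrow> nat \<Rightarrow> 'b list set" where
  "coord_systems A n = {Xs. length Xs = n \<and> adjoin A Xs = UNIV}"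

definition exp_rank :: "'b::idom set \<Rightarrow> nat \<Rightarrow> ('b \<Rightarrow> 'b poly) \<Rightarrow> nat" where
  "exp_rank A n \<delta> =
     (LEAST r. r \<le> n \<and> (\<exists>Xs\<in>coord_systems A n. adjoin A (take (n - r) Xs) \<subseteq> invariants \<delta>))"

definition adapted_coord_systems :: "'b::idom set \<Rightarrow> nat \<Rightarrow> ('b \<Rightarrow> 'b poly) \<Rightarrow> 'b list set" where
  "adapted_coord_systems A n \<delta> =
     {Xs \<in> coord_systems A n. adjoin A (take (n - exp_rank A n \<delta>) Xs) \<subseteq> invariants \<delta>}"

definition rigid :: "'b::idom set \<Rightarrow> nat \<Rightarrow> ('b \<Rightarrow> 'b poly) \<Rightarrow> bool" where
  "rigid A n \<delta> \<longleftrightarrow>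
     (\<forall>Xs\<in>adapted_coord_systems A n \<delta>. \<forall>Ys\<in>adapted_coord_systems A n \<delta>.
        adjoin A (take (n - exp_rank A n \<delta>) Xs) = adjoin A (take (n - exp_rank A n \<delta>) Ys))"

text \<open>The polynomial ring in three variables over \<open>'k\<close> is \<open>'k poly poly poly\<close>; this is the copy
  of \<open>'k\<close> in it.\<close>

definition scalars3 :: "'k::field poly poly poly set" where
  "scalars3 = range (\<lambda>c. [:[:[:c:]:]:])"

end

theory Submission
  imports "HOL-Algebra.Algebraic_Closure_Type" Defs
begin

text \<open>
  Let \<open>A\<close> be the ring of invariants of a nontrivial exponential map on \<open>B = k[X,Y,Z]\<close>; it is
  factorially and algebraically closed in \<open>B\<close>. The only difficult rank is 2: if two coordinates
  \<open>X\<close>, \<open>X'\<close> lie in \<open>A\<close> and \<open>k[X] \<noteq> k[X']\<close>, then the rank is at most 1.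

  Let \<open>n\<close> be the least positive \<open>t\<close>-degree of an element of \<open>B\<close>, and \<open>s\<close> of degree \<open>n\<close> with leading
  coefficient \<open>c \<in> A\<close>; then every element of \<open>B\<close> is carried into \<open>A[s]\<close> by a power of \<open>c\<close>. Over an
  algebraic closure \<open>K\<close> of \<open>k(X)\<close> the invariants are \<open>K[P]\<close>, because an invariant is algebraic over
  \<open>K\<close>, hence constant, modulo the prime \<open>P\<close>; for the same reason \<open>K[Y,Z] = K[P][s]\<close> once the degree
  of \<open>c\<close> is minimal. A \<open>k(X)\<close>-linear retraction \<open>K \<rightarrow> k(X)\<close>, applied to coefficients, commutes with
  the action and brings \<open>P\<close> and \<open>s\<close> down to \<open>B\<close>.

  Dividing out factors from \<open>k[X]\<close> yields \<open>A = k[X,P]\<close> and an \<open>s\<close> that lies in \<open>A + \<pi>B\<close> for no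
  prime \<open>\<pi> \<in> k[X]\<close>, while every \<open>b \<in> B\<close> has \<open>f(X) b \<in> A[s]\<close> for some \<open>f \<noteq> 0\<close>. The element \<open>s'\<close>
  obtained in the same way from \<open>X'\<close> then lies in \<open>A[s]\<close>, so that also \<open>f'(X') b \<in> A[s]\<close> for some
  \<open>f' \<noteq> 0\<close>. As \<open>f(X)\<close> and \<open>f'(X')\<close> have no common prime factor in \<open>B\<close>, it follows that
  \<open>B = A[s] = k[X,P,s]\<close>.
\<close>

section \<open>Iterative homomorphisms and their invariants\<close>

locale comm_hom =
  fixes h :: "'a::comm_ring_1 \<Rightarrow> 'b::comm_ring_1"
  assumes add: "h (x + y) = h x + h y"
    and mult: "h (x * y) = h x * h y"
    and one: "h 1 = 1"
begin

lemma zero: "h 0 = 0"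
  using add[of 0 0] by simp

lemma uminus: "h (- x) = - h x"
  using add[of x "- x"] zero by (simp add: eq_neg_iff_add_eq_0 add.commute)

lemma diff: "h (x - y) = h x - h y"
  using add[of x "- y"] uminus by simp

lemma sum: "h (\<Sum>i\<in>I. f i) = (\<Sum>i\<in>I. h (f i))"
  by (induction I rule: infinite_finite_induct) (auto simp: zero add)

lemma power: "h (x ^ n) = h x ^ n"
  by (induction n) (auto simp: one mult)

lemma of_nat: "h (of_nat n) = of_nat n"
  by (induction n) (auto simp: zero one add)

lemma map_poly_hom: "comm_hom (map_poly h)"
proof
  show "map_poly h (p + q) = map_poly h p + map_poly h q" for p q
    by (rule poly_eqI) (simp add: coeff_map_poly zero add)
  show "map_poly h (p * q) = map_poly h p * map_poly h q" for p q
    by (rule poly_eqI) (simp add: coeff_map_poly zero coeff_mult sum mult)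
  show "map_poly h 1 = 1"
    by (simp add: one)
qed

lemma eval_hom: "comm_hom (\<lambda>p. poly (map_poly h p) y)"
proof -
  interpret M: comm_hom "map_poly h" by (rule map_poly_hom)
  show ?thesis by unfold_locales (simp_all add: M.add M.mult M.one)
qed

lemma eval_pCons: "poly (map_poly h (pCons a p)) y = h a + y * poly (map_poly h p) y"
  by (simp add: map_poly_pCons zero)

lemma hom_poly: "h (poly p x) = poly (map_poly h p) (h x)"
  by (induction p) (simp_all add: map_poly_pCons zero add mult)

end

lemma comm_hom_comp:
  assumes "comm_hom f" "comm_hom g" shows "comm_hom (\<lambda>x. f (g x))"
  using assms by (simp add: comm_hom_def)

lemma const_hom: "comm_hom (\<lambda>c. [:c:])"
  by unfold_locales (auto simp: one_pCons)

lemma comm_hom_poly_eqI: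
  fixes f g :: "'a::comm_ring_1 poly \<Rightarrow> 'b::comm_ring_1"
  assumes "comm_hom f" "comm_hom g"
    and c: "\<And>c. f [:c:] = g [:c:]" and X: "f [:0, 1:] = g [:0, 1:]"
  shows "f p = g p"
proof (induction p)
  interpret f: comm_hom f by fact
  interpret g: comm_hom g by fact
  {
    case 0
    show ?case by (simp add: f.zero g.zero)
  next
    case (pCons a p)
    have "pCons a p = [:a:] + [:0, 1:] * p" by simp
    then show ?case using pCons by (simp only: f.add g.add f.mult g.mult c X)
  }
qed

lemma coeff_linear_power:
  fixes a b :: "'a::comm_ring_1"
  shows "coeff ([:a, b:] ^ n) i = of_nat (n choose i) * b ^ i * a ^ (n - i)"
proof (cases "i \<le> n")
  case False
  have "degree ([:a, b:] ^ n) \<le> n"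
    by (rule order_trans[OF degree_power_le]) (simp add: degree_pCons_eq_if)
  with False show ?thesis by (simp add: coeff_eq_0 binomial_eq_0)
qed (rule coeff_linear_poly_power)

section \<open>Iterative higher derivations: degree and invariants\<close>

definition poly_span :: "'b::comm_ring_1 set \<Rightarrow> 'b \<Rightarrow> 'b set" where
  "poly_span A s = {poly q s | q. \<forall>i. coeff q i \<in> A}"

text \<open>The coefficient maps $D_i$ of \<open>\<delta>\<close> form a locally finite iterative
  higher derivation: \<open>iterate\<close> is the composition law of an exponential map read off at
  $t^i s^j$.\<close>

locale iterative_hom =
  fixes \<delta> :: "'b::idom \<Rightarrow> 'b poly"
  assumes hom: "comm_hom \<delta>"
    and coeff_0: "coeff (\<delta> b) 0 = b"
    and iterate: "coeff (\<delta> (coeff (\<delta> b) i)) j = of_nat ((i + j) choose i) * coeff (\<delta> b) (i + j)"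
begin

sublocale comm_hom \<delta> by (rule hom)

abbreviation A :: "'b set" where "A \<equiv> invariants \<delta>"
abbreviation deg :: "'b \<Rightarrow> nat" where "deg b \<equiv> degree (\<delta> b)"

lemma eq_0_iff [simp]: "\<delta> b = 0 \<longleftrightarrow> b = 0"
  using coeff_0[of b] zero by auto

lemma inv_iff: "b \<in> A \<longleftrightarrow> deg b = 0"
proof
  assume "deg b = 0"
  then obtain c where "\<delta> b = [:c:]" by (meson degree_eq_zeroE)
  then show "b \<in> A" using coeff_0[of b] by (simp add: invariants_def)
qed (simp add: invariants_def)

lemma invD: "b \<in> A \<Longrightarrow> \<delta> b = [:b:]"
  by (simp add: invariants_def)

lemma inv_closed [simp, intro]:
  shows "0 \<in> A" "1 \<in> A"
    and "x \<in> A \<Longrightarrow> y \<in> A \<Longrightarrow> x + y \<in> A"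
    and "x \<in> A \<Longrightarrow> y \<in> A \<Longrightarrow> x - y \<in> A"
    and "x \<in> A \<Longrightarrow> y \<in> A \<Longrightarrow> x * y \<in> A"
    and "x \<in> A \<Longrightarrow> - x \<in> A"
  by (simp_all add: invariants_def zero one add diff mult uminus one_pCons)

lemma inv_sum: "(\<And>i. i \<in> I \<Longrightarrow> f i \<in> A) \<Longrightarrow> sum f I \<in> A"
  by (induction I rule: infinite_finite_induct) auto

lemma inv_power: "x \<in> A \<Longrightarrow> x ^ n \<in> A"
  by (induction n) auto

lemma deg_mult: "x \<noteq> 0 \<Longrightarrow> y \<noteq> 0 \<Longrightarrow> deg (x * y) = deg x + deg y"
  by (simp add: mult degree_mult_eq)

text \<open>Factorial closedness: degrees add up on nonzero products, so a product of degree 0 has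
  only factors of degree 0.\<close>

lemma inv_factor:
  assumes "x * y \<in> A" "x * y \<noteq> 0" shows "x \<in> A" "y \<in> A"
  using assms deg_mult[of x y] by (auto simp: inv_iff)

lemma hom_poly_inv:
  assumes "\<And>i. coeff p i \<in> A" shows "\<delta> (poly p x) = pcompose p (\<delta> x)"
proof -
  have "map_poly \<delta> p = map_poly (\<lambda>c. [:c:]) p"
    by (rule poly_eqI) (simp add: coeff_map_poly zero invD[OF assms])
  then show ?thesis by (simp add: hom_poly pcompose_altdef)
qed

lemma deg_poly_inv:
  assumes "\<And>i. coeff p i \<in> A" shows "deg (poly p x) = degree p * deg x"
  by (simp add: hom_poly_inv[OF assms] degree_pcompose)

text \<open>This is algebraic closedness of \<open>A\<close>: a root \<open>x\<close> outside
  \<open>A\<close> makes the composition of \<open>p\<close> with the nonconstant polynomial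
  \<open>\<delta> x\<close> vanish, which forces \<open>p = 0\<close>.\<close>

lemma poly_inv_eq_0:
  assumes "\<And>i. coeff p i \<in> A" "poly p x = 0" "x \<notin> A" shows "p = 0"
proof -
  have "pcompose p (\<delta> x) = 0" using hom_poly_inv[OF assms(1)] assms(2) zero by metis
  then show ?thesis using pcompose_eq_0[of p "\<delta> x"] assms(3) by (auto simp: inv_iff)
qed

lemma poly_in_inv: "(\<And>i. coeff p i \<in> A) \<Longrightarrow> x \<in> A \<Longrightarrow> poly p x \<in> A"
  by (auto simp: poly_altdef intro!: inv_sum inv_closed inv_power)

text \<open>By \<open>iterate\<close>, the leading coefficient of \<open>\<delta> c\<close>, where
  \<open>c = coeff (\<delta> b) i\<close>, is an integer multiple of the coefficient of
  \<open>\<delta> b\<close> at \<open>i + deg c\<close>, which is therefore nonzero.\<close>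

lemma deg_coeff_le:
  assumes "coeff (\<delta> b) i \<noteq> 0" shows "deg (coeff (\<delta> b) i) + i \<le> deg b"
proof -
  define c where "c = coeff (\<delta> b) i"
  have "coeff (\<delta> c) (deg c) \<noteq> 0" using assms by (simp add: c_def)
  then have "coeff (\<delta> b) (i + deg c) \<noteq> 0" unfolding c_def using iterate[of b i] by auto
  then show ?thesis using le_degree c_def by fastforce
qed

lemma lead_inv: "lead_coeff (\<delta> b) \<in> A"
proof (cases "b = 0")
  case False
  then show ?thesis using deg_coeff_le[of b "deg b"] by (simp add: inv_iff)
qed (simp add: zero)

section \<open>The ring generated by one element over the invariants\<close>

abbreviation A_span :: "'b \<Rightarrow> 'b set" where "A_span s \<equiv> poly_span A s"

lemma A_spanI: "(\<And>i. coeff q i \<in> A) \<Longrightarrow> poly q s \<in> A_span s"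
  by (auto simp: poly_span_def)

lemma A_span_inv: "a \<in> A \<Longrightarrow> a \<in> A_span s"
  using A_spanI[of "[:a:]" s] by (simp add: coeff_pCons split: nat.split)

lemma A_span_self: "s \<in> A_span s"
  using A_spanI[of "[:0, 1:]" s] by (simp add: coeff_pCons split: nat.split)

lemma A_span_add: "x \<in> A_span s \<Longrightarrow> y \<in> A_span s \<Longrightarrow> x + y \<in> A_span s"
  by (clarsimp simp: poly_span_def) (metis poly_add coeff_add inv_closed(3))

lemma A_span_mult: assumes "x \<in> A_span s" "y \<in> A_span s" shows "x * y \<in> A_span s"
proof -
  obtain p q where *: "x = poly p s" "y = poly q s" "\<And>i. coeff p i \<in> A" "\<And>i. coeff q i \<in> A"
    using assms by (auto simp: poly_span_def)
  have "coeff (p * q) i \<in> A" for i by (auto simp: coeff_mult * intro!: inv_sum)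
  then show ?thesis using A_spanI[of "p * q" s] by (simp add: *)
qed

lemma A_span_power: "x \<in> A_span s \<Longrightarrow> x ^ n \<in> A_span s"
  by (induction n) (auto intro: A_span_mult A_span_inv)

lemma A_span_sum: "(\<And>i. i \<in> I \<Longrightarrow> f i \<in> A_span s) \<Longrightarrow> sum f I \<in> A_span s"
  by (induction I rule: infinite_finite_induct) (auto intro: A_span_add A_span_inv)

lemma A_span_trans: assumes "x \<in> A_span s" "s \<in> A_span s'" shows "x \<in> A_span s'"
proof -
  obtain q where "x = poly q s" "\<And>i. coeff q i \<in> A" using assms(1) by (auto simp: poly_span_def)
  then show ?thesis
    unfolding poly_altdef by (simp add: A_span_sum A_span_mult A_span_inv A_span_power assms(2))
qed

section \<open>Elements of least positive degree\<close>

definition min_deg :: nat where "min_deg = (LEAST m. m > 0 \<and> (\<exists>b. deg b = m))"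

lemma min_deg_le: "b \<notin> A \<Longrightarrow> min_deg \<le> deg b"
  unfolding min_deg_def by (rule Least_le) (auto simp: inv_iff)

lemma inv_if_deg_less: "deg b < min_deg \<Longrightarrow> b \<in> A"
  using min_deg_le by fastforce

lemma min_deg_witness:
  assumes "A \<noteq> UNIV" shows "min_deg > 0" "\<exists>b. deg b = min_deg"
proof -
  have "\<exists>m. m > 0 \<and> (\<exists>b. deg b = m)" using assms by (auto simp: inv_iff)
  from LeastI_ex[OF this] show "min_deg > 0" "\<exists>b. deg b = min_deg" by (auto simp: min_deg_def)
qed

lemma deg_coeff_eq:
  assumes "i \<le> deg b" "of_nat (deg b choose i) \<noteq> (0 :: 'b)"
  shows "deg (coeff (\<delta> b) i) = deg b - i"
proof (cases "b = 0")
  case False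
  let ?c = "coeff (\<delta> b) i"
  have *: "coeff (\<delta> ?c) (deg b - i) \<noteq> 0" using iterate[of b i "deg b - i"] assms False by simp
  then have "?c \<noteq> 0" using zero by force
  then show ?thesis using deg_coeff_le[of b i] le_degree[OF *] by simp
qed (simp add: zero)

text \<open>Otherwise \<open>deg_coeff_eq\<close> would produce an element of degree
  \<open>min_deg - i\<close>, strictly between 0 and \<open>min_deg\<close>. Hence
  \<open>min_deg\<close> is 1 in characteristic 0 and a power of \<open>p\<close> in characteristic
  \<open>p\<close>.\<close>

lemma binomial_min_deg:
  assumes "A \<noteq> UNIV" "0 < i" "i < min_deg" shows "of_nat (min_deg choose i) = (0 :: 'b)"
proof (rule ccontr)
  assume *: "of_nat (min_deg choose i) \<noteq> (0 :: 'b)"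
  obtain b where b: "deg b = min_deg" using min_deg_witness assms(1) by blast
  then have "deg (coeff (\<delta> b) i) = min_deg - i" using deg_coeff_eq[of i b] * assms by simp
  then show False using inv_if_deg_less[of "coeff (\<delta> b) i"] assms by (simp add: inv_iff)
qed

text \<open>Since all inner binomial coefficients of \<open>n = min_deg\<close> vanish, $(1+x)^{qn+r} =
  (1+x^n)^q(1+x)^r$, so that the coefficient of $x^r$ in it is $1$ for $r < n$.\<close>

lemma min_deg_dvd: assumes "A \<noteq> UNIV" shows "min_deg dvd deg b"
proof (rule ccontr)
  let ?n = min_deg
  assume nd: "\<not> ?n dvd deg b"
  define q r where "q = deg b div ?n" and "r = deg b mod ?n"
  have n: "?n > 0" using min_deg_witness assms by blast
  have r: "0 < r" "r < ?n" "deg b = ?n * q + r" "r \<le> deg b"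
    using nd n by (auto simp: r_def q_def mod_greater_zero_iff_not_dvd)
  define x :: "'b poly" where "x = [:1, 1:]"
  have x: "coeff (x ^ m) i = of_nat (m choose i)" for m i
    by (simp add: x_def coeff_linear_power)
  have xn: "x ^ ?n = 1 + monom 1 ?n"
  proof (rule poly_eqI)
    show "coeff (x ^ ?n) i = coeff (1 + monom 1 ?n) i" for i
      using n binomial_min_deg[OF assms, of i]
      by (cases "i = 0"; cases i ?n rule: linorder_cases) (auto simp: x binomial_eq_0)
  qed
  have "monom 1 ?n dvd x ^ ?n - 1" by (simp add: xn)
  moreover have "x ^ ?n - 1 dvd (x ^ ?n) ^ q - 1" by (simp add: power_diff_1_eq)
  ultimately have "monom 1 ?n dvd ((x ^ ?n) ^ q - 1) * x ^ r" by (meson dvd_mult2 dvd_trans)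
  then obtain g where g: "((x ^ ?n) ^ q - 1) * x ^ r = monom 1 ?n * g" by (auto simp: dvd_def)
  have "x ^ deg b - x ^ r = monom 1 ?n * g"
    unfolding g[symmetric] r(3) power_add power_mult by (simp add: left_diff_distrib)
  then have "coeff (x ^ deg b - x ^ r) r = 0" using r by (simp add: coeff_monom_mult)
  then have "of_nat (deg b choose r) = (1 :: 'b)" by (simp add: x)
  then have "deg (coeff (\<delta> b) r) = deg b - r" using deg_coeff_eq[of r b] r by simp
  \<comment> \<open>By symmetry of the binomial coefficients, the coefficient at the complementary
    index has degree \<open>r\<close>, which lies strictly between 0 and
    \<open>min_deg\<close>.\<close>
  have "of_nat (deg b choose (deg b - r)) = (1 :: 'b)"
    using \<open>of_nat (deg b choose r) = (1 :: 'b)\<close> r(4) binomial_symmetric by metis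
  then have "deg (coeff (\<delta> b) (deg b - r)) = r" using deg_coeff_eq[of "deg b - r" b] r by simp
  then show False using r inv_if_deg_less[of "coeff (\<delta> b) (deg b - r)"] by (simp add: inv_iff)
qed

text \<open>As \<open>deg b\<close> is \<open>min_deg * e\<close>, subtracting an invariant multiple
  of \<open>s ^ e\<close> from \<open>c ^ e * b\<close>, with \<open>c\<close> the leading
  coefficient of \<open>\<delta> s\<close>, kills the top coefficient and lowers the degree.\<close>

lemma lead_power_mult_in_span:
  assumes "A \<noteq> UNIV" "deg s = min_deg"
  shows "\<exists>N. lead_coeff (\<delta> s) ^ N * b \<in> A_span s"
proof (induction "deg b" arbitrary: b rule: less_induct)
  case less
  let ?c = "lead_coeff (\<delta> s)"
  have n: "min_deg > 0" using min_deg_witness assms by blast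
  have s0: "s \<noteq> 0" using assms(2) n by (auto simp: zero)
  show ?case
  proof (cases "b \<in> A")
    case True
    then show ?thesis using A_span_inv by (intro exI[of _ 0]) simp
  next
    case False
    then have b0: "b \<noteq> 0" by auto
    obtain e where e: "deg b = min_deg * e" using min_deg_dvd assms by blast
    have db: "deg b > 0" using False by (simp add: inv_iff)
    define b' where "b' = ?c ^ e * b - lead_coeff (\<delta> b) * s ^ e"
    have cA: "?c \<in> A" "lead_coeff (\<delta> b) \<in> A" using lead_inv by auto
    have D: "\<delta> b' = smult (?c ^ e) (\<delta> b) - smult (lead_coeff (\<delta> b)) (\<delta> s ^ e)"
      using invD[OF inv_power[OF cA(1)]] invD[OF cA(2)] by (simp add: b'_def diff mult power)
    have ds: "degree (\<delta> s ^ e) = deg b" using e assms s0 by (simp add: degree_power_eq)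
    have "deg b' \<le> deg b" unfolding D using ds
      by (intro degree_diff_le) (auto intro: order_trans[OF degree_smult_le])
    moreover have "coeff (\<delta> b') (deg b) = 0"
      using ds lead_coeff_power[of "\<delta> s" e] by (simp add: D)
    ultimately have "deg b' < deg b" using db
      by (metis degree_0 leading_coeff_0_iff le_neq_implies_less)
    then obtain N where N: "?c ^ N * b' \<in> A_span s" using less by blast
    have "?c ^ (N + e) * b = ?c ^ N * b' + ?c ^ N * lead_coeff (\<delta> b) * s ^ e"
      by (simp add: b'_def power_add algebra_simps)
    also have "\<dots> \<in> A_span s"
      by (intro A_span_add N A_span_mult A_span_power A_span_self A_span_inv cA inv_power)
    finally show ?thesis by blast
  qed
qed

end

text \<open>The composition law is compared at $t^i s^j$, with \<open>t\<close> the outer and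
  \<open>s\<close> the inner variable; in the expansion at $s+t$ only the term of degree
  \<open>i + j\<close> contributes there.\<close>

lemma exp_maps_iterative:
  assumes "\<delta> \<in> exp_maps S" shows "iterative_hom \<delta>"
proof (rule iterative_hom.intro)
  show "comm_hom \<delta>" using assms by unfold_locales (auto simp: exp_maps_def)
  interpret comm_hom \<delta> by fact
  show "coeff (\<delta> b) 0 = b" for b using assms by (simp add: exp_maps_def poly_0_coeff_0)
  fix b i j
  have law: "map_poly \<delta> (\<delta> b) = poly (map_poly (\<lambda>c. [:[:c:]:]) (\<delta> b)) [:[:0, 1:], 1:]"
    using assms by (simp add: exp_maps_def)
  let ?d = "degree (\<delta> b)"
  have dg: "degree (map_poly (\<lambda>c. [:[:c:]:]) (\<delta> b)) = ?d"
    by (cases "\<delta> b = 0") (auto intro: map_poly_degree_eq)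
  have pw: "([:0, 1:] :: 'a poly) ^ m = monom 1 m" for m by (simp add: monom_altdef)
  have "coeff (\<delta> (coeff (\<delta> b) i)) j = coeff (coeff (map_poly \<delta> (\<delta> b)) i) j"
    by (simp add: coeff_map_poly zero)
  also have "\<dots> = (\<Sum>m\<le>?d. coeff (coeff ([:[:coeff (\<delta> b) m:]:] * [:[:0, 1:], 1:] ^ m) i) j)"
    unfolding law poly_altdef dg by (simp add: coeff_sum coeff_map_poly)
  also have "\<dots> = (\<Sum>m\<le>?d. if m = i + j then of_nat ((i + j) choose i) * coeff (\<delta> b) (i + j) else 0)"
  proof (rule sum.cong[OF refl])
    fix m
    have "coeff (coeff ([:[:coeff (\<delta> b) m:]:] * [:[:0, 1:], 1:] ^ m) i) j
        = coeff (\<delta> b) m * (of_nat (m choose i) * coeff (monom 1 (m - i)) j)"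
      by (simp add: coeff_linear_power pw of_nat_poly del: coeff_monom)
    also have "\<dots> = (if m = i + j then of_nat ((i + j) choose i) * coeff (\<delta> b) (i + j) else 0)"
      by (auto simp: binomial_eq_0 not_le)
    finally show "coeff (coeff ([:[:coeff (\<delta> b) m:]:] * [:[:0, 1:], 1:] ^ m) i) j = \<dots>" .
  qed
  also have "\<dots> = of_nat ((i + j) choose i) * coeff (\<delta> b) (i + j)"
    by (auto simp: coeff_eq_0)
  finally show "coeff (\<delta> (coeff (\<delta> b) i)) j = of_nat ((i + j) choose i) * coeff (\<delta> b) (i + j)" .
qed

section \<open>Actions on the plane over an algebraically closed field\<close>

text \<open>Fraction-free elimination: the pivot \<open>f k\<close> clears the coefficient at index
  \<open>n\<close> from the other polynomials, so no division in the domain is needed.\<close>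

lemma linear_dependence:
  fixes f :: "'i \<Rightarrow> 'd::idom poly"
  assumes "finite I" "n < card I" "\<And>i j. i \<in> I \<Longrightarrow> j \<ge> n \<Longrightarrow> coeff (f i) j = 0"
  shows "\<exists>c. (\<exists>i\<in>I. c i \<noteq> 0) \<and> (\<Sum>i\<in>I. smult (c i) (f i)) = 0"
  using assms
proof (induction n arbitrary: I f)
  case 0
  then have "\<exists>i\<in>I. (\<lambda>_. 1 :: 'd) i \<noteq> 0" by (auto simp: card_gt_0_iff)
  moreover have "f i = 0" if "i \<in> I" for i using 0 that by (auto intro: poly_eqI)
  ultimately show ?case by (intro exI[of _ "\<lambda>_. 1"]) simp
next
  case (Suc n)
  show ?case
  proof (cases "\<forall>i\<in>I. coeff (f i) n = 0")
    case True
    then have "coeff (f i) j = 0" if "i \<in> I" "j \<ge> n" for i j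
      using Suc.prems(3)[OF that(1), of j] that by (cases "j = n") auto
    then show ?thesis using Suc.IH[of I f] Suc.prems by simp
  next
    case False
    then obtain k where k: "k \<in> I" "coeff (f k) n \<noteq> 0" by blast
    define a where "a = coeff (f k) n"
    define g where "g i = smult a (f i) - smult (coeff (f i) n) (f k)" for i
    let ?J = "I - {k}"
    have "coeff (g i) j = 0" if "i \<in> ?J" "j \<ge> n" for i j
      using Suc.prems(3)[of i j] Suc.prems(3)[of k j] that k
      by (cases "j = n") (auto simp: g_def a_def)
    moreover have "finite ?J" "n < card ?J" using Suc.prems(1,2) k by (simp_all add: less_diff_conv)
    ultimately obtain c where c: "\<exists>i\<in>?J. c i \<noteq> 0" "(\<Sum>i\<in>?J. smult (c i) (g i)) = 0"
      using Suc.IH[of ?J g] by blast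
    \<comment> \<open>Expanding the relation among the \<open>g i\<close> gives weight
      \<open>a * c i\<close> to each \<open>f i\<close> and collects the rest on the pivot
      \<open>f k\<close>.\<close>
    define c' where "c' i = (if i = k then - (\<Sum>i\<in>?J. c i * coeff (f i) n) else a * c i)" for i
    have "(\<Sum>i\<in>I. smult (c' i) (f i)) = smult (c' k) (f k) + (\<Sum>i\<in>?J. smult (c' i) (f i))"
      using Suc.prems(1) k by (simp add: sum.remove)
    also have "(\<Sum>i\<in>?J. smult (c' i) (f i)) = (\<Sum>i\<in>?J. smult (a * c i) (f i))"
      by (rule sum.cong) (auto simp: c'_def)
    also have "smult (c' k) (f k) = - (\<Sum>i\<in>?J. smult (c i * coeff (f i) n) (f k))"
      by (simp add: c'_def smult_sum)
    also have "\<dots> + (\<Sum>i\<in>?J. smult (a * c i) (f i)) = (\<Sum>i\<in>?J. smult (c i) (g i))"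
      by (simp add: g_def smult_diff_right sum_subtractf mult.commute)
    finally have "(\<Sum>i\<in>I. smult (c' i) (f i)) = 0" using c by simp
    moreover have "\<exists>i\<in>I. c' i \<noteq> 0" using c(1) k by (auto simp: c'_def a_def)
    ultimately show ?thesis by blast
  qed
qed

text \<open>Dimension count: the \<open>N * N\<close> products have degree at most
  \<open>d * N\<close>, where \<open>d\<close> is the sum of the two degrees, and
  \<open>N = d + 2\<close> makes \<open>N * N\<close> exceed \<open>d * N + 1\<close>.\<close>

lemma algebraic_dependence:
  fixes P Q :: "'d::idom poly"
  shows "\<exists>N c. (\<exists>i<N. \<exists>j<N. c i j \<noteq> 0) \<and> (\<Sum>i<N. \<Sum>j<N. smult (c i j) (P ^ i * Q ^ j)) = 0"
proof -
  define d where "d = degree P + degree Q"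
  define N where "N = d + 2"
  define f where "f = (\<lambda>(i, j). P ^ i * Q ^ j)"
  let ?I = "{..<N} \<times> {..<N}"
  have deg: "degree (P ^ i * Q ^ j) < d * N + 1" if "i < N" "j < N" for i j
  proof -
    have "degree (P ^ i * Q ^ j) \<le> degree P * i + degree Q * j"
      by (intro order_trans[OF degree_mult_le] add_mono degree_power_le)
    also have "\<dots> \<le> degree P * N + degree Q * N" using that by (intro add_mono mult_le_mono) auto
    finally show ?thesis by (simp add: d_def algebra_simps)
  qed
  have "card ?I > d * N + 1" by (simp add: N_def)
  moreover have "coeff (f p) j = 0" if "p \<in> ?I" "j \<ge> d * N + 1" for p j
    using that deg by (auto simp: f_def intro!: coeff_eq_0 intro: less_le_trans)
  ultimately obtain c where c: "\<exists>p\<in>?I. c p \<noteq> 0" "(\<Sum>p\<in>?I. smult (c p) (f p)) = 0"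
    using linear_dependence[of ?I "d * N + 1" f] by auto
  have "(\<Sum>i<N. \<Sum>j<N. smult (c (i, j)) (P ^ i * Q ^ j)) = 0"
    using c(2) by (simp add: sum.cartesian_product f_def case_prod_beta)
  then show ?thesis using c(1) by (intro exI[of _ N] exI[of _ "\<lambda>i j. c (i, j)"]) auto
qed

section \<open>Constants and the lexicographic degree\<close>

definition scal :: "'k::comm_ring_1 \<Rightarrow> 'k poly poly" where "scal c = [:[:c:]:]"

lemma scal_hom: "comm_hom scal"
  unfolding scal_def by (rule comm_hom_comp[OF const_hom const_hom])

text \<open>This degree is additive on products and, unlike the total degree, is read off a single
  coefficient. Hence it does not change when a map fixing \<open>1\<close> is applied to the coefficients of
  a polynomial whose lexicographic leading coefficient is \<open>1\<close>.\<close>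

definition lex_deg :: "'k::idom poly poly \<Rightarrow> nat" where
  "lex_deg p = degree p + degree (lead_coeff p)"

lemma lex_deg_mult: "p \<noteq> 0 \<Longrightarrow> q \<noteq> 0 \<Longrightarrow> lex_deg (p * q) = lex_deg p + lex_deg q"
  unfolding lex_deg_def lead_coeff_mult by (simp add: degree_mult_eq)

lemma lex_deg_eq_0_iff: "lex_deg p = 0 \<longleftrightarrow> p \<in> range scal"
proof
  assume *: "lex_deg p = 0"
  then obtain q where q: "p = [:q:]" by (auto simp: lex_deg_def elim: degree_eq_zeroE)
  then obtain c where "q = [:c:]" using * by (auto simp: lex_deg_def elim: degree_eq_zeroE)
  then show "p \<in> range scal" by (simp add: q scal_def)
qed (auto simp: lex_deg_def scal_def)

lemma lex_deg_diff_scal: "lex_deg (p - scal c) \<le> lex_deg p"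
proof (cases "degree p = 0")
  case True
  then obtain q where "p = [:q:]" by (auto elim: degree_eq_zeroE)
  then show ?thesis by (auto simp: lex_deg_def scal_def intro: degree_diff_le)
next
  case False
  then have "degree (- scal c) < degree p" by (simp add: scal_def)
  from degree_add_eq_left[OF this] have d: "degree (p - scal c) = degree p"
    by (simp only: add_uminus_conv_diff)
  have c: "coeff (p - scal c) (degree p) = lead_coeff p"
    using False by (simp add: scal_def coeff_pCons split: nat.split)
  show ?thesis unfolding lex_deg_def d c ..
qed

lemma nonzero_const_polyE:
  assumes "degree h = 0" "h \<noteq> 0"
  obtains a where "h = [:a:]" "a \<noteq> 0"
  using assms by (auto elim: degree_eq_zeroE)

text \<open>Modulo the prime \<open>P\<close>, an element algebraic over an algebraically closed
  field is constant: \<open>q\<close> splits into linear factors, and \<open>P\<close> divides one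
  of the resulting \<open>Q - scal r\<close>.\<close>

lemma prime_dvd_poly_scal:
  fixes P :: "'k::alg_closed_field poly poly"
  assumes "prime_elem P" "q \<noteq> 0" "P dvd poly (map_poly scal q) Q"
  shows "\<exists>c. P dvd Q - scal c"
  using assms(2,3)
proof (induction "degree q" arbitrary: q)
  case 0
  from nonzero_const_polyE[OF 0(1)[symmetric] 0(2)] obtain a where a: "q = [:a:]" "a \<noteq> 0" .
  then have "scal a * scal (inverse a) = 1" by (simp add: scal_def one_pCons)
  then have "scal a dvd 1" by (metis dvd_triv_left)
  moreover have "P dvd scal a" using 0 a by (simp add: map_poly_pCons scal_def)
  ultimately show ?case using assms(1) by (meson dvd_trans prime_elem_not_unit)
next
  case (Suc n)
  interpret S: comm_hom scal by (rule scal_hom)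
  interpret E: comm_hom "\<lambda>p. poly (map_poly scal p) Q" by (rule S.eval_hom)
  obtain r where "poly q r = 0" using alg_closed_imp_poly_has_root[of q] Suc by auto
  then obtain q' where q': "q = [:- r, 1:] * q'" by (metis dvdE poly_eq_0_iff_dvd)
  have "poly (map_poly scal q) Q = (Q - scal r) * poly (map_poly scal q') Q"
    unfolding q' E.mult by (simp add: S.eval_pCons S.zero S.one S.uminus del: map_poly_pCons)
  then have "P dvd Q - scal r \<or> P dvd poly (map_poly scal q') Q"
    using Suc.prems assms(1) by (simp add: prime_elem_dvd_mult_iff)
  moreover have "q' \<noteq> 0" "n = degree q'" using q' Suc by (auto simp: degree_mult_eq simp del: mult_pCons_left)
  ultimately show ?case using Suc.hyps(1) by blast
qed

section \<open>Invariants and minimal slices of an action on the plane\<close>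

locale plane_action = iterative_hom \<delta>
  for \<delta> :: "'k::{alg_closed_field,factorial_ring_gcd,semiring_gcd_mult_normalize} poly poly \<Rightarrow> 'k poly poly poly" +
  assumes scal_inv [simp]: "scal c \<in> invariants \<delta>"
    and nonconst: "\<not> invariants \<delta> \<subseteq> range scal"
    and nontriv: "invariants \<delta> \<noteq> UNIV"
begin

sublocale S: comm_hom scal by (rule scal_hom)

definition minimal_inv :: "'k poly poly \<Rightarrow> bool" where
  "minimal_inv P \<longleftrightarrow> P \<in> A - range scal \<and> (\<forall>Q\<in>A - range scal. lex_deg P \<le> lex_deg Q)"

lemma minimal_inv_exists: "\<exists>P. minimal_inv P"
proof -
  obtain a where "a \<in> A - range scal" using nonconst by blast
  from arg_min_nat_lemma[of "\<lambda>x. x \<in> A - range scal", OF this, of lex_deg]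
  show ?thesis unfolding minimal_inv_def by blast
qed

text \<open>This makes every translate of a minimal \<open>P\<close> prime as well, as needed when a
  polynomial in \<open>P\<close> is split into linear factors.\<close>

lemma minimal_inv_diff: assumes "minimal_inv P" shows "minimal_inv (P - scal c)"
proof -
  have "P - scal c \<notin> range scal"
  proof
    assume "P - scal c \<in> range scal"
    then obtain d where "P - scal c = scal d" by blast
    then have "P = scal (d + c)" by (simp add: S.add algebra_simps)
    then show False using assms by (auto simp: minimal_inv_def)
  qed
  then show ?thesis using assms lex_deg_diff_scal[of P c] by (auto simp: minimal_inv_def intro: order_trans)
qed

text \<open>The factors of \<open>P\<close> are invariant by factorial closedness. If neither were a
  unit, both would be nonconstant, and minimality would contradict additivity of
  \<open>lex_deg\<close>. Unique factorization in \<open>'k poly poly\<close> turns irreducible into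
  prime.\<close>

lemma minimal_inv_prime: assumes "minimal_inv P" shows "prime_elem P"
proof (rule irreducible_imp_prime_elem, rule irreducibleI)
  have P: "P \<in> A" "P \<notin> range scal" using assms by (auto simp: minimal_inv_def)
  show "P \<noteq> 0" using P(2) by (auto simp: scal_def image_iff)
  show "\<not> P dvd 1"
  proof
    assume "P dvd 1"
    then obtain Q where Q: "1 = P * Q" by (auto simp: dvd_def)
    then have "P \<noteq> 0" "Q \<noteq> 0" by auto
    then have "lex_deg P + lex_deg Q = lex_deg (1 :: 'k poly poly)"
      using lex_deg_mult[of P Q] Q by simp
    moreover have "lex_deg (1 :: 'k poly poly) = 0" by (simp add: lex_deg_def)
    ultimately have "lex_deg P = 0" by simp
    then show False using P(2) lex_deg_eq_0_iff[of P] by simp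
  qed
  have unit: "u dvd 1" if u: "u \<noteq> 0" "u \<in> range scal" for u :: "'k poly poly"
  proof -
    obtain a where a: "u = scal a" using u by blast
    then have "a \<noteq> 0" using u S.zero by auto
    then have "u * scal (inverse a) = 1" by (simp add: a S.mult[symmetric] S.one)
    then show ?thesis by (metis dvd_triv_left)
  qed
  fix u v assume uv: "P = u * v"
  have nz: "u \<noteq> 0" "v \<noteq> 0" using uv \<open>P \<noteq> 0\<close> by auto
  have inv: "u \<in> A" "v \<in> A" using inv_factor[of u v] P uv \<open>P \<noteq> 0\<close> by auto
  show "u dvd 1 \<or> v dvd 1"
  proof (rule ccontr)
    assume "\<not> (u dvd 1 \<or> v dvd 1)"
    then have "u \<notin> range scal" "v \<notin> range scal" using unit nz by auto
    then have "lex_deg P \<le> lex_deg u" "lex_deg v \<noteq> 0"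
      using assms inv lex_deg_eq_0_iff by (auto simp: minimal_inv_def)
    then show False using lex_deg_mult[OF nz] uv by simp
  qed
qed

text \<open>Any two elements of \<open>K[Y][Z]\<close> are algebraically dependent over \<open>K[Y]\<close>. Sorting such a relation
  by powers of \<open>Y\<close> yields one over \<open>K\<close>, unless \<open>Y\<close> is algebraic over the invariants and hence invariant.\<close>

lemma inv_dependent:
  assumes "P \<in> A" "Q \<in> A"
  shows "\<exists>N c. (\<exists>i<N. \<exists>j<N. c i j \<noteq> 0) \<and> (\<Sum>i<N. \<Sum>j<N. scal (c i j) * (P ^ i * Q ^ j)) = 0"
proof (cases "[:[:0, 1:]:] \<in> A")
  case True
  have Y: "[:q:] \<in> A" for q :: "'k poly"
  proof (induction q)
    case (pCons a q)
    have "[:pCons a q:] = scal a + [:[:0, 1:]:] * [:q:]" by (simp add: scal_def)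
    then show ?case using pCons True by (metis inv_closed(3,5) scal_inv)
  qed simp
  \<comment> \<open>If \<open>W\<close> involved \<open>Z\<close>, then \<open>Z\<close> would be a
    root of the nonzero polynomial \<open>?p\<close>, which is \<open>W\<close> with its variable
    renamed, minus \<open>W\<close> as a constant. So \<open>Z\<close> would be invariant, and with
    it everything.\<close>
  have deg0: "degree W = 0" if W: "W \<in> A" for W
  proof (rule ccontr)
    assume W0: "degree W \<noteq> 0"
    let ?p = "map_poly (\<lambda>q. [:q:]) W - [:W:]"
    have p: "coeff ?p i \<in> A" for i using W Y by (auto simp: coeff_map_poly coeff_pCons split: nat.split)
    have "poly ?p [:0, 1:] = 0" by (simp add: pcompose_altdef[symmetric])
    moreover have "?p \<noteq> 0"
    proof
      assume "?p = 0"
      then have "coeff ?p (degree W) = 0" by simp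
      then have "lead_coeff W = 0"
        using W0 by (simp add: coeff_map_poly coeff_pCons del: leading_coeff_0_iff split: nat.splits)
      then show False using W0 by simp
    qed
    ultimately have Z: "[:0, 1:] \<in> A" using poly_inv_eq_0[OF p] by blast
    have "V \<in> A" for V
    proof (induction V)
      case (pCons a q)
      have "pCons a q = [:a:] + [:0, 1:] * q" by simp
      then show ?case using pCons Z Y by (metis inv_closed(3,5))
    qed simp
    then show False using nontriv by blast
  qed
  obtain p q where pq: "P = [:p:]" "Q = [:q:]" using deg0[OF assms(1)] deg0[OF assms(2)] by (meson degree_eq_zeroE)
  interpret C: comm_hom "\<lambda>c :: 'k poly. [:c:]" by (rule const_hom)
  obtain N c where c: "\<exists>i<N. \<exists>j<N. c i j \<noteq> 0" "(\<Sum>i<N. \<Sum>j<N. smult (c i j) (p ^ i * q ^ j)) = 0"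
    using algebraic_dependence[of p q] by blast
  have "(\<Sum>i<N. \<Sum>j<N. scal (c i j) * (P ^ i * Q ^ j)) = [:\<Sum>i<N. \<Sum>j<N. smult (c i j) (p ^ i * q ^ j):]"
    unfolding C.sum by (simp add: pq scal_def C.power[symmetric] mult.commute)
  also have "\<dots> = 0" by (simp add: c(2))
  finally show ?thesis using c(1) by (intro exI[of _ N] exI[of _ c]) blast
next
  case False
  obtain N c where c: "\<exists>i<N. \<exists>j<N. c i j \<noteq> 0" "(\<Sum>i<N. \<Sum>j<N. smult (c i j) (P ^ i * Q ^ j)) = 0"
    using algebraic_dependence[of P Q] by blast
  define g where "g m = (\<Sum>i<N. \<Sum>j<N. scal (coeff (c i j) m) * (P ^ i * Q ^ j))" for m
  have g: "g m \<in> A" for m unfolding g_def using assms by (auto intro!: inv_sum inv_closed inv_power)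
  obtain i j where ij: "i < N" "j < N" "c i j \<noteq> 0" using c by blast
  define M where "M = (\<Sum>i<N. \<Sum>j<N. degree (c i j))"
  have M: "degree (c i j) \<le> M" if "i < N" "j < N" for i j
  proof -
    have "degree (c i j) \<le> (\<Sum>j<N. degree (c i j))" by (rule member_le_sum) (use that in auto)
    also have "\<dots> \<le> M" unfolding M_def
      by (rule member_le_sum[where f = "\<lambda>i. \<Sum>j<N. degree (c i j)"]) (use that in auto)
    finally show ?thesis .
  qed
  let ?p = "\<Sum>m\<le>M. monom (g m) m"
  have cp: "coeff ?p m = (if m \<le> M then g m else 0)" for m by (simp add: coeff_sum)
  have ycoeff: "(\<Sum>m\<le>M. scal (coeff d m) * [:[:0, 1:]:] ^ m) = [:d:]" if "degree d \<le> M" for d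
  proof -
    have "(\<Sum>m\<le>M. scal (coeff d m) * [:[:0, 1:]:] ^ m) = [:\<Sum>m\<le>M. monom (coeff d m) m:]"
      by (simp add: comm_hom.sum[OF const_hom] scal_def comm_hom.power[OF const_hom, symmetric] monom_altdef)
    also have "\<dots> = [:d:]" using that by (simp add: poly_as_sum_of_monoms')
    finally show ?thesis .
  qed
  have "poly ?p [:[:0, 1:]:] = (\<Sum>m\<le>M. g m * [:[:0, 1:]:] ^ m)" by (simp add: poly_sum poly_monom)
  also have "\<dots> = (\<Sum>m\<le>M. \<Sum>i<N. \<Sum>j<N. (P ^ i * Q ^ j) * (scal (coeff (c i j) m) * [:[:0, 1:]:] ^ m))"
    unfolding g_def sum_distrib_right by (intro sum.cong refl) (simp only: ac_simps)
  also have "\<dots> = (\<Sum>i<N. \<Sum>j<N. \<Sum>m\<le>M. (P ^ i * Q ^ j) * (scal (coeff (c i j) m) * [:[:0, 1:]:] ^ m))"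
    unfolding sum.swap[where A = "{..M}"] ..
  also have "\<dots> = (\<Sum>i<N. \<Sum>j<N. smult (c i j) (P ^ i * Q ^ j))"
    unfolding sum_distrib_left[symmetric] by (intro sum.cong refl) (simp add: ycoeff M)
  finally have "poly ?p [:[:0, 1:]:] = 0" using c by simp
  then have "?p = 0" using poly_inv_eq_0[of ?p "[:[:0, 1:]:]"] g cp False by simp
  then have g0: "g m = 0" if "m \<le> M" for m using cp[of m] that by simp
  \<comment> \<open>This power of \<open>Y\<close> keeps the relation nontrivial: its entry at
    \<open>i\<close>, \<open>j\<close> is the leading coefficient of \<open>c i j\<close>.\<close>
  let ?m = "degree (c i j)"
  have "g ?m = 0" using g0 M ij by blast
  moreover have "coeff (c i j) ?m \<noteq> 0" using ij by simp
  ultimately show ?thesis using ij unfolding g_def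
    by (intro exI[of _ N] exI[of _ "\<lambda>i j. coeff (c i j) ?m"]) blast
qed

text \<open>An algebraic relation between \<open>P\<close> and \<open>Q\<close> is divided by the
  highest possible power of \<open>P\<close>; modulo \<open>P\<close> there remains a nonzero
  polynomial over the constants that vanishes at \<open>Q\<close>.\<close>

lemma minimal_inv_dvd_diff:
  assumes P: "minimal_inv P" and Q: "Q \<in> A" shows "\<exists>c. P dvd Q - scal c"
proof -
  have PA: "P \<in> A" "P \<noteq> 0" using P minimal_inv_prime[OF P] by (auto simp: minimal_inv_def)
  obtain N c where c: "\<exists>i<N. \<exists>j<N. c i j \<noteq> 0" "(\<Sum>i<N. \<Sum>j<N. scal (c i j) * (P ^ i * Q ^ j)) = 0"
    using inv_dependent[OF PA(1) Q] by blast
  define k where "k = (LEAST i. i < N \<and> (\<exists>j<N. c i j \<noteq> 0))"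
  have k: "k < N" "\<exists>j<N. c k j \<noteq> 0"
    using LeastI_ex[of "\<lambda>i. i < N \<and> (\<exists>j<N. c i j \<noteq> 0)"] c(1) unfolding k_def by blast+
  have less: "c i j = 0" if "i < k" "j < N" for i j
    using not_less_Least[of i "\<lambda>i. i < N \<and> (\<exists>j<N. c i j \<noteq> 0)"] that k unfolding k_def by auto
  define q where "q = (\<Sum>j<N. monom (c k j) j)"
  have cq: "coeff q j = (if j < N then c k j else 0)" for j by (simp add: q_def coeff_sum)
  obtain j where "j < N" "c k j \<noteq> 0" using k(2) by blast
  then have "coeff q j \<noteq> 0" by (simp add: cq)
  then have "q \<noteq> 0" by auto
  have pq: "poly (map_poly scal q) Q = (\<Sum>j<N. scal (c k j) * Q ^ j)"
    unfolding q_def comm_hom.sum[OF S.eval_hom] by (simp add: map_poly_monom S.zero poly_monom)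
  define r where "r = (\<Sum>i\<in>{k<..<N}. \<Sum>j<N. scal (c i j) * (P ^ (i - Suc k) * Q ^ j))"
  have "0 = (\<Sum>i\<in>{..<k} \<union> ({k} \<union> {k<..<N}). \<Sum>j<N. scal (c i j) * (P ^ i * Q ^ j))"
    unfolding c(2)[symmetric] using k by (intro sum.cong) auto
  also have "\<dots> = (\<Sum>j<N. scal (c k j) * (P ^ k * Q ^ j)) + (\<Sum>i\<in>{k<..<N}. \<Sum>j<N. scal (c i j) * (P ^ i * Q ^ j))"
    by (subst sum.union_disjoint, simp, simp, force) (simp add: less S.zero)
  also have "(\<Sum>i\<in>{k<..<N}. \<Sum>j<N. scal (c i j) * (P ^ i * Q ^ j)) = P ^ Suc k * r"
    unfolding r_def sum_distrib_left
  proof (intro sum.cong refl)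
    fix i j assume "i \<in> {k<..<N}"
    then have "P ^ i = P ^ Suc k * P ^ (i - Suc k)" by (simp flip: power_add power_Suc)
    then show "scal (c i j) * (P ^ i * Q ^ j) = P ^ Suc k * (scal (c i j) * (P ^ (i - Suc k) * Q ^ j))"
      by (simp only: ac_simps)
  qed
  also have "(\<Sum>j<N. scal (c k j) * (P ^ k * Q ^ j)) = P ^ k * poly (map_poly scal q) Q"
    unfolding pq sum_distrib_left by (simp add: ac_simps)
  finally have "P ^ k * (poly (map_poly scal q) Q + P * r) = 0" by (simp add: algebra_simps)
  then have "poly (map_poly scal q) Q = P * - r" using PA(2) by (simp add: eq_neg_iff_add_eq_0)
  then show ?thesis using prime_dvd_poly_scal[OF minimal_inv_prime[OF P] \<open>q \<noteq> 0\<close>] by auto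
qed

text \<open>Write \<open>Q = scal c + P * R\<close>: by factorial closedness \<open>R\<close> is
  invariant, and its \<open>lex_deg\<close> is smaller.\<close>

lemma inv_eq_poly_minimal:
  assumes P: "minimal_inv P" and Q: "Q \<in> A" shows "\<exists>h. Q = poly (map_poly scal h) P"
  using Q
proof (induction "lex_deg Q" arbitrary: Q rule: less_induct)
  case less
  have PA: "P \<in> A" "P \<notin> range scal" using P by (auto simp: minimal_inv_def)
  show ?case
  proof (cases "Q \<in> range scal")
    case True
    then obtain c where "Q = scal c" by blast
    then show ?thesis by (intro exI[of _ "[:c:]"]) (simp add: S.eval_pCons)
  next
    case False
    obtain c R where R: "Q - scal c = P * R" using minimal_inv_dvd_diff[OF P less.prems] by (auto simp: dvd_def)
    have "Q - scal c \<noteq> 0" using False by auto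
    then have nz: "P \<noteq> 0" "R \<noteq> 0" "P * R \<noteq> 0" using R by auto
    have "P * R \<in> A" using less.prems R[symmetric] by simp
    then have "R \<in> A" using inv_factor nz by blast
    moreover have "lex_deg R < lex_deg Q"
      using lex_deg_mult[OF nz(1,2)] lex_deg_diff_scal[of Q c] lex_deg_eq_0_iff[of P] PA R by simp
    ultimately obtain h where "R = poly (map_poly scal h) P" using less.hyps by blast
    then have "Q = poly (map_poly scal (pCons c h)) P" using R by (simp add: S.eval_pCons algebra_simps)
    then show ?thesis by blast
  qed
qed

text \<open>Invariants are constant modulo \<open>P\<close>, so \<open>P * b = q(s) + P * r\<close>
  with \<open>q\<close> over the constants and \<open>r\<close> in \<open>A_span s\<close>. If
  \<open>q\<close> is nonzero, \<open>P\<close> divides some \<open>s - scal d\<close>, and the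
  quotient has the same degree as \<open>s\<close> but a leading coefficient smaller by the factor
  \<open>P\<close>, against the choice of \<open>s\<close>.\<close>

lemma span_cancel_minimal:
  assumes P: "minimal_inv P" and s: "deg s = min_deg"
    and min: "\<And>s'. deg s' = min_deg \<Longrightarrow> lex_deg (lead_coeff (\<delta> s)) \<le> lex_deg (lead_coeff (\<delta> s'))"
    and b: "P * b \<in> A_span s"
  shows "b \<in> A_span s"
proof -
  have PA: "P \<in> A" "P \<notin> range scal" "P \<noteq> 0" using P S.zero by (auto simp: minimal_inv_def)
  obtain p where p: "P * b = poly p s" "\<And>i. coeff p i \<in> A" using b by (auto simp: poly_span_def)
  have "\<forall>i. \<exists>c R. coeff p i = scal c + P * R \<and> R \<in> A"
  proof
    fix i
    obtain c R where R: "coeff p i - scal c = P * R"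
      using minimal_inv_dvd_diff[OF P p(2)[of i]] by (auto simp: dvd_def)
    have "P * R \<in> A" using p(2)[of i] R[symmetric] by simp
    then have "R \<in> A" using PA inv_factor[of P R] by (cases "R = 0") auto
    then show "\<exists>c R. coeff p i = scal c + P * R \<and> R \<in> A"
      using R by (metis add.commute diff_add_cancel)
  qed
  then obtain c R where cR: "\<And>i. coeff p i = scal (c i) + P * R i" "\<And>i. R i \<in> A" by metis
  define q where "q = (\<Sum>i\<le>degree p. monom (c i) i)"
  define r where "r = (\<Sum>i\<le>degree p. R i * s ^ i)"
  have r: "r \<in> A_span s" unfolding r_def
    by (simp add: A_span_sum A_span_mult A_span_inv A_span_power A_span_self cR)
  have pq: "poly (map_poly scal q) s = (\<Sum>i\<le>degree p. scal (c i) * s ^ i)"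
    unfolding q_def comm_hom.sum[OF S.eval_hom] by (simp add: map_poly_monom S.zero poly_monom)
  have eq: "P * b = poly (map_poly scal q) s + P * r"
    unfolding p(1) pq r_def poly_altdef[of p] cR(1) sum_distrib_left sum.distrib[symmetric]
    by (intro sum.cong refl) (simp add: algebra_simps)
  then have *: "poly (map_poly scal q) s = P * (b - r)" by (simp add: algebra_simps)
  show ?thesis
  proof (cases "q = 0")
    case True
    then have "b = r" using * PA by simp
    then show ?thesis using r by simp
  next
    case False
    then obtain d t where t: "s - scal d = P * t"
      using prime_dvd_poly_scal[OF minimal_inv_prime[OF P]] * by (metis dvd_def)
    have s_eq: "\<delta> s = [:scal d:] + smult P (\<delta> t)"
    proof -
      have "s = scal d + P * t" using t by (simp add: algebra_simps)
      then show ?thesis using invD[OF scal_inv[of d]] invD[OF PA(1)] by (simp add: add mult)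
    qed
    have n: "min_deg > 0" using min_deg_witness nontriv by blast
    have "degree (smult P (\<delta> t)) = min_deg"
    proof -
      have "degree [:scal d:] < degree (\<delta> s)" using s n by simp
      moreover have "smult P (\<delta> t) = \<delta> s + - [:scal d:]" using s_eq by simp
      ultimately show ?thesis using degree_add_eq_left[of "- [:scal d:]" "\<delta> s"] s by simp
    qed
    then have dt: "deg t = min_deg" using PA by simp
    have "coeff (\<delta> s) min_deg = P * coeff (\<delta> t) min_deg"
      using n unfolding s_eq by (simp add: coeff_pCons split: nat.split)
    then have "lead_coeff (\<delta> s) = P * lead_coeff (\<delta> t)" using s dt by simp
    moreover have "\<delta> t \<noteq> 0" using dt n by (metis degree_0 less_irrefl)
    then have "lead_coeff (\<delta> t) \<noteq> 0" by simp
    ultimately have "lex_deg (lead_coeff (\<delta> s)) = lex_deg P + lex_deg (lead_coeff (\<delta> t))"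
      using PA lex_deg_mult by metis
    then show ?thesis using min[OF dt] lex_deg_eq_0_iff[of P] PA by simp
  qed
qed

text \<open>A power of the leading coefficient of \<open>\<delta> s\<close> carries \<open>b\<close>
  into \<open>A_span s\<close>. It is a polynomial in \<open>P\<close>, hence a constant times
  factors \<open>P - scal r\<close>, which \<open>span_cancel_minimal\<close> removes one by
  one.\<close>

lemma span_minimal_slice:
  assumes s: "deg s = min_deg"
    and min: "\<And>s'. deg s' = min_deg \<Longrightarrow> lex_deg (lead_coeff (\<delta> s)) \<le> lex_deg (lead_coeff (\<delta> s'))"
  shows "b \<in> A_span s"
proof -
  obtain P where P: "minimal_inv P" using minimal_inv_exists by blast
  have cancel: "b \<in> A_span s" if "h \<noteq> 0" "poly (map_poly scal h) P * b \<in> A_span s" for h b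
    using that
  proof (induction "degree h" arbitrary: h)
    case 0
    from nonzero_const_polyE[OF 0(1)[symmetric] 0(2)] obtain a where a: "h = [:a:]" "a \<noteq> 0" .
    then have "scal a * b \<in> A_span s" using 0 by (simp add: S.eval_pCons)
    then have "scal (inverse a) * (scal a * b) \<in> A_span s"
      by (rule A_span_mult[OF A_span_inv[OF scal_inv]])
    moreover have "scal (inverse a) * (scal a * b) = b"
      using a by (simp add: S.mult[symmetric] S.one mult.assoc[symmetric])
    ultimately show ?case by simp
  next
    case (Suc n)
    interpret E: comm_hom "\<lambda>p. poly (map_poly scal p) P" by (rule S.eval_hom)
    obtain r where "poly h r = 0" using alg_closed_imp_poly_has_root[of h] Suc by auto
    then obtain h' where h': "h = [:- r, 1:] * h'" by (metis dvdE poly_eq_0_iff_dvd)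
    have "poly (map_poly scal h) P = (P - scal r) * poly (map_poly scal h') P"
      unfolding h' E.mult by (simp add: S.eval_pCons S.zero S.one S.uminus)
    then have "(P - scal r) * (poly (map_poly scal h') P * b) \<in> A_span s"
      using Suc.prems by (simp add: mult.assoc)
    then have "poly (map_poly scal h') P * b \<in> A_span s"
      using span_cancel_minimal[OF minimal_inv_diff[OF P, of r] s] min by blast
    moreover have "h' \<noteq> 0" "n = degree h'" using h' Suc by (auto simp: degree_mult_eq simp del: mult_pCons_left)
    ultimately show ?case using Suc.hyps(1) by blast
  qed
  obtain N where N: "lead_coeff (\<delta> s) ^ N * b \<in> A_span s"
    using lead_power_mult_in_span[OF nontriv s] by blast
  have "lead_coeff (\<delta> s) ^ N \<in> A" using lead_inv inv_power by blast
  then obtain h where h: "lead_coeff (\<delta> s) ^ N = poly (map_poly scal h) P"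
    using inv_eq_poly_minimal[OF P] by blast
  have "deg s \<noteq> 0" using s min_deg_witness nontriv by simp
  then have "s \<noteq> 0" by (auto simp: zero)
  then have "h \<noteq> 0" using h by auto
  moreover have "poly (map_poly scal h) P * b \<in> A_span s" using N h by simp
  ultimately show ?thesis by (rule cancel)
qed

end

section \<open>Descent of the generators along a field extension\<close>

lemma comm_hom_poly2_eqI:
  fixes f g :: "'a::comm_ring_1 poly poly \<Rightarrow> 'b::comm_ring_1"
  assumes f: "comm_hom f" and g: "comm_hom g"
    and "\<And>c. f (scal c) = g (scal c)" "f [:[:0, 1:]:] = g [:[:0, 1:]:]" "f [:0, 1:] = g [:0, 1:]"
  shows "f p = g p"
proof (rule comm_hom_poly_eqI[OF f g])
  show "f [:q:] = g [:q:]" for q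
    by (rule comm_hom_poly_eqI[OF comm_hom_comp[OF f const_hom] comm_hom_comp[OF g const_hom]])
      (use assms in \<open>simp_all add: scal_def\<close>)
qed (rule assms)

lemma (in comm_hom) map_poly2_scal: "map_poly (map_poly h) (scal c) = scal (h c)"
  by (simp add: scal_def map_poly_pCons zero)

lemma (in comm_hom) map_poly_inj: assumes "inj h" shows "inj (map_poly h)"
proof (rule injI)
  fix p q assume "map_poly h p = map_poly h q"
  then have "h (coeff p i) = h (coeff q i)" for i by (metis coeff_map_poly zero)
  then show "p = q" using assms by (auto intro: poly_eqI dest: injD)
qed

lemma additive_map_poly:
  assumes "\<And>x y. l (x + y) = l x + (l y :: 'b::comm_monoid_add)" "l (0 :: 'a::comm_monoid_add) = 0"
  shows "map_poly l (p + q) = map_poly l p + map_poly l q"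
  using assms by (intro poly_eqI) (simp add: coeff_map_poly)

text \<open>The intended \<open>\<iota>\<close> embeds a domain into an algebraically closed field
  \<open>K\<close> containing its fraction field. The map \<open>l\<close> is a linear retraction of
  \<open>K\<close> onto that fraction field, viewed as a map into \<open>K\<close>;
  \<open>l_frac\<close> says that its values are fractions.\<close>

locale scalar_extension = iterative_hom \<delta> + I: comm_hom \<iota>
  for \<delta> :: "'d::idom poly poly \<Rightarrow> 'd poly poly poly"
    and \<iota> :: "'d \<Rightarrow> 'k::{alg_closed_field,factorial_ring_gcd,semiring_gcd_mult_normalize}" +
  fixes l :: "'k \<Rightarrow> 'k"
  assumes inj: "inj \<iota>"
    and l_add: "l (x + y) = l x + l y"
    and l_mult: "l (\<iota> d * x) = \<iota> d * l x"
    and l_1: "l 1 = 1"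
    and l_frac: "\<exists>d e. d \<noteq> 0 \<and> \<iota> d * l x = \<iota> e"
    and scal_inv: "scal d \<in> invariants \<delta>"
    and nonconst: "\<not> invariants \<delta> \<subseteq> range scal"
    and nontriv: "invariants \<delta> \<noteq> UNIV"
begin

sublocale I1: comm_hom "map_poly \<iota>" by (rule I.map_poly_hom)
sublocale H: comm_hom "map_poly (map_poly \<iota>)" by (rule I1.map_poly_hom)
sublocale H': comm_hom "map_poly (map_poly (map_poly \<iota>))" by (rule H.map_poly_hom)
sublocale S: comm_hom "scal :: 'k \<Rightarrow> _" by (rule scal_hom)
sublocale S': comm_hom "scal :: 'd \<Rightarrow> _" by (rule scal_hom)

abbreviation \<eta> :: "'d poly poly \<Rightarrow> 'k poly poly" where "\<eta> \<equiv> map_poly (map_poly \<iota>)"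

lemma \<eta>_eq_iff: "\<eta> p = \<eta> q \<longleftrightarrow> p = q"
  using I1.map_poly_inj[OF I.map_poly_inj[OF inj]] by (auto dest: injD)

lemma \<eta>_scal: "\<eta> (scal d) = scal (\<iota> d)" by (rule I.map_poly2_scal)

text \<open>The image of \<open>\<eta>\<close> spans $K[Y,Z]$ over \<open>K\<close>, so an additive
  property need only be checked on products of a constant and an element of this image.\<close>

lemma span_induct:
  fixes b :: "'k poly poly"
  assumes add: "\<And>x y. Q x \<Longrightarrow> Q y \<Longrightarrow> Q (x + y)" and base: "\<And>c m. Q (scal c * \<eta> m)"
  shows "Q b"
proof -
  have Q0: "Q 0" using base[of 0 0] by simp
  have Qsum: "Q (sum f J)" if "\<And>i. i \<in> J \<Longrightarrow> Q (f i)" for f and J :: "nat set"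
    using that by (induction J rule: infinite_finite_induct) (auto simp: Q0 add)
  have "monom (monom c j) i = scal c * \<eta> (monom (monom 1 j) i)" for c i j
    by (simp add: map_poly_monom I.zero I1.zero I.one scal_def smult_monom)
  then have Qm: "Q (monom (monom c j) i)" for c i j using base by simp
  have "Q (monom q i)" for q i
  proof -
    have "monom q i = (\<Sum>j\<le>degree q. monom (monom (coeff q j) j) i)"
      by (subst (1) poly_as_sum_of_monoms[of q, symmetric]) (rule poly_eqI, simp add: coeff_sum)
    then show ?thesis using Qsum Qm by simp
  qed
  then have "Q (\<Sum>i\<le>degree b. monom (coeff b i) i)" by (intro Qsum)
  then show ?thesis by (simp add: poly_as_sum_of_monoms)
qed

text \<open>The extension of \<open>\<delta>\<close> to $K[Y,Z]$ as a homomorphism of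
  \<open>K\<close>-algebras, determined by the images of \<open>Y\<close> and
  \<open>Z\<close>.\<close>

definition \<delta>K :: "'k poly poly \<Rightarrow> 'k poly poly poly" where
  "\<delta>K b = poly (map_poly (\<lambda>q. poly (map_poly (\<lambda>c. [:scal c:]) q) (map_poly \<eta> (\<delta> [:[:0, 1:]:]))) b)
    (map_poly \<eta> (\<delta> [:0, 1:]))"

lemma \<delta>K_hom: "comm_hom \<delta>K"
  unfolding \<delta>K_def by (rule comm_hom.eval_hom, rule comm_hom.eval_hom, rule comm_hom_comp[OF const_hom S.comm_hom_axioms])

sublocale DK: comm_hom \<delta>K by (rule \<delta>K_hom)

lemma \<delta>K_scal: "\<delta>K (scal c) = [:scal c:]"
  unfolding \<delta>K_def by (subst (1) scal_def) (simp add: map_poly_pCons S.zero)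

lemma \<delta>K_\<eta>: "\<delta>K (\<eta> b) = map_poly \<eta> (\<delta> b)"
proof (rule comm_hom_poly2_eqI[of "\<lambda>b. \<delta>K (\<eta> b)" "\<lambda>b. map_poly \<eta> (\<delta> b)"])
  show "comm_hom (\<lambda>b. \<delta>K (\<eta> b))" by (rule comm_hom_comp[OF \<delta>K_hom H.comm_hom_axioms])
  show "comm_hom (\<lambda>b. map_poly \<eta> (\<delta> b))" by (rule comm_hom_comp[OF H'.comm_hom_axioms hom])
  show "\<delta>K (\<eta> (scal c)) = map_poly \<eta> (\<delta> (scal c))" for c
    using invD[OF scal_inv[of c]] by (simp add: \<eta>_scal \<delta>K_scal map_poly_pCons H.zero)
  show "\<delta>K (\<eta> [:[:0, 1:]:]) = map_poly \<eta> (\<delta> [:[:0, 1:]:])"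
    unfolding \<delta>K_def by (simp add: map_poly_pCons I.zero I1.zero I.one S.zero S.one)
  show "\<delta>K (\<eta> [:0, 1:]) = map_poly \<eta> (\<delta> [:0, 1:])"
    unfolding \<delta>K_def by (simp add: map_poly_pCons I.zero I1.zero I.one S.zero S.one)
qed

lemma \<delta>K_scal_\<eta>: "\<delta>K (scal c * \<eta> m) = smult (scal c) (map_poly \<eta> (\<delta> m))"
  by (simp add: DK.mult \<delta>K_scal \<delta>K_\<eta>)

lemma \<delta>K_iterative: "iterative_hom \<delta>K"
proof (rule iterative_hom.intro)
  show "comm_hom \<delta>K" by (rule \<delta>K_hom)
  show "coeff (\<delta>K b) 0 = b" for b
    by (rule span_induct[of "\<lambda>b. coeff (\<delta>K b) 0 = b"])
      (simp_all add: DK.add \<delta>K_scal_\<eta> coeff_map_poly H.zero coeff_0)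
  show "coeff (\<delta>K (coeff (\<delta>K b) i)) j = of_nat ((i + j) choose i) * coeff (\<delta>K b) (i + j)" for b i j
  proof (rule span_induct[of "\<lambda>b. coeff (\<delta>K (coeff (\<delta>K b) i)) j = of_nat ((i + j) choose i) * coeff (\<delta>K b) (i + j)"])
    fix c m
    show "coeff (\<delta>K (coeff (\<delta>K (scal c * \<eta> m)) i)) j
        = of_nat ((i + j) choose i) * coeff (\<delta>K (scal c * \<eta> m)) (i + j)"
      by (simp add: \<delta>K_scal_\<eta> coeff_map_poly H.zero iterate H.mult H.of_nat)
  qed (simp add: DK.add ring_distribs)
qed

sublocale DKI: iterative_hom \<delta>K by (rule \<delta>K_iterative)

lemma deg_\<eta>: "DKI.deg (\<eta> b) = deg b"
proof (cases "\<delta> b = 0")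
  case True
  then show ?thesis by (simp add: zero DK.zero)
next
  case False
  then have "\<eta> (lead_coeff (\<delta> b)) \<noteq> \<eta> 0" unfolding \<eta>_eq_iff by simp
  then have "\<eta> (lead_coeff (\<delta> b)) \<noteq> 0" by (simp only: H.zero not_False_eq_True)
  then show ?thesis unfolding \<delta>K_\<eta> by (rule map_poly_degree_eq)
qed

lemma inv_\<eta>: "\<eta> b \<in> DKI.A \<longleftrightarrow> b \<in> A"
  by (simp only: DKI.inv_iff inv_iff deg_\<eta>)

lemma \<eta>_range_scal: "\<eta> b \<in> range scal \<longleftrightarrow> b \<in> range scal"
proof
  assume "\<eta> b \<in> range scal"
  then obtain c where c: "\<eta> b = scal c" by blast
  have "b = scal (coeff (coeff b 0) 0)"
  proof (rule poly_eqI, rule poly_eqI)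
    fix i j
    have "\<iota> (coeff (coeff b i) j) = coeff (coeff (scal c) i) j"
      unfolding c[symmetric] by (simp add: coeff_map_poly I.zero I1.zero)
    then have "coeff (coeff b i) j = 0" if "i \<noteq> 0 \<or> j \<noteq> 0"
      using that inj_eq[OF inj, of _ 0] by (auto simp: scal_def coeff_pCons I.zero split: nat.splits)
    then show "coeff (coeff b i) j = coeff (coeff (scal (coeff (coeff b 0) 0)) i) j"
      by (auto simp: scal_def coeff_pCons split: nat.splits)
  qed
  then show "b \<in> range scal" by (metis rangeI)
qed (auto simp: \<eta>_scal)

sublocale PA: plane_action \<delta>K
proof (unfold_locales)
  show "scal c \<in> DKI.A" for c by (simp add: invariants_def \<delta>K_scal)
  show "\<not> DKI.A \<subseteq> range scal" using nonconst inv_\<eta> \<eta>_range_scal by blast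
  show "DKI.A \<noteq> UNIV" using nontriv inv_\<eta> by blast
qed

section \<open>The retraction applied to coefficients\<close>

abbreviation L :: "'k poly poly \<Rightarrow> 'k poly poly" where "L \<equiv> map_poly (map_poly l)"

lemma l_0: "l 0 = 0"
  using l_mult[of 0 0] by (simp add: I.zero)

lemma L_add: "L (x + y) = L x + L y"
  by (intro additive_map_poly) (simp_all add: l_add l_0)

lemma L_0: "L 0 = 0" by simp

lemma L_scal_\<eta>: "L (scal c * \<eta> m) = scal (l c) * \<eta> m"
proof (rule poly_eqI, rule poly_eqI)
  fix i j
  have "l (c * \<iota> (coeff (coeff m i) j)) = l c * \<iota> (coeff (coeff m i) j)"
    using l_mult[of "coeff (coeff m i) j" c] by (simp add: mult.commute)
  then show "coeff (coeff (L (scal c * \<eta> m)) i) j = coeff (coeff (scal (l c) * \<eta> m) i) j"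
    by (simp add: scal_def coeff_map_poly l_0 I.zero I1.zero)
qed

lemma L_\<eta>: "L (\<eta> m) = \<eta> m"
  using L_scal_\<eta>[of 1 m] by (simp add: l_1 S.one)

lemma L_mult_\<eta>: "L (x * \<eta> m) = L x * \<eta> m"
proof (rule span_induct[of "\<lambda>x. L (x * \<eta> m) = L x * \<eta> m"])
  show "L (scal c * \<eta> n * \<eta> m) = L (scal c * \<eta> n) * \<eta> m" for c n
    unfolding mult.assoc H.mult[symmetric] L_scal_\<eta> ..
qed (simp add: L_add ring_distribs)

text \<open>On \<open>scal c * \<eta> m\<close> the retraction touches only the first factor and the
  action only the second, so they commute.\<close>

lemma \<delta>K_L: "\<delta>K (L b) = map_poly L (\<delta>K b)"
proof (rule span_induct[of "\<lambda>b. \<delta>K (L b) = map_poly L (\<delta>K b)"])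
  fix c m
  show "\<delta>K (L (scal c * \<eta> m)) = map_poly L (\<delta>K (scal c * \<eta> m))"
    by (rule poly_eqI) (simp add: L_scal_\<eta> \<delta>K_scal_\<eta> coeff_map_poly L_0 H.zero)
qed (simp add: L_add DK.add additive_map_poly L_0)

lemma L_inv: "b \<in> DKI.A \<Longrightarrow> L b \<in> DKI.A"
  by (simp add: invariants_def \<delta>K_L map_poly_pCons)

lemma L_monic:
  assumes "lead_coeff (lead_coeff p) = 1" shows "lex_deg (L p) = lex_deg p" "L p \<noteq> 0"
proof -
  have 1: "degree (map_poly l (lead_coeff p)) = degree (lead_coeff p)"
    by (rule map_poly_degree_eq) (simp add: assms l_1)
  have 2: "map_poly l (lead_coeff p) \<noteq> 0"
  proof
    assume "map_poly l (lead_coeff p) = 0"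
    then have "coeff (map_poly l (lead_coeff p)) (degree (lead_coeff p)) = 0" by simp
    then show False by (simp add: coeff_map_poly l_0 assms l_1)
  qed
  then have 3: "degree (L p) = degree p" by (intro map_poly_degree_eq)
  show "lex_deg (L p) = lex_deg p" unfolding lex_deg_def 3 by (simp add: coeff_map_poly 1)
  have "coeff (L p) (degree p) \<noteq> 0" using 2 by (simp add: coeff_map_poly)
  then show "L p \<noteq> 0" by auto
qed

section \<open>Clearing denominators\<close>

lemma l_denom: "\<exists>d p'. d \<noteq> 0 \<and> smult (\<iota> d) (map_poly l p) = map_poly \<iota> p'"
proof (induction p)
  case 0
  show ?case by (intro exI[of _ 1] exI[of _ 0]) simp
next
  case (pCons a p)
  then obtain d p' where 1: "d \<noteq> 0" "smult (\<iota> d) (map_poly l p) = map_poly \<iota> p'" by blast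
  obtain e a' where 2: "e \<noteq> 0" "\<iota> e * l a = \<iota> a'" using l_frac by blast
  have "smult (\<iota> (d * e)) (map_poly l (pCons a p))
      = pCons (\<iota> d * (\<iota> e * l a)) (smult (\<iota> e) (smult (\<iota> d) (map_poly l p)))"
    by (simp add: map_poly_pCons l_0 I.mult mult_ac)
  also have "\<dots> = map_poly \<iota> (pCons (d * a') (smult e p'))"
    unfolding 1 2 by (simp add: map_poly_pCons I.zero I.mult map_poly_smult)
  finally show ?case using 1 2 by (metis mult_eq_0_iff)
qed

lemma L_denom: "\<exists>d p'. d \<noteq> 0 \<and> scal (\<iota> d) * L p = \<eta> p'"
proof (induction p)
  case 0
  show ?case by (intro exI[of _ 1] exI[of _ 0]) simp
next
  case (pCons a p)
  then obtain d p' where 1: "d \<noteq> 0" "scal (\<iota> d) * L p = \<eta> p'" by blast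
  obtain e a' where 2: "e \<noteq> 0" "smult (\<iota> e) (map_poly l a) = map_poly \<iota> a'" using l_denom by blast
  have "scal (\<iota> (d * e)) * L (pCons a p)
      = pCons (smult (\<iota> d) (smult (\<iota> e) (map_poly l a))) (scal (\<iota> e) * (scal (\<iota> d) * L p))"
    by (simp add: map_poly_pCons scal_def I.mult mult_ac)
  also have "\<dots> = \<eta> (pCons (smult d a') (scal e * p'))"
    unfolding 1 2 by (simp add: map_poly_pCons I1.zero I.zero I.mult map_poly_smult H.mult \<eta>_scal)
  finally show ?case using 1 2 by (metis mult_eq_0_iff)
qed

lemma L_denom_poly: "\<exists>d q'. d \<noteq> 0 \<and> (\<forall>i. scal (\<iota> d) * L (coeff q i) = \<eta> (coeff q' i))"
proof (induction q)
  case 0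
  show ?case by (intro exI[of _ 1] exI[of _ 0]) simp
next
  case (pCons a q)
  then obtain d q' where 1: "d \<noteq> 0" "\<And>i. scal (\<iota> d) * L (coeff q i) = \<eta> (coeff q' i)" by blast
  obtain e a' where 2: "e \<noteq> 0" "scal (\<iota> e) * L a = \<eta> a'" using L_denom by blast
  have "scal (\<iota> (d * e)) * L (coeff (pCons a q) i) = \<eta> (coeff (pCons (scal d * a') (smult (scal e) q')) i)" for i
  proof (cases i)
    case 0
    have "scal (\<iota> (d * e)) * L a = scal (\<iota> d) * (scal (\<iota> e) * L a)" by (simp add: I.mult S.mult)
    then show ?thesis by (simp add: 0 2 H.mult \<eta>_scal)
  next
    case (Suc k)
    have "scal (\<iota> (d * e)) * L (coeff q k) = scal (\<iota> e) * (scal (\<iota> d) * L (coeff q k))"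
      by (simp add: I.mult S.mult mult_ac)
    then show ?thesis by (simp add: Suc 1 H.mult \<eta>_scal)
  qed
  then show ?case using 1 2 by (metis mult_eq_0_iff)
qed

lemma lex_deg_scal_mult: "c \<noteq> 0 \<Longrightarrow> lex_deg (scal (c :: 'k) * p) = lex_deg p"
  by (cases "p = 0") (simp_all add: lex_deg_mult scal_def, simp add: lex_deg_def)

lemma monic_multiple:
  fixes p :: "'k poly poly"
  assumes "p \<noteq> 0"
  obtains c where "c \<noteq> 0" "lead_coeff (lead_coeff (scal c * p)) = 1"
proof
  let ?u = "lead_coeff (lead_coeff p)"
  show "inverse ?u \<noteq> 0" using assms by simp
  show "lead_coeff (lead_coeff (scal (inverse ?u) * p)) = 1"
    unfolding lead_coeff_mult using assms by (simp add: scal_def)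
qed

text \<open>After scaling, the lexicographic leading coefficient of a minimal invariant is 1 and
  survives the retraction. Hence \<open>lex_deg\<close> is unchanged, and clearing denominators
  gives a minimal invariant in the image of \<open>\<eta>\<close>.\<close>

lemma minimal_inv_descent: "\<exists>P. PA.minimal_inv (\<eta> P)"
proof -
  obtain P where P: "PA.minimal_inv P" using PA.minimal_inv_exists by blast
  have nz: "x \<noteq> 0" if "x \<notin> range scal" for x :: "'k poly poly" using that S.zero by auto
  have "P \<noteq> 0" using P nz by (auto simp: PA.minimal_inv_def)
  then obtain c where c: "c \<noteq> 0" "lead_coeff (lead_coeff (scal c * P)) = 1" by (rule monic_multiple)
  let ?P = "scal c * P"
  obtain d p where dp: "d \<noteq> 0" "scal (\<iota> d) * L ?P = \<eta> p" using L_denom by blast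
  have \<iota>d: "\<iota> d \<noteq> 0" using dp(1) inj I.zero by (metis injD)
  have deg: "lex_deg (\<eta> p) = lex_deg P"
    unfolding dp(2)[symmetric] using L_monic(1)[OF c(2)] by (simp add: lex_deg_scal_mult \<iota>d c(1))
  have "\<eta> p \<in> DKI.A"
    unfolding dp(2)[symmetric] using P by (intro DKI.inv_closed L_inv PA.scal_inv) (simp add: PA.minimal_inv_def)
  moreover have "\<eta> p \<notin> range scal"
    using P deg lex_deg_eq_0_iff[of "\<eta> p"] lex_deg_eq_0_iff[of P] by (simp add: PA.minimal_inv_def)
  ultimately show ?thesis using P deg unfolding PA.minimal_inv_def by auto
qed

text \<open>The same normalization, applied to the leading coefficient of
  \<open>\<delta>K s1\<close>, keeps the degree of \<open>s1\<close> and the \<open>lex_deg\<close>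
  of that coefficient, so \<open>span_minimal_slice\<close> still applies to the descended
  element.\<close>

lemma slice_descent:
  "\<exists>s. deg s = min_deg \<and> (\<forall>b. b \<in> DKI.A_span (\<eta> s))"
proof -
  have n: "DKI.min_deg > 0" using DKI.min_deg_witness PA.nontriv by blast
  obtain s0 where "DKI.deg s0 = DKI.min_deg" using DKI.min_deg_witness PA.nontriv by blast
  from arg_min_nat_lemma[of "\<lambda>x. DKI.deg x = DKI.min_deg", OF this, of "\<lambda>x. lex_deg (lead_coeff (\<delta>K x))"]
  obtain s1 where s1: "DKI.deg s1 = DKI.min_deg"
    "\<And>x. DKI.deg x = DKI.min_deg \<Longrightarrow> lex_deg (lead_coeff (\<delta>K s1)) \<le> lex_deg (lead_coeff (\<delta>K x))"
    by blast
  have "\<delta>K s1 \<noteq> 0" using s1(1) n by (metis degree_0 less_irrefl)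
  then have "lead_coeff (\<delta>K s1) \<noteq> 0" by simp
  then obtain c where c: "c \<noteq> 0" "lead_coeff (lead_coeff (scal c * lead_coeff (\<delta>K s1))) = 1"
    by (rule monic_multiple)
  obtain d s where ds: "d \<noteq> 0" "scal (\<iota> d) * L (scal c * s1) = \<eta> s" using L_denom by blast
  have \<iota>d: "\<iota> d \<noteq> 0" using ds(1) inj I.zero by (metis injD)
  have e: "\<delta>K (\<eta> s) = smult (scal (\<iota> d)) (map_poly L (smult (scal c) (\<delta>K s1)))"
    unfolding ds(2)[symmetric] DK.mult \<delta>K_scal \<delta>K_L by simp
  have co: "coeff (\<delta>K (\<eta> s)) DKI.min_deg = scal (\<iota> d) * L (scal c * lead_coeff (\<delta>K s1))"
    unfolding e by (simp add: coeff_map_poly s1(1))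
  have nz: "coeff (\<delta>K (\<eta> s)) DKI.min_deg \<noteq> 0"
    unfolding co using L_monic(2)[OF c(2)] \<iota>d by (simp add: scal_def)
  have "DKI.deg (\<eta> s) \<le> DKI.min_deg"
    unfolding e by (intro order_trans[OF degree_smult_le] order_trans[OF map_poly_degree_leq]) (simp add: s1)
  then have deg: "DKI.deg (\<eta> s) = DKI.min_deg" using le_degree[OF nz] by simp
  have lex: "lex_deg (lead_coeff (\<delta>K (\<eta> s))) = lex_deg (lead_coeff (\<delta>K s1))"
    unfolding deg co using L_monic(1)[OF c(2)] by (simp add: lex_deg_scal_mult \<iota>d c(1))
  have "b \<in> DKI.A_span (\<eta> s)" for b
    by (rule PA.span_minimal_slice[OF deg]) (use s1(2) lex in simp)
  \<comment> \<open>The least positive degrees before and after the extension agree, since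
    \<open>\<eta>\<close> preserves degrees and \<open>\<eta> s\<close> attains the one over
    \<open>K\<close>.\<close>
  moreover have "deg s = min_deg"
  proof (rule antisym)
    obtain b where b: "deg b = min_deg" using min_deg_witness nontriv by blast
    then have "b \<notin> A" using min_deg_witness nontriv by (simp add: inv_iff)
    then have "DKI.min_deg \<le> DKI.deg (\<eta> b)" using DKI.min_deg_le inv_\<eta> by blast
    then show "deg s \<le> min_deg" using deg deg_\<eta> b by simp
    show "min_deg \<le> deg s" using deg deg_\<eta> n by (intro min_deg_le) (simp add: inv_iff)
  qed
  ultimately show ?thesis by blast
qed

lemma generators_up_to_denominators:
  "\<exists>P s. P \<in> A \<and> P \<notin> range scal \<and> (\<forall>a\<in>A. \<exists>d h. d \<noteq> 0 \<and> scal d * a = poly (map_poly scal h) P)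
     \<and> deg s = min_deg \<and> (\<forall>b. \<exists>d. d \<noteq> 0 \<and> scal d * b \<in> A_span s)"
proof -
  obtain P where P: "PA.minimal_inv (\<eta> P)" using minimal_inv_descent by blast
  obtain s where s: "deg s = min_deg" "\<And>b. b \<in> DKI.A_span (\<eta> s)" using slice_descent by blast
  have L_poly: "L (poly q (\<eta> x)) = poly (map_poly L q) (\<eta> x)" for q x
    by (induction q) (simp_all add: L_add map_poly_pCons mult.commute[of "\<eta> x"] L_mult_\<eta>)
  have \<eta>_poly: "\<eta> (poly q x) = poly (map_poly \<eta> q) (\<eta> x)" for q x by (rule H.hom_poly)
  \<comment> \<open>\<open>L\<close> fixes the image of \<open>\<eta>\<close> and is linear over it,
    so it turns an identity with coefficients over \<open>K\<close> into one with coefficients over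
    the fraction field; a common denominator brings this down.\<close>
  have descend: "\<exists>d q'. d \<noteq> 0 \<and> scal d * b = poly q' x \<and> (\<forall>i. scal (\<iota> d) * L (coeff q i) = \<eta> (coeff q' i))"
    if q: "\<eta> b = poly q (\<eta> x)" for b q x
  proof -
    obtain d q' where d: "d \<noteq> 0" "\<And>i. scal (\<iota> d) * L (coeff q i) = \<eta> (coeff q' i)" using L_denom_poly by blast
    have "smult (scal (\<iota> d)) (map_poly L q) = map_poly \<eta> q'"
      by (rule poly_eqI) (simp add: coeff_map_poly d H.zero)
    then have "poly (map_poly \<eta> q') (\<eta> x) = scal (\<iota> d) * poly (map_poly L q) (\<eta> x)" by (metis poly_smult)
    also have "\<dots> = \<eta> (scal d * b)" unfolding L_poly[symmetric] q[symmetric] by (simp add: L_\<eta> H.mult \<eta>_scal)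
    finally have "scal d * b = poly q' x" using \<eta>_eq_iff by (simp add: \<eta>_poly[symmetric])
    then show ?thesis using d by blast
  qed
  have "\<exists>d h. d \<noteq> 0 \<and> scal d * a = poly (map_poly scal h) P" if "a \<in> A" for a
  proof -
    have "\<eta> a \<in> DKI.A" using that inv_\<eta> by blast
    then obtain g where "\<eta> a = poly (map_poly scal g) (\<eta> P)" using PA.inv_eq_poly_minimal[OF P] by blast
    from descend[OF this] obtain d q' where d: "d \<noteq> 0" "scal d * a = poly q' P"
      and q': "\<And>i. scal (\<iota> d) * L (coeff (map_poly scal g) i) = \<eta> (coeff q' i)" by blast
    have "coeff q' i \<in> range scal" for i
    proof -
      have "\<eta> (coeff q' i) = scal (\<iota> d * l (coeff g i))"
        unfolding q'[symmetric] by (simp add: coeff_map_poly S.zero S.mult scal_def map_poly_pCons l_0)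
      then show ?thesis using \<eta>_range_scal by blast
    qed
    then have "map_poly scal (map_poly (\<lambda>p. coeff (coeff p 0) 0) q') = q'"
      by (intro poly_eqI) (auto simp: coeff_map_poly S'.zero scal_def image_iff, metis coeff_pCons_0)
    then show ?thesis using d by metis
  qed
  moreover have "\<exists>d. d \<noteq> 0 \<and> scal d * b \<in> A_span s" for b
  proof -
    obtain q where q: "\<eta> b = poly q (\<eta> s)" "\<And>i. coeff q i \<in> DKI.A"
      using s(2)[of "\<eta> b"] by (auto simp: poly_span_def)
    obtain d q' where d: "d \<noteq> 0" "scal d * b = poly q' s" "\<And>i. scal (\<iota> d) * L (coeff q i) = \<eta> (coeff q' i)"
      using descend[OF q(1)] by blast
    have "coeff q' i \<in> A" for i
      unfolding inv_\<eta>[symmetric] d(3)[symmetric] by (intro DKI.inv_closed L_inv PA.scal_inv q)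
    then show ?thesis using d A_spanI by metis
  qed
  moreover have "P \<in> A" "P \<notin> range scal" using P inv_\<eta> \<eta>_range_scal by (auto simp: PA.minimal_inv_def)
  ultimately show ?thesis using s(1) by blast
qed

end

text \<open>The set \<open>{1}\<close> is linearly independent over the base field, so the
  assignment of 1 to 1 extends to a linear map on the whole closure.\<close>

lemma closure_retraction:
  "\<exists>l :: 'f::field alg_closure \<Rightarrow> 'f. (\<forall>x y. l (x + y) = l x + l y) \<and> (\<forall>c x. l (to_ac c * x) = c * l x) \<and> l 1 = 1"
proof -
  interpret V: vector_space "\<lambda>(c :: 'f) x. to_ac c * x"
    by unfold_locales (simp_all add: algebra_simps)
  interpret W: vector_space "(*) :: 'f \<Rightarrow> 'f \<Rightarrow> 'f"
    by unfold_locales (simp_all add: algebra_simps)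
  interpret VW: vector_space_pair "\<lambda>(c :: 'f) x. to_ac c * x" "(*) :: 'f \<Rightarrow> 'f \<Rightarrow> 'f" ..
  have "\<not> V.dependent {1}" by simp
  from VW.linear_independent_extend[OF this, of "\<lambda>_. 1"]
  obtain l :: "'f alg_closure \<Rightarrow> 'f"
    where "Vector_Spaces.linear (\<lambda>(c :: 'f) x. to_ac c * x) (*) l" "l 1 = 1" by auto
  then show ?thesis unfolding Vector_Spaces.linear_def module_hom_def module_hom_axioms_def by auto
qed

text \<open>The scalar extension is taken to the algebraic closure of the fraction field of
  \<open>'d\<close>. For $k[X]$ as \<open>'d\<close> this yields generators over $k(X)$.\<close>

lemma action_generators_up_to_denominators:
  fixes \<delta> :: "'d::idom poly poly \<Rightarrow> 'd poly poly poly"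
  assumes "iterative_hom \<delta>" "\<And>d. scal d \<in> invariants \<delta>" "\<not> invariants \<delta> \<subseteq> range scal" "invariants \<delta> \<noteq> UNIV"
  obtains P s where "P \<in> invariants \<delta>" "P \<notin> range scal"
    "\<And>a. a \<in> invariants \<delta> \<Longrightarrow> \<exists>d h. d \<noteq> 0 \<and> scal d * a = poly (map_poly scal h) P"
    "degree (\<delta> s) = iterative_hom.min_deg \<delta>"
    "\<And>b. \<exists>d. d \<noteq> 0 \<and> scal d * b \<in> poly_span (invariants \<delta>) s"
proof -
  interpret iterative_hom \<delta> by fact
  obtain l :: "'d fract alg_closure \<Rightarrow> 'd fract" where l: "\<And>x y. l (x + y) = l x + l y"
    "\<And>c x. l (to_ac c * x) = c * l x" "l 1 = 1"
    using closure_retraction by blast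
  interpret scalar_extension \<delta> "\<lambda>d. to_ac (to_fract d)" "\<lambda>x. to_ac (l x)"
  proof unfold_locales
    show "inj (\<lambda>d :: 'd. to_ac (to_fract d))" by (rule injI) (simp)
    show "\<exists>d e. d \<noteq> 0 \<and> to_ac (to_fract d) * to_ac (l x) = to_ac (to_fract e)" for x
    proof (cases "l x")
      case (Fract a b)
      then have "to_fract b * l x = to_fract a" by (simp add: Fract_conv_to_fract)
      then have "to_ac (to_fract b) * to_ac (l x) = to_ac (to_fract a)" by (metis to_ac_mult)
      then show ?thesis using Fract by blast
    qed
  qed (use assms l in \<open>auto simp: to_ac_mult[symmetric] to_ac_add[symmetric] simp del: to_ac_mult to_ac_add\<close>)
  show ?thesis using generators_up_to_denominators that by blast
qed

section \<open>Actions on three-space fixing a coordinate\<close>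

text \<open>The map \<open>\<rho>\<close> evaluates at a root of \<open>f\<close> in the algebraic
  closure, and \<open>\<pi>\<close> is a nonzero element of least degree in its kernel: the minimal
  polynomial of the root, up to a unit.\<close>

lemma residue_hom:
  fixes f :: "'k::field poly"
  assumes "degree f > 0"
  obtains \<pi> and \<rho> :: "'k poly \<Rightarrow> 'k alg_closure"
  where "\<pi> dvd f" "degree \<pi> > 0" "comm_hom \<rho>" "\<And>d. \<rho> d = 0 \<longleftrightarrow> \<pi> dvd d"
proof -
  interpret T: comm_hom "to_ac :: 'k \<Rightarrow> _" by unfold_locales auto
  have "to_ac (lead_coeff f) \<noteq> 0" using assms by auto
  then have "degree (map_poly to_ac f) > 0" using assms by (simp add: map_poly_degree_eq)
  then obtain x where x: "poly (map_poly to_ac f) x = 0" using alg_closed_imp_poly_has_root by blast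
  define \<rho> where "\<rho> d = poly (map_poly to_ac d) x" for d
  interpret R: comm_hom \<rho> unfolding \<rho>_def by (rule T.eval_hom)
  have "\<exists>d. d \<noteq> 0 \<and> \<rho> d = 0" using x assms by (intro exI[of _ f]) (auto simp: \<rho>_def)
  then obtain d0 where "d0 \<noteq> 0 \<and> \<rho> d0 = 0" ..
  from arg_min_nat_lemma[of "\<lambda>d. d \<noteq> 0 \<and> \<rho> d = 0", OF this, of degree]
  obtain \<pi> where \<pi>: "\<pi> \<noteq> 0" "\<rho> \<pi> = 0" "\<And>d. d \<noteq> 0 \<Longrightarrow> \<rho> d = 0 \<Longrightarrow> degree \<pi> \<le> degree d" by blast
  have ker: "\<rho> d = 0 \<longleftrightarrow> \<pi> dvd d" for d
  proof
    assume d: "\<rho> d = 0"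
    have "\<rho> (d mod \<pi>) = 0"
      using d \<pi>(2) by (simp add: minus_div_mult_eq_mod[symmetric] R.diff R.mult)
    then have "d mod \<pi> = 0" using \<pi>(3)[of "d mod \<pi>"] degree_mod_less[OF \<pi>(1), of d] by fastforce
    then show "\<pi> dvd d" by auto
  qed (auto simp: dvd_def R.mult \<pi>(2))
  have "degree \<pi> > 0"
  proof (rule ccontr)
    assume "\<not> degree \<pi> > 0"
    then obtain c where c: "\<pi> = [:c:]" "c \<noteq> 0" using nonzero_const_polyE[of \<pi>] \<pi>(1) by auto
    then show False using \<pi>(2) by (simp add: \<rho>_def map_poly_pCons)
  qed
  moreover have "\<pi> dvd f" unfolding ker[symmetric] \<rho>_def by (rule x)
  ultimately show thesis using that[of \<pi> \<rho>] ker R.comm_hom_axioms by blast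
qed

section \<open>Reduction modulo a prime of the coefficient ring\<close>

lemma scal_dvd_iff: "scal (c :: 'c::idom) dvd b \<longleftrightarrow> (\<forall>i j. c dvd coeff (coeff b i) j)"
  by (simp add: scal_def const_poly_dvd_iff)

text \<open>Stands in for the quotient by \<open>\<pi>\<close>. As the target of
  \<open>\<rho>\<close> is a domain, \<open>\<pi>\<close> is prime.\<close>

locale residue_map = comm_hom \<rho> for \<rho> :: "'d::idom \<Rightarrow> 'e::idom" +
  fixes \<pi> :: 'd
  assumes kernel: "\<rho> d = 0 \<longleftrightarrow> \<pi> dvd d"
    and nonzero: "\<pi> \<noteq> 0"
begin

sublocale R1: comm_hom "map_poly \<rho>" by (rule map_poly_hom)
sublocale R: comm_hom "map_poly (map_poly \<rho>)" by (rule R1.map_poly_hom)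

lemma kernel_scal: "map_poly (map_poly \<rho>) b = 0 \<longleftrightarrow> scal \<pi> dvd b"
  by (simp add: scal_dvd_iff poly_eq_iff coeff_map_poly zero R1.zero kernel)

lemma prime_scal: "prime_elem (scal \<pi>)"
proof (rule prime_elemI)
  show "scal \<pi> \<noteq> 0" using nonzero by (simp add: scal_def)
  show "\<not> scal \<pi> dvd 1" unfolding kernel_scal[symmetric] R.one by simp
  show "scal \<pi> dvd a \<or> scal \<pi> dvd b" if "scal \<pi> dvd a * b" for a b
    using that unfolding kernel_scal[symmetric] R.mult by simp
qed

text \<open>Used in contrapositive form: an element not of the form
  \<open>scal d + scal \<pi> * b'\<close> has a nonconstant reduction.\<close>

lemma dvd_coeff_split:
  assumes "map_poly (map_poly \<rho>) b \<in> range scal"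
  shows "\<exists>d b'. b = scal d + scal \<pi> * b'"
proof -
  obtain c where c: "map_poly (map_poly \<rho>) b = scal c" using assms by blast
  define d where "d = coeff (coeff b 0) 0"
  have "\<rho> d = c"
    using arg_cong[OF c, of "\<lambda>p. coeff (coeff p 0) 0"]
    by (simp add: d_def coeff_map_poly zero R1.zero scal_def)
  then have "map_poly (map_poly \<rho>) (b - scal d) = 0" by (simp add: R.diff c map_poly2_scal)
  then have "scal \<pi> dvd b - scal d" using kernel_scal by blast
  then obtain b' where "b - scal d = scal \<pi> * b'" by (auto simp: dvd_def)
  then have "b = scal d + scal \<pi> * b'" by (simp add: algebra_simps)
  then show ?thesis by blast
qed

end

text \<open>The image of \<open>\<rho>\<close> is a field, by Bezout's identity: a nonzero element
  \<open>w\<close> of least degree in the ideal of \<open>d\<close> and \<open>\<pi>\<close> divides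
  both, and it is a unit because \<open>\<pi>\<close> is prime and does not divide
  \<open>d\<close>.\<close>

lemma residue_inverse:
  fixes \<pi> :: "'k::field poly"
  assumes "residue_map \<rho> \<pi>" "\<rho> d \<noteq> 0"
  shows "\<exists>u. \<rho> u * \<rho> d = 1"
proof -
  interpret residue_map \<rho> \<pi> by fact
  let ?J = "{u * d + v * \<pi> | u v. True} - {0}"
  have "\<pi> \<in> ?J" using nonzero by (auto intro: exI[of _ 0] exI[of _ 1])
  from arg_min_nat_lemma[of "\<lambda>w. w \<in> ?J", OF this, of degree]
  obtain w where w: "w \<in> ?J" "\<And>w'. w' \<in> ?J \<Longrightarrow> degree w \<le> degree w'" by blast
  then obtain u v where uv: "w = u * d + v * \<pi>" "w \<noteq> 0" by blast
  have dvd: "w dvd x" if "x = u' * d + v' * \<pi>" for x u' v'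
  proof -
    have "x mod w = (u' - x div w * u) * d + (v' - x div w * v) * \<pi>"
      unfolding minus_div_mult_eq_mod[symmetric] by (subst (2) uv(1), subst (1) that) (simp add: algebra_simps)
    then have "x mod w \<in> ?J \<or> x mod w = 0" by blast
    then have "x mod w = 0" using w(2)[of "x mod w"] degree_mod_less[OF uv(2), of x] by fastforce
    then show ?thesis by auto
  qed
  have "w dvd d" "w dvd \<pi>" using dvd[of d 1 0] dvd[of \<pi> 0 1] by auto
  then obtain w' where w': "\<pi> = w * w'" by (auto simp: dvd_def)
  have "\<not> \<pi> dvd w" using \<open>w dvd d\<close> assms(2) kernel by (meson dvd_trans)
  moreover have "\<rho> w * \<rho> w' = 0" unfolding mult[symmetric] w'[symmetric] kernel by simp
  ultimately have "\<pi> dvd w'" using kernel by auto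
  then obtain w'' where "w' = \<pi> * w''" by (auto simp: dvd_def)
  then have "w' = (w * w') * w''" using w' by metis
  then have "w' * 1 = w' * (w * w'')" by (simp add: mult_ac)
  moreover have "w' \<noteq> 0" using w' nonzero by auto
  ultimately have "1 = w * w''" by (metis mult_cancel_left)
  then have "\<rho> (w'' * u) * \<rho> d + \<rho> (w'' * v) * \<rho> \<pi> = 1"
    unfolding mult[symmetric] add[symmetric] using uv(1) by (simp add: one algebra_simps)
  moreover have "\<rho> \<pi> = 0" by (simp add: kernel)
  ultimately show ?thesis by auto
qed

text \<open>Evaluation at \<open>x\<close> is composition in \<open>Y\<close> if \<open>x\<close> is
  free of \<open>Z\<close>, and in \<open>Z\<close> otherwise; degrees multiply in both cases. Thus
  a nonconstant \<open>x\<close> is transcendental over the constants.\<close>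

lemma lex_deg_poly_scal:
  fixes x :: "'c::idom poly poly"
  assumes "x \<notin> range scal" "q \<noteq> 0"
  shows "poly (map_poly scal q) x \<noteq> 0" "lex_deg (poly (map_poly scal q) x) = degree q * lex_deg x"
proof -
  interpret C: comm_hom "\<lambda>c :: 'c poly. [:c:]" by (rule const_hom)
  have *: "poly (map_poly scal q) x \<noteq> 0 \<and> lex_deg (poly (map_poly scal q) x) = degree q * lex_deg x"
  proof (cases "degree x = 0")
    case True
    then obtain y where y: "x = [:y:]" by (meson degree_eq_zeroE)
    have "degree y \<noteq> 0" using assms(1) y by (metis degree_eq_zeroE scal_def rangeI)
    moreover have "poly (map_poly scal q) x = [:pcompose q y:]"
      by (simp add: y pcompose_altdef C.hom_poly map_poly_map_poly comp_def scal_def[abs_def])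
    ultimately show ?thesis using assms(2) pcompose_eq_0[of q y] by (auto simp: lex_deg_def degree_pcompose y)
  next
    case False
    let ?q = "map_poly (\<lambda>c. [:c:]) q"
    have dq: "degree ?q = degree q" using assms(2) by (simp add: map_poly_degree_eq)
    have "coeff ?q (degree q) \<noteq> 0" using assms(2) by (simp add: coeff_map_poly)
    then have q0: "?q \<noteq> 0" by auto
    have e: "poly (map_poly scal q) x = pcompose ?q x"
      by (simp add: pcompose_altdef map_poly_map_poly comp_def scal_def[abs_def])
    have "lead_coeff (pcompose ?q x) = [:lead_coeff q:] * lead_coeff x ^ degree q"
      using False by (simp add: lead_coeff_comp dq coeff_map_poly)
    moreover have "pcompose ?q x \<noteq> 0" using q0 pcompose_eq_0[of ?q x] False by auto
    moreover have "degree (lead_coeff x ^ degree q) = degree q * degree (lead_coeff x)"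
      using False by (subst degree_power_eq) auto
    moreover have "lead_coeff x ^ degree q \<noteq> 0" using False by auto
    ultimately show ?thesis
      using assms(2) unfolding e lex_deg_def
      by (simp only: degree_pcompose dq) (simp add: degree_mult_eq algebra_simps)
  qed
  then show "poly (map_poly scal q) x \<noteq> 0" "lex_deg (poly (map_poly scal q) x) = degree q * lex_deg x" by auto
qed

section \<open>Generators and slices over k[X]\<close>

lemma degree_dvd_less:
  fixes p q :: "'k::field poly"
  assumes "degree \<pi> > 0" "p = \<pi> * q" "p \<noteq> 0" shows "q \<noteq> 0" "degree q < degree p"
  using assms by (auto simp: degree_mult_eq)

lemma minimal_witness:
  fixes m :: "'a \<Rightarrow> 'i \<Rightarrow> nat"
  assumes "Q x0 i0"
  shows "\<exists>x i. Q x i \<and> (\<forall>x' i'. Q x' i' \<longrightarrow> m x i \<le> m x' i')"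
proof -
  have "case_prod Q (x0, i0)" using assms by simp
  from arg_min_nat_lemma[of "case_prod Q", OF this, of "case_prod m"]
  obtain z where z: "case_prod Q z" "\<forall>y. case_prod Q y \<longrightarrow> case_prod m z \<le> case_prod m y" by (elim conjE) (rule that)
  obtain x i where "z = (x, i)" by (cases z)
  then show ?thesis using z by (intro exI[of _ x] exI[of _ i]) auto
qed

text \<open>Here \<open>scal\<close> embeds $k[X]$ into $k[X,Y,Z]$, so \<open>scal_inv\<close> says
  that the action fixes $k[X]$.\<close>

locale space_action = iterative_hom \<delta>
  for \<delta> :: "'k::field poly poly poly \<Rightarrow> 'k poly poly poly poly" +
  assumes scal_inv: "scal d \<in> invariants \<delta>"
    and nonconst: "\<not> invariants \<delta> \<subseteq> range scal"
    and nontriv: "invariants \<delta> \<noteq> UNIV"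
begin

sublocale S: comm_hom "scal :: 'k poly \<Rightarrow> _" by (rule scal_hom)

lemma scal_mult_inv: assumes "d \<noteq> 0" "scal d * b \<in> A" shows "b \<in> A"
  using inv_factor[of "scal d" b] assms by (cases "b = 0") (auto simp: scal_def)

text \<open>After the nonzero elements of $k[X]$ are inverted, the invariants become $k(X)[P]$; the
  formula clears denominators.\<close>

definition generator :: "'k poly poly poly \<Rightarrow> bool" where
  "generator P \<longleftrightarrow> P \<in> A \<and> P \<notin> range scal \<and>
     (\<forall>a\<in>A. \<exists>d h. d \<noteq> 0 \<and> scal d * a = poly (map_poly scal h) P)"

definition slice :: "'k poly poly poly \<Rightarrow> bool" where
  "slice s \<longleftrightarrow> deg s = min_deg \<and> (\<forall>b. \<exists>d. d \<noteq> 0 \<and> scal d * b \<in> A_span s)"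

lemma generator_slice_exist: "\<exists>P. generator P" "\<exists>s. slice s"
proof -
  from action_generators_up_to_denominators[OF iterative_hom_axioms scal_inv nonconst nontriv]
  obtain P s where "P \<in> A" "P \<notin> range scal"
    "\<And>a. a \<in> A \<Longrightarrow> \<exists>d h. d \<noteq> 0 \<and> scal d * a = poly (map_poly scal h) P"
    "deg s = min_deg" "\<And>b. \<exists>d. d \<noteq> 0 \<and> scal d * b \<in> A_span s"
    by blast
  then show "\<exists>P. generator P" "\<exists>s. slice s" unfolding generator_def slice_def by blast+
qed

text \<open>If \<open>P = scal d + scal \<pi> * b\<close>, then \<open>b\<close> is again a
  generator, and each nonconstant coefficient of \<open>P\<close> is \<open>\<pi>\<close> times that
  of \<open>b\<close>. So it suffices to minimize the degree in \<open>X\<close> of a nonzero such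
  coefficient.\<close>

lemma reduced_generator:
  obtains P where "generator P" "\<And>\<pi> d b. degree \<pi> > 0 \<Longrightarrow> P \<noteq> scal d + scal \<pi> * b"
proof -
  \<comment> \<open>The index \<open>(0, 0)\<close> is excluded because the coefficient there also
    absorbs \<open>d\<close>.\<close>
  let ?Q = "\<lambda>P (i, j). generator P \<and> (i, j) \<noteq> (0, 0) \<and> coeff (coeff P i) j \<noteq> 0"
  let ?m = "\<lambda>P (i, j). degree (coeff (coeff P i) j)"
  obtain P where P: "generator P" using generator_slice_exist by blast
  have "\<exists>i j. (i, j) \<noteq> (0, 0) \<and> coeff (coeff P i) j \<noteq> 0"
  proof (rule ccontr)
    assume "\<not> ?thesis"
    then have "coeff (coeff P i) j = coeff (coeff (scal (coeff (coeff P 0) 0)) i) j" for i j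
      by (cases i; cases j) (auto simp: scal_def)
    then have "P = scal (coeff (coeff P 0) 0)" by (rule poly_eqI[OF poly_eqI])
    then show False using P unfolding generator_def by (metis rangeI)
  qed
  then obtain i j where "?Q P (i, j)" using P by auto
  from minimal_witness[of ?Q, OF this, of ?m] obtain P z
    where z: "?Q P z" "\<forall>P' z'. ?Q P' z' \<longrightarrow> ?m P z \<le> ?m P' z'"
    by (elim exE conjE) (rule that)
  obtain i j where ij: "z = (i, j)" by (cases z)
  note y = z[unfolded ij]
  from y(1) have P: "generator P" "(i, j) \<noteq> (0, 0)" "coeff (coeff P i) j \<noteq> 0" by simp_all
  have min: "degree (coeff (coeff P i) j) \<le> degree (coeff (coeff P' i) j)"
    if "generator P'" "coeff (coeff P' i) j \<noteq> 0" for P'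
  proof -
    have "?Q P' (i, j)" unfolding prod.case using that P(2) by (intro conjI)
    then have "?m P (i, j) \<le> ?m P' (i, j)" by (rule y(2)[THEN spec, THEN spec, THEN mp])
    then show ?thesis unfolding prod.case .
  qed
  have "P \<noteq> scal d + scal \<pi> * b" if \<pi>: "degree \<pi> > 0" for \<pi> d b
  proof
    assume eq: "P = scal d + scal \<pi> * b"
    have P': "P \<in> A" "P \<notin> range scal" "\<And>a. a \<in> A \<Longrightarrow> \<exists>d h. d \<noteq> 0 \<and> scal d * a = poly (map_poly scal h) P"
      using P(1) by (auto simp: generator_def)
    have "\<pi> \<noteq> 0" using \<pi> by auto
    moreover have "scal \<pi> * b = P - scal d" using eq by simp
    then have "scal \<pi> * b \<in> A" using P'(1) scal_inv by simp
    ultimately have "b \<in> A" by (rule scal_mult_inv)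
    moreover have "b \<notin> range scal"
    proof
      assume "b \<in> range scal"
      then obtain e where "b = scal e" by blast
      then have "P = scal (d + \<pi> * e)" using eq by (simp add: S.add S.mult)
      then show False using P'(2) by blast
    qed
    moreover have "\<exists>d h. d \<noteq> 0 \<and> scal d * a = poly (map_poly scal h) b" if "a \<in> A" for a
    proof -
      obtain e h where e: "e \<noteq> 0" "scal e * a = poly (map_poly scal h) P" using P'(3) \<open>a \<in> A\<close> by blast
      have "poly (map_poly scal h) P = poly (map_poly scal (pcompose h [:d, \<pi>:])) b"
      proof (induction h)
        case (pCons c h)
        interpret E: comm_hom "\<lambda>p. poly (map_poly scal p) b" by (rule S.eval_hom)
        have "poly (map_poly scal [:d, \<pi>:]) b = P" by (simp add: eq S.eval_pCons mult.commute)
        moreover have "poly (map_poly scal [:c:]) b = scal c" by (simp add: S.eval_pCons)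
        ultimately show ?case using pCons unfolding pcompose_pCons E.add E.mult by (simp add: S.eval_pCons)
      qed simp
      then show ?thesis using e by metis
    qed
    ultimately have "generator b" by (simp add: generator_def)
    moreover have c: "coeff (coeff P i) j = \<pi> * coeff (coeff b i) j"
      using P(2) by (auto simp: eq scal_def coeff_pCons split: nat.splits)
    moreover from c have "coeff (coeff b i) j \<noteq> 0" using P(3) by auto
    ultimately have "degree (coeff (coeff P i) j) \<le> degree (coeff (coeff b i) j)" by (intro min)
    then show False using degree_dvd_less[OF \<pi> c P(3)] by simp
  qed
  then show thesis using that P(1) by blast
qed

text \<open>The same descent on the leading coefficient of \<open>\<delta> s\<close>: an invariant
  summand \<open>a\<close> contributes only to $t^0$, so \<open>s = a + scal \<pi> * b\<close> makes
  this coefficient \<open>scal \<pi>\<close> times that of \<open>\<delta> b\<close>, and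
  \<open>b\<close> is again a slice.\<close>

lemma reduced_slice:
  obtains s where "slice s" "\<And>\<pi> a b. degree \<pi> > 0 \<Longrightarrow> a \<in> A \<Longrightarrow> s \<noteq> a + scal \<pi> * b"
proof -
  let ?c = "\<lambda>s i j. coeff (coeff (lead_coeff (\<delta> s)) i) j"
  let ?Q = "\<lambda>s (i, j). slice s \<and> ?c s i j \<noteq> 0"
  let ?m = "\<lambda>s (i, j). degree (?c s i j)"
  have n: "min_deg > 0" using min_deg_witness nontriv by blast
  obtain s where s: "slice s" using generator_slice_exist by blast
  then have "\<delta> s \<noteq> 0" using n unfolding slice_def by (metis degree_0 less_irrefl)
  then have "lead_coeff (\<delta> s) \<noteq> 0" by simp
  then obtain i j where "?c s i j \<noteq> 0" by (metis leading_coeff_0_iff)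
  with s have "?Q s (i, j)" by simp
  from minimal_witness[of ?Q, OF this, of ?m] obtain s i j where y: "?Q s (i, j)"
    "\<forall>s' i'. ?Q s' i' \<longrightarrow> ?m s (i, j) \<le> ?m s' i'" by fast
  from y(1) have s: "slice s" "?c s i j \<noteq> 0" by simp_all
  have min: "degree (?c s i j) \<le> degree (?c s' i j)" if "slice s'" "?c s' i j \<noteq> 0" for s'
    using y(2)[rule_format, of s' "(i, j)"] that by simp
  have "s \<noteq> a + scal \<pi> * b" if \<pi>: "degree \<pi> > 0" and a: "a \<in> A" for \<pi> a b
  proof
    assume eq: "s = a + scal \<pi> * b"
    have ds: "deg s = min_deg" using s by (simp add: slice_def)
    have \<pi>0: "scal \<pi> \<noteq> 0" using \<pi> by (auto simp: scal_def)
    have e: "\<delta> s = [:a:] + smult (scal \<pi>) (\<delta> b)"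
      using invD[OF a] invD[OF scal_inv[of \<pi>]] by (simp add: eq add mult)
    have "degree [:a:] < degree (\<delta> s)" using ds n by simp
    moreover have "smult (scal \<pi>) (\<delta> b) = \<delta> s + - [:a:]" using e by simp
    ultimately have "degree (smult (scal \<pi>) (\<delta> b)) = min_deg"
      using degree_add_eq_left[of "- [:a:]" "\<delta> s"] ds by simp
    then have db: "deg b = min_deg" using \<pi>0 by simp
    have "coeff (\<delta> s) min_deg = scal \<pi> * coeff (\<delta> b) min_deg"
      using n unfolding e by (simp add: coeff_pCons split: nat.split)
    then have c: "?c s i j = \<pi> * ?c b i j" by (simp add: ds db scal_def)
    have "s \<in> A_span b"
      unfolding eq by (intro A_span_add A_span_mult A_span_inv a scal_inv A_span_self)
    then have "slice b" using s(1) db A_span_trans unfolding slice_def by blast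
    moreover from c have "?c b i j \<noteq> 0" using s(2) by auto
    ultimately have "degree (?c s i j) \<le> degree (?c b i j)" by (intro min)
    then show False using degree_dvd_less[OF \<pi> c s(2)] by simp
  qed
  then show thesis using that s(1) by blast
qed

text \<open>A denominator \<open>d\<close> of least degree is constant. Otherwise take a prime
  factor \<open>\<pi>\<close> of it: modulo \<open>\<pi>\<close> the polynomial \<open>h\<close>
  annihilates the reduction of \<open>P\<close>, which is transcendental, so \<open>\<pi>\<close>
  divides \<open>h\<close> and cancels.\<close>

lemma generator_generates:
  assumes P: "generator P" and red: "\<And>\<pi> d b. degree \<pi> > 0 \<Longrightarrow> P \<noteq> scal d + scal \<pi> * b" and a: "a \<in> A"
  shows "\<exists>h. a = poly (map_poly scal h) P"
proof -
  let ?Q = "\<lambda>d h. d \<noteq> 0 \<and> scal d * a = poly (map_poly scal h) P"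
  obtain d h where "?Q d h" using P a unfolding generator_def by blast
  from minimal_witness[of ?Q, OF this, of "\<lambda>d h. degree d"]
  obtain d h where d: "d \<noteq> 0" "scal d * a = poly (map_poly scal h) P"
    and min: "\<And>d' h'. d' \<noteq> 0 \<Longrightarrow> scal d' * a = poly (map_poly scal h') P \<Longrightarrow> degree d \<le> degree d'"
    by metis
  interpret E: comm_hom "\<lambda>p. poly (map_poly scal p) P" by (rule S.eval_hom)
  show ?thesis
  proof (cases "degree d = 0")
    case True
    then obtain c where c: "d = [:c:]" "c \<noteq> 0" using d(1) nonzero_const_polyE by blast
    have "scal [:inverse c:] * (scal d * a) = a"
      unfolding mult.assoc[symmetric] S.mult[symmetric] using c by (simp add: S.one one_pCons[symmetric])
    moreover have "scal [:inverse c:] = poly (map_poly scal [:[:inverse c:]:]) P" by (simp add: S.eval_pCons)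
    ultimately have "a = poly (map_poly scal ([:[:inverse c:]:] * h)) P" using d(2) E.mult by metis
    then show ?thesis by blast
  next
    case False
    then have "degree d > 0" by simp
    then obtain \<pi> and \<rho> :: "'k poly \<Rightarrow> 'k alg_closure"
      where \<pi>: "\<pi> dvd d" "degree \<pi> > 0" "comm_hom \<rho>" "\<And>d. \<rho> d = 0 \<longleftrightarrow> \<pi> dvd d"
      using residue_hom by blast
    have \<pi>0: "\<pi> \<noteq> 0" using \<pi>(2) by auto
    interpret M: residue_map \<rho> \<pi>
      using \<pi> \<pi>0 by (simp add: residue_map_def residue_map_axioms_def)
    let ?r = "map_poly (map_poly \<rho>)"
    have rP: "?r P \<notin> range scal" using M.dvd_coeff_split red \<pi>(2) by blast
    obtain d' where d': "d = \<pi> * d'" using \<pi>(1) by (auto simp: dvd_def)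
    have "?r (poly (map_poly scal h) P) = poly (map_poly scal (map_poly \<rho> h)) (?r P)"
      by (simp add: M.R.hom_poly map_poly_map_poly comp_def M.zero M.R.zero S.zero M.map_poly2_scal comm_hom.zero[OF scal_hom])
    moreover have "?r (scal d * a) = 0"
      using \<pi>(1) by (simp add: M.R.mult M.map_poly2_scal \<pi>(4)[symmetric] comm_hom.zero[OF scal_hom])
    ultimately have "map_poly \<rho> h = 0" using lex_deg_poly_scal(1)[OF rP, of "map_poly \<rho> h"] d(2) by auto
    then have "\<pi> dvd coeff h i" for i
      using coeff_map_poly[of \<rho> h i] M.zero \<pi>(4)[of "coeff h i"] by simp
    then have "[:\<pi>:] dvd h" by (simp add: const_poly_dvd_iff)
    then obtain h' where h': "h = [:\<pi>:] * h'" by (rule dvdE)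
    have "poly (map_poly scal [:\<pi>:]) P = scal \<pi>" by (simp add: S.eval_pCons)
    then have "poly (map_poly scal h) P = scal \<pi> * poly (map_poly scal h') P" by (metis h' E.mult)
    moreover have "scal d = scal \<pi> * scal d'" by (metis d' S.mult)
    ultimately have "scal \<pi> * (scal d' * a) = scal \<pi> * poly (map_poly scal h') P"
      using d(2) by (metis mult.assoc)
    moreover have "scal \<pi> \<noteq> 0" using \<pi>0 by (simp add: scal_def)
    ultimately have "scal d' * a = poly (map_poly scal h') P" by (metis mult_cancel_left)
    moreover have "d' \<noteq> 0" "degree d' < degree d" using degree_dvd_less[OF \<pi>(2) d' d(1)] by auto
    ultimately show ?thesis using min[of d' h'] by simp
  qed
qed

text \<open>Modulo \<open>\<pi>\<close> the invariants form a polynomial ring in one variable over a field, in which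
  division with remainder is possible.\<close>

lemma slice_coprime:
  fixes \<rho> :: "'k poly \<Rightarrow> 'e::idom"
  assumes P: "generator P" and redP: "\<And>\<pi> d b. degree \<pi> > 0 \<Longrightarrow> P \<noteq> scal d + scal \<pi> * b"
    and red: "\<And>\<pi> a b. degree \<pi> > 0 \<Longrightarrow> a \<in> A \<Longrightarrow> s \<noteq> a + scal \<pi> * b"
    and \<pi>: "degree \<pi> > 0" and M: "residue_map \<rho> \<pi>"
    and a: "a1 \<in> A" "a0 \<in> A" "a1 * s + a0 = scal \<pi> * b"
  shows "scal \<pi> dvd a1"
proof (rule ccontr)
  assume nd: "\<not> scal \<pi> dvd a1"
  interpret M: residue_map \<rho> \<pi> by fact
  let ?r = "map_poly (map_poly \<rho>)"
  have rP: "?r P \<notin> range scal" using M.dvd_coeff_split redP \<pi>(1) by blast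
  interpret S': comm_hom "scal :: 'e \<Rightarrow> _" by (rule scal_hom)
  interpret E: comm_hom "\<lambda>p. poly (map_poly scal p) (?r P)" by (rule S'.eval_hom)
  let ?e = "\<lambda>h. poly (map_poly scal (map_poly \<rho> h)) (?r P)"
  have r_poly: "?r (poly (map_poly scal h) P) = ?e h" for h
    by (simp add: M.R.hom_poly map_poly_map_poly comp_def M.zero M.R.zero S.zero S'.zero M.map_poly2_scal)
  obtain h1 h0 where h: "a1 = poly (map_poly scal h1) P" "a0 = poly (map_poly scal h0) P"
    using generator_generates[OF P redP] a by blast
  define g where "g = map_poly \<rho> h1"
  have g0: "g \<noteq> 0"
  proof
    assume "g = 0"
    then have "?r a1 = 0" unfolding h(1) r_poly g_def by simp
    then show False using nd M.kernel_scal by blast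
  qed
  have unit: "\<exists>e. \<rho> e * x = 1" if x: "x \<noteq> 0" "x \<in> range \<rho>" for x
  proof -
    obtain d where d: "x = \<rho> d" using x by blast
    then obtain u where "\<rho> u * \<rho> d = 1" using residue_inverse[OF M, of d] x by blast
    then show ?thesis using d by blast
  qed
  \<comment> \<open>Division with remainder: as long as the reduction of \<open>f\<close> is
    nonzero, \<open>lex_deg\<close> shows that its degree is at least that of \<open>g\<close>, so
    subtracting \<open>t * h1\<close> cancels its leading term, and \<open>y\<close> is built up
    from the terms \<open>t\<close>.\<close>
  have "\<exists>q. y = ?e q" if "poly (map_poly scal g) (?r P) * y = ?e f" for y f
    using that
  proof (induction "degree (map_poly \<rho> f)" arbitrary: f y rule: less_induct)
    case less
    let ?f = "map_poly \<rho> f" and ?gP = "poly (map_poly scal g) (?r P)"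
    have gP0: "?gP \<noteq> 0" using lex_deg_poly_scal(1)[OF rP g0] .
    show ?case
    proof (cases "?f = 0")
      case True
      then have "y = 0" using less.prems gP0 by simp
      then show ?thesis by (intro exI[of _ 0]) simp
    next
      case False
      have fP0: "?e f \<noteq> 0" using lex_deg_poly_scal(1)[OF rP False] .
      then have y0: "y \<noteq> 0" using less.prems by auto
      have rP0: "lex_deg (?r P) > 0" using rP lex_deg_eq_0_iff by blast
      have "degree g * lex_deg (?r P) \<le> degree ?f * lex_deg (?r P)"
        using lex_deg_mult[OF gP0 y0] lex_deg_poly_scal(2)[OF rP False] lex_deg_poly_scal(2)[OF rP g0] less.prems by simp
      then have dg: "degree g \<le> degree ?f" using rP0 by simp
      have "lead_coeff g \<in> range \<rho>" by (simp add: g_def coeff_map_poly M.zero)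
      moreover have "lead_coeff g \<noteq> 0" using g0 by simp
      ultimately obtain e where e: "\<rho> e * lead_coeff g = 1" using unit by blast
      define k where "k = degree ?f - degree g"
      define t where "t = monom (e * coeff f (degree ?f)) k"
      have f': "map_poly \<rho> (f - t * h1) = ?f - monom (\<rho> e * lead_coeff ?f) k * g"
        by (simp add: M.R1.diff M.R1.mult g_def t_def map_poly_monom M.zero M.mult coeff_map_poly)
      have eq: "?gP * (y - ?e t) = ?e (f - t * h1)"
        using less.prems by (simp add: right_diff_distrib M.R1.diff M.R1.mult E.diff E.mult g_def mult.commute)
      show ?thesis
      proof (cases "map_poly \<rho> (f - t * h1) = 0")
        case True
        then have "y = ?e t" using eq gP0 by simp
        then show ?thesis by blast
      next
        case nz: False
        have "degree (monom (\<rho> e * lead_coeff ?f) k * g) \<le> degree ?f"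
          using degree_mult_le[of "monom (\<rho> e * lead_coeff ?f) k" g] degree_monom_le[of "\<rho> e * lead_coeff ?f" k] dg
          by (simp add: k_def)
        then have "degree (map_poly \<rho> (f - t * h1)) \<le> degree ?f" unfolding f' by (intro degree_diff_le) auto
        moreover have "coeff (map_poly \<rho> (f - t * h1)) (degree ?f) = 0"
        proof -
          have "coeff (monom (\<rho> e * lead_coeff ?f) k * g) (degree ?f) = (\<rho> e * lead_coeff g) * lead_coeff ?f"
            using dg by (simp add: coeff_monom_mult k_def)
          then show ?thesis unfolding f' by (simp add: e)
        qed
        ultimately have "degree (map_poly \<rho> (f - t * h1)) < degree ?f"
          using nz by (metis leading_coeff_0_iff le_neq_implies_less)
        then obtain q where "y - ?e t = ?e q" using less.hyps eq by blast
        then have "y = ?e (q + t)" by (simp add: M.R1.add E.add algebra_simps)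
        then show ?thesis by blast
      qed
    qed
  qed
  note divide = this
  \<comment> \<open>Modulo \<open>\<pi>\<close>, the element \<open>s\<close> is a quotient of two
    polynomials in \<open>P\<close>, hence by the division a polynomial in \<open>P\<close>. This
    puts \<open>s\<close> into \<open>A\<close> plus a multiple of \<open>scal \<pi>\<close>,
    against \<open>red\<close>.\<close>
  have "?r a1 * ?r s + ?r a0 = 0"
    using M.kernel_scal[of "scal \<pi> * b"] unfolding M.R.add[symmetric] M.R.mult[symmetric] a(3) by simp
  then have "poly (map_poly scal g) (?r P) * ?r s = ?e (- h0)"
    unfolding h r_poly g_def by (simp add: M.R1.uminus E.uminus eq_neg_iff_add_eq_0)
  from divide[OF this] obtain q where q: "?r s = ?e q" by blast
  let ?a = "poly (map_poly scal q) P"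
  have "?r (s - ?a) = 0" unfolding M.R.diff r_poly q by simp
  then obtain b' where "s - ?a = scal \<pi> * b'" using M.kernel_scal by (metis dvd_def)
  then have "s = ?a + scal \<pi> * b'" by (simp add: algebra_simps)
  moreover have "?a \<in> A"
    using P scal_inv by (intro poly_in_inv) (auto simp: coeff_map_poly S.zero generator_def)
  ultimately show False using red[OF \<pi>] by blast
qed

lemma generator_and_slice:
  obtains P s where "P \<in> A" "\<And>a. a \<in> A \<Longrightarrow> \<exists>h. a = poly (map_poly scal h) P"
    "deg s = min_deg" "\<And>b. \<exists>d. d \<noteq> 0 \<and> scal d * b \<in> A_span s"
    "\<And>f. degree f > 0 \<Longrightarrow> \<exists>\<pi>. \<pi> dvd f \<and> degree \<pi> > 0 \<and> prime_elem (scal \<pi>)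
       \<and> (\<forall>a1\<in>A. \<forall>a0\<in>A. \<forall>b. a1 * s + a0 = scal \<pi> * b \<longrightarrow> scal \<pi> dvd a1)"
proof -
  obtain P where P: "generator P" "\<And>\<pi> d b. degree \<pi> > 0 \<Longrightarrow> P \<noteq> scal d + scal \<pi> * b"
    using reduced_generator by blast
  obtain s where s: "slice s" "\<And>\<pi> a b. degree \<pi> > 0 \<Longrightarrow> a \<in> A \<Longrightarrow> s \<noteq> a + scal \<pi> * b"
    using reduced_slice by blast
  show thesis
  proof (rule that)
    show "P \<in> A" using P by (simp add: generator_def)
    show "\<exists>h. a = poly (map_poly scal h) P" if "a \<in> A" for a using generator_generates[OF P that] .
    show "deg s = min_deg" "\<And>b. \<exists>d. d \<noteq> 0 \<and> scal d * b \<in> A_span s" using s(1) by (auto simp: slice_def)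
    fix f :: "'k poly" assume f: "degree f > 0"
    obtain \<pi> and \<rho> :: "'k poly \<Rightarrow> 'k alg_closure"
      where \<pi>: "\<pi> dvd f" "degree \<pi> > 0" "comm_hom \<rho>" "\<And>d. \<rho> d = 0 \<longleftrightarrow> \<pi> dvd d"
      using residue_hom[OF f] by blast
    then have "\<pi> \<noteq> 0" by auto
    then have M: "residue_map \<rho> \<pi>" using \<pi> by (simp add: residue_map_def residue_map_axioms_def)
    show "\<exists>\<pi>. \<pi> dvd f \<and> degree \<pi> > 0 \<and> prime_elem (scal \<pi>)
       \<and> (\<forall>a1\<in>A. \<forall>a0\<in>A. \<forall>b. a1 * s + a0 = scal \<pi> * b \<longrightarrow> scal \<pi> dvd a1)"
      using \<pi>(1,2) residue_map.prime_scal[OF M] slice_coprime[OF P s(2) \<pi>(2) M] by blast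
  qed
qed

end

section \<open>Surjective endomorphisms and coordinate systems\<close>

definition ideal_set :: "'a::comm_ring_1 set \<Rightarrow> bool" where
  "ideal_set I \<longleftrightarrow> 0 \<in> I \<and> (\<forall>x\<in>I. \<forall>y\<in>I. x + y \<in> I) \<and> (\<forall>r. \<forall>x\<in>I. r * x \<in> I)"

definition noetherian :: "'a::comm_ring_1 itself \<Rightarrow> bool" where
  "noetherian _ \<longleftrightarrow> (\<forall>I :: nat \<Rightarrow> 'a set. (\<forall>n. ideal_set (I n)) \<longrightarrow> (\<forall>n. I n \<subseteq> I (Suc n))
     \<longrightarrow> (\<exists>N. \<forall>n\<ge>N. I n = I N))"

lemma noetherianD:
  fixes I :: "nat \<Rightarrow> 'a::comm_ring_1 set"
  assumes "noetherian TYPE('a)" "\<And>n. ideal_set (I n)" "\<And>n. I n \<subseteq> I (Suc n)"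
  shows "\<exists>N. \<forall>n\<ge>N. I n = I N"
  using assms unfolding noetherian_def by blast

lemma noetherian_field: "noetherian TYPE('k::field)"
  unfolding noetherian_def
proof (intro allI impI)
  fix I :: "nat \<Rightarrow> 'k set"
  assume I: "\<forall>n. ideal_set (I n)" and inc: "\<forall>n. I n \<subseteq> I (Suc n)"
  have mono: "m \<le> n \<Longrightarrow> I m \<subseteq> I n" for m n using inc lift_Suc_mono_le[of I] by blast
  show "\<exists>N. \<forall>n\<ge>N. I n = I N"
  proof (cases "\<forall>n. I n \<subseteq> {0}")
    case True
    then have "I n = {0}" for n using I unfolding ideal_set_def by blast
    then show ?thesis by simp
  next
    case False
    then obtain N x where x: "x \<in> I N" "x \<noteq> 0" by blast
    have "I n = UNIV" if "n \<ge> N" for n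
    proof -
      have "x \<in> I n" using mono[OF that] x by blast
      then have "(y / x) * x \<in> I n" for y using I unfolding ideal_set_def by blast
      then show ?thesis using x(2) by auto
    qed
    then show ?thesis by blast
  qed
qed

lemma ideal_set_diff: "ideal_set I \<Longrightarrow> x \<in> I \<Longrightarrow> y \<in> I \<Longrightarrow> x - y \<in> I"
  unfolding ideal_set_def by (metis add_uminus_conv_diff mult_minus1)

text \<open>Nested ideals with the same leading coefficients in every degree are equal, by induction
  on the degree; so the chains of leading coefficient ideals are made stationary simultaneously in
  all degrees.\<close>

lemma hilbert_basis:
  assumes noeth: "noetherian TYPE('a::comm_ring_1)" shows "noetherian TYPE('a poly)"
  unfolding noetherian_def
proof (intro allI impI)
  fix I :: "nat \<Rightarrow> 'a poly set"
  assume I: "\<forall>n. ideal_set (I n)" and inc: "\<forall>n. I n \<subseteq> I (Suc n)"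
  have mono: "m \<le> n \<Longrightarrow> I m \<subseteq> I n" for m n using inc lift_Suc_mono_le[of I] by blast
  define lead where "lead n d = {coeff p d | p. p \<in> I n \<and> degree p \<le> d}" for n d
  have ideal: "ideal_set (lead n d)" for n d
    unfolding ideal_set_def
  proof (intro conjI ballI allI)
    have In: "ideal_set (I n)" using I by blast
    show "0 \<in> lead n d" unfolding lead_def using In by (auto simp: ideal_set_def intro!: exI[of _ 0])
    show "x + y \<in> lead n d" if xy: "x \<in> lead n d" "y \<in> lead n d" for x y
    proof -
      obtain p q where "x = coeff p d" "p \<in> I n" "degree p \<le> d" "y = coeff q d" "q \<in> I n" "degree q \<le> d"
        using xy unfolding lead_def by blast
      then have "x + y = coeff (p + q) d" "p + q \<in> I n" "degree (p + q) \<le> d"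
        using In degree_add_le by (auto simp: ideal_set_def)
      then show ?thesis unfolding lead_def by blast
    qed
    show "r * x \<in> lead n d" if x: "x \<in> lead n d" for r x
    proof -
      obtain p where p: "x = coeff p d" "p \<in> I n" "degree p \<le> d" using x unfolding lead_def by blast
      have "[:r:] * p \<in> I n" using In p by (auto simp only: ideal_set_def)
      moreover have "degree ([:r:] * p) \<le> d" using p(3) degree_smult_le[of r p] by simp
      moreover have "r * x = coeff ([:r:] * p) d" using p by simp
      ultimately show ?thesis unfolding lead_def by blast
    qed
  qed
  have lead_n: "lead n d \<subseteq> lead n' d" if "n \<le> n'" for n n' d
    using subsetD[OF mono[OF that]] by (auto simp: lead_def)
  have "lead n d \<subseteq> lead n (Suc d)" for n d
  proof
    fix x assume "x \<in> lead n d"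
    then obtain p where p: "x = coeff p d" "p \<in> I n" "degree p \<le> d" unfolding lead_def by blast
    have "[:0, 1:] * p \<in> I n" using I p(2) by (simp only: ideal_set_def)
    moreover have "degree ([:0, 1:] * p) \<le> Suc d" using p(3) degree_mult_le[of "[:0, 1:]" p] by simp
    moreover have "x = coeff ([:0, 1:] * p) (Suc d)" using p by simp
    ultimately show "x \<in> lead n (Suc d)" unfolding lead_def by blast
  qed
  then have lead_d: "lead n d \<subseteq> lead n d'" if "d \<le> d'" for n d d'
    using that lift_Suc_mono_le[of "lead n"] by blast
  \<comment> \<open>The diagonal chain settles all degrees from \<open>N\<close> on at once; the
    finitely many degrees below \<open>N\<close> get bounds of their own, collected in
    \<open>K\<close>.\<close>
  have "\<exists>N. \<forall>n\<ge>N. lead n n = lead N N"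
    using lead_n lead_d by (intro noetherianD[OF noeth ideal]) (meson le_Suc_eq order_refl subset_trans)
  then obtain N where N: "\<And>n. n \<ge> N \<Longrightarrow> lead n n = lead N N" by blast
  have "\<exists>M. \<forall>n\<ge>M. lead n d = lead M d" for d
    by (rule noetherianD[OF noeth ideal]) (simp add: lead_n)
  then obtain M where M: "\<And>d n. n \<ge> M d \<Longrightarrow> lead n d = lead (M d) d" by metis
  define K where "K = N + (\<Sum>d<N. M d)"
  have MK: "M d \<le> K" if "d < N" for d
    using member_le_sum[of d "{..<N}" M] that by (simp add: K_def)
  have const: "lead n d = lead K d" if n: "n \<ge> K" for n d
  proof (cases "d < N")
    case True
    then show ?thesis using M[of d n] M[of d K] MK n by (metis order_trans)
  next
    case False
    have "lead m d = lead N N" if "m \<ge> N" for m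
    proof
      have "lead m d \<subseteq> lead (max m d) (max m d)" using lead_n lead_d by (meson max.cobounded1 max.cobounded2 subset_trans)
      then show "lead m d \<subseteq> lead N N" using N[of "max m d"] that by simp
      show "lead N N \<subseteq> lead m d" using lead_n[OF that] lead_d[of N d] False by (meson not_less subset_trans)
    qed
    then show ?thesis using n by (simp add: K_def)
  qed
  have "I n \<subseteq> I K" if n: "n \<ge> K" for n
  proof
    fix p assume "p \<in> I n"
    then show "p \<in> I K"
    proof (induction "degree p" arbitrary: p rule: less_induct)
      case less
      have "lead_coeff p \<in> lead n (degree p)"
        unfolding lead_def by (rule CollectI, rule exI[of _ p]) (simp add: less.prems)
      then have "lead_coeff p \<in> lead K (degree p)" by (simp only: const[OF n])
      then obtain q where q: "lead_coeff p = coeff q (degree p)" "q \<in> I K" "degree q \<le> degree p"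
        unfolding lead_def by blast
      have "p - q \<in> I n" using ideal_set_diff I less.prems q(2) mono[OF n] by blast
      moreover have "degree (p - q) < degree p \<or> p - q = 0"
      proof -
        have "coeff (p - q) (degree p) = 0" using q by simp
        moreover have "degree (p - q) \<le> degree p" using q by (intro degree_diff_le) auto
        ultimately show ?thesis by (metis leading_coeff_0_iff le_neq_implies_less)
      qed
      moreover have "0 \<in> I K" using I by (simp add: ideal_set_def)
      ultimately have "p - q \<in> I K" using less.hyps by metis
      then have "(p - q) + q \<in> I K" using I q(2) unfolding ideal_set_def by blast
      then show ?case by simp
    qed
  qed
  then show "\<exists>N. \<forall>n\<ge>N. I n = I N" using mono by blast
qed

text \<open>The kernels of the powers of \<open>f\<close> become stationary at some
  \<open>N\<close>. If \<open>f x = 0\<close> and \<open>x = (f ^^ N) y\<close>, then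
  \<open>y\<close> lies in the kernel of \<open>f ^^ Suc N\<close>, hence of \<open>f ^^ N\<close>,
  and \<open>x = 0\<close>.\<close>

lemma noetherian_surj_imp_inj:
  fixes f :: "'a::comm_ring_1 \<Rightarrow> 'a"
  assumes "noetherian TYPE('a)" "comm_hom f" "surj f"
  shows "inj f"
proof -
  interpret comm_hom f by fact
  have pow: "comm_hom (f ^^ n)" for n
  proof (induction n)
    case 0
    show ?case by unfold_locales auto
  next
    case (Suc n)
    then show ?case using comm_hom_comp[OF assms(2) Suc] by (simp add: comp_def)
  qed
  have "\<exists>N. \<forall>n\<ge>N. {x. (f ^^ n) x = 0} = {x. (f ^^ N) x = 0}"
  proof (rule noetherianD[OF assms(1)])
    fix n
    interpret P: comm_hom "f ^^ n" by (rule pow)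
    show "ideal_set {x. (f ^^ n) x = 0}" by (simp add: ideal_set_def P.zero P.add P.mult)
    show "{x. (f ^^ n) x = 0} \<subseteq> {x. (f ^^ Suc n) x = 0}" by (auto simp: zero)
  qed
  then obtain N where N: "{x. (f ^^ Suc N) x = 0} = {x. (f ^^ N) x = 0}" by (meson le_SucI order_refl)
  have ker: "x = 0" if "f x = 0" for x
  proof -
    have "surj (f ^^ N)" using assms(3) by (rule surj_fn)
    then obtain y where y: "x = (f ^^ N) y" by (meson surjD)
    then have "(f ^^ Suc N) y = 0" using that by simp
    then show ?thesis using N y by blast
  qed
  show ?thesis
  proof (rule injI)
    fix x y assume "f x = f y"
    then have "f (x - y) = 0" by (simp add: diff)
    then show "x = y" using ker by force
  qed
qed

section \<open>Subrings generated by elements\<close>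

lemma unital_subring_adjoin: "unital_subring (adjoin S xs)"
  unfolding adjoin_def by (rule hull_in) (auto simp: unital_subring_def)

lemma adjoin_base: "S \<subseteq> adjoin S xs" "set xs \<subseteq> adjoin S xs"
  using hull_subset[of "S \<union> set xs" unital_subring] by (auto simp: adjoin_def)

lemma adjoin_minimal: "unital_subring T \<Longrightarrow> S \<subseteq> T \<Longrightarrow> set xs \<subseteq> T \<Longrightarrow> adjoin S xs \<subseteq> T"
  unfolding adjoin_def by (rule hull_minimal) auto

lemma unital_subringD:
  assumes "unital_subring T"
  shows "1 \<in> T" "0 \<in> T" "x \<in> T \<Longrightarrow> y \<in> T \<Longrightarrow> x - y \<in> T" "x \<in> T \<Longrightarrow> y \<in> T \<Longrightarrow> x + y \<in> T"
    "x \<in> T \<Longrightarrow> y \<in> T \<Longrightarrow> x * y \<in> T"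
proof -
  show 1: "1 \<in> T" using assms by (simp add: unital_subring_def)
  have d: "x - y \<in> T" if "x \<in> T" "y \<in> T" for x y using assms that by (simp add: unital_subring_def)
  then show "x \<in> T \<Longrightarrow> y \<in> T \<Longrightarrow> x - y \<in> T" .
  show 0: "0 \<in> T" using d[OF 1 1] by simp
  show "x + y \<in> T" if "x \<in> T" "y \<in> T" using d[OF that(1) d[OF 0 that(2)]] by simp
  show "x \<in> T \<Longrightarrow> y \<in> T \<Longrightarrow> x * y \<in> T" using assms by (simp add: unital_subring_def)
qed

lemma unital_subring_range: assumes "comm_hom h" shows "unital_subring (range h)"
proof -
  interpret comm_hom h by fact
  show ?thesis unfolding unital_subring_def
    by (auto simp: diff[symmetric] mult[symmetric]) (metis one rangeI)
qed

lemma unital_subring_poly: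
  assumes T: "unital_subring T" and "\<And>i. coeff q i \<in> T" "x \<in> T" shows "poly q x \<in> T"
  using assms(2)
proof (induction q)
  case (pCons a q)
  have "a \<in> T" using pCons.prems[of 0] by simp
  moreover have "coeff q i \<in> T" for i using pCons.prems[of "Suc i"] by simp
  ultimately show ?case using pCons.IH assms(3) by (simp add: unital_subringD[OF T])
qed (simp add: unital_subringD[OF T])

section \<open>Polynomials in one element and automorphisms from coordinate systems\<close>

definition const3 :: "'k::field \<Rightarrow> 'k poly poly poly" where "const3 c = [:[:[:c:]:]:]"

lemma const3_hom: "comm_hom const3"
  unfolding const3_def by (rule comm_hom_comp[OF comm_hom_comp[OF const_hom const_hom] const_hom])

lemma scalars3_eq: "scalars3 = range const3"
  by (simp add: scalars3_def const3_def)

definition eval3 :: "'k::field poly poly poly \<Rightarrow> 'k poly \<Rightarrow> 'k poly poly poly" where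
  "eval3 x f = poly (map_poly const3 f) x"

lemma eval3_hom: "comm_hom (eval3 x)"
  unfolding eval3_def by (rule comm_hom.eval_hom[OF const3_hom])

lemma eval3_pCons: "eval3 x (pCons c f) = const3 c + x * eval3 x f"
  unfolding eval3_def by (rule comm_hom.eval_pCons[OF const3_hom])

lemma eval3_0 [simp]: "eval3 x 0 = 0"
  by (simp add: eval3_def)

lemma eval3_const: "eval3 x [:c:] = const3 c" and eval3_var: "eval3 x [:0, 1:] = x"
  by (simp_all add: eval3_pCons comm_hom.zero[OF const3_hom] comm_hom.one[OF const3_hom])

lemma adjoin_single: "adjoin scalars3 [x] = range (eval3 x)"
proof
  show "adjoin scalars3 [x] \<subseteq> range (eval3 x)"
    by (rule adjoin_minimal[OF unital_subring_range[OF eval3_hom]])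
      (auto simp: scalars3_eq image_iff intro: eval3_const[symmetric] eval3_var[symmetric])
  have "coeff (map_poly const3 f) i \<in> adjoin scalars3 [x]" for f i
    using adjoin_base(1)[of scalars3 "[x]"] by (auto simp: coeff_map_poly comm_hom.zero[OF const3_hom] scalars3_eq)
  then show "range (eval3 x) \<subseteq> adjoin scalars3 [x]"
    unfolding eval3_def using adjoin_base(2)[of "[x]" scalars3]
    by (auto intro!: unital_subring_poly[OF unital_subring_adjoin])
qed

lemma unit_const3: "b dvd 1 \<Longrightarrow> b \<in> range const3"
  by (auto simp: is_unit_poly_iff const3_def)

lemma comm_hom_inverse:
  assumes "comm_hom f" "\<And>x. f (g x) = x" "\<And>x. g (f x) = x" shows "comm_hom g"
proof -
  interpret comm_hom f by fact
  show ?thesis by unfold_locales (metis add assms(2,3), metis mult assms(2,3), metis one assms(3))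
qed

text \<open>Coordinates are only required to generate, so substituting them for \<open>X\<close>,
  \<open>Y\<close>, \<open>Z\<close> is surjective; injectivity, and with it algebraic independence,
  comes from the Noetherian property.\<close>

lemma coordinate_automorphism:
  fixes x y z :: "'k::field poly poly poly"
  assumes "adjoin scalars3 [x, y, z] = UNIV"
  obtains \<Phi> \<Psi> :: "'k poly poly poly \<Rightarrow> 'k poly poly poly"
  where "comm_hom \<Phi>" "comm_hom \<Psi>" "\<And>p. \<Phi> (\<Psi> p) = p" "\<And>p. \<Psi> (\<Phi> p) = p"
    "\<And>d. \<Phi> (scal d) = eval3 x d"
proof -
  define \<Phi> where "\<Phi> p = poly (map_poly (\<lambda>q. poly (map_poly (eval3 x) q) y) p) z" for p
  have hom: "comm_hom \<Phi>" unfolding \<Phi>_def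
    by (rule comm_hom.eval_hom, rule comm_hom.eval_hom, rule eval3_hom)
  interpret E: comm_hom "eval3 x" by (rule eval3_hom)
  interpret E': comm_hom "\<lambda>q. poly (map_poly (eval3 x) q) y" by (rule E.eval_hom)
  have scal: "\<Phi> (scal d) = eval3 x d" for d
    by (simp add: \<Phi>_def scal_def map_poly_pCons E.zero)
  have "\<Phi> [:[:0, 1:]:] = y" "\<Phi> [:0, 1:] = z"
    by (simp_all add: \<Phi>_def map_poly_pCons E.zero E.one E'.zero)
  moreover have "\<Phi> (scal [:0, 1:]) = x" "\<Phi> (scal [:c:]) = const3 c" for c
    by (simp_all only: scal eval3_var eval3_const)
  ultimately have "scalars3 \<subseteq> range \<Phi>" "set [x, y, z] \<subseteq> range \<Phi>"
    unfolding scalars3_eq by (auto simp: image_iff) metis+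
  then have "adjoin scalars3 [x, y, z] \<subseteq> range \<Phi>"
    by (rule adjoin_minimal[OF unital_subring_range[OF hom]])
  then have "surj \<Phi>" using assms by auto
  moreover have "inj \<Phi>"
    by (rule noetherian_surj_imp_inj[OF hilbert_basis[OF hilbert_basis[OF hilbert_basis[OF noetherian_field]]] hom \<open>surj \<Phi>\<close>])
  ultimately have "\<Phi> (the_inv \<Phi> p) = p" "the_inv \<Phi> (\<Phi> p) = p" for p
    by (simp_all add: f_the_inv_into_f the_inv_f_f)
  then show thesis using that[OF hom comm_hom_inverse[OF hom]] scal by blast
qed

section \<open>Comparing two fixed coordinates\<close>

lemma eval3_comp:
  assumes "comm_hom h" "\<And>c. h (const3 c) = const3 c" shows "h (eval3 x f) = eval3 (h x) f"
proof -
  interpret comm_hom h by fact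
  have "map_poly h (map_poly const3 f) = map_poly const3 f"
    by (rule poly_eqI) (simp add: coeff_map_poly zero comm_hom.zero[OF const3_hom] assms(2))
  then show ?thesis by (simp add: eval3_def hom_poly)
qed

locale coordinate =
  fixes x :: "'k::field poly poly poly" and \<Phi> \<Psi> :: "'k poly poly poly \<Rightarrow> 'k poly poly poly"
  assumes \<Phi>: "comm_hom \<Phi>" and \<Psi>: "comm_hom \<Psi>"
    and \<Phi>\<Psi> [simp]: "\<Phi> (\<Psi> p) = p" and \<Psi>\<Phi> [simp]: "\<Psi> (\<Phi> p) = p"
    and \<Phi>_scal: "\<Phi> (scal d) = eval3 x d"
begin

sublocale \<Phi>: comm_hom \<Phi> by (rule \<Phi>)
sublocale \<Psi>: comm_hom \<Psi> by (rule \<Psi>)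

lemma \<Phi>_const3: "\<Phi> (const3 c) = const3 c"
  using \<Phi>_scal[of "[:c:]"] by (simp add: eval3_const) (simp add: scal_def const3_def)

lemma \<Psi>_const3: "\<Psi> (const3 c) = const3 c"
  using \<Psi>\<Phi>[of "const3 c"] by (simp only: \<Phi>_const3)

lemma \<Psi>_eval3: "\<Psi> (eval3 x d) = scal d"
  using \<Psi>\<Phi>[of "scal d"] by (simp only: \<Phi>_scal)

lemma eval3_eq_0: "eval3 x d = 0 \<Longrightarrow> d = 0"
  using \<Psi>_eval3[of d] \<Psi>.zero by (simp add: scal_def)

lemma \<Psi>_dvd_iff: "\<Psi> a dvd \<Psi> b \<longleftrightarrow> a dvd b"
proof
  assume "\<Psi> a dvd \<Psi> b"
  then obtain c where "\<Psi> b = \<Psi> a * c" by (rule dvdE)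
  then have "\<Phi> (\<Psi> b) = \<Phi> (\<Psi> a) * \<Phi> c" by (simp only: \<Phi>.mult)
  then show "a dvd b" by simp
next
  assume "a dvd b"
  then obtain c where "b = a * c" by (rule dvdE)
  then show "\<Psi> a dvd \<Psi> b" by (simp add: \<Psi>.mult)
qed

lemma eval3_dvd_iff: "eval3 x p dvd b \<longleftrightarrow> scal p dvd \<Psi> b"
  using \<Psi>_dvd_iff[of "eval3 x p" b] by (simp only: \<Psi>_eval3)

lemma prime_transport: assumes "prime_elem (scal \<pi>)" shows "prime_elem (eval3 x \<pi>)"
proof (rule prime_elemI)
  show "eval3 x \<pi> \<noteq> 0"
  proof
    assume "eval3 x \<pi> = 0"
    then have "scal \<pi> = 0" using \<Psi>_eval3[of \<pi>] \<Psi>.zero by simp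
    then show False using assms by simp
  qed
  show "\<not> eval3 x \<pi> dvd 1"
    using assms unfolding eval3_dvd_iff \<Psi>.one by (rule prime_elem_not_unit)
  show "eval3 x \<pi> dvd a \<or> eval3 x \<pi> dvd b" if "eval3 x \<pi> dvd a * b" for a b
    using that assms unfolding eval3_dvd_iff \<Psi>.mult by (simp add: prime_elem_dvd_mult_iff)
qed

lemma range_iff: "y \<in> range (eval3 x) \<longleftrightarrow> \<Psi> y \<in> range scal"
  by (metis \<Phi>\<Psi> \<Phi>_scal \<Psi>_eval3 imageE rangeI)

text \<open>An element outside $k[x]$ is transcendental over $k[x]$: after transport by
  \<open>\<Psi>\<close> this is \<open>lex_deg_poly_scal\<close>, applied to \<open>q\<close> minus
  an element of $k[X]$.\<close>

lemma eval3_not_in_range: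
  assumes y: "y \<notin> range (eval3 x)" and q: "degree q > 0"
  shows "eval3 y q \<notin> range (eval3 x)"
proof
  assume "eval3 y q \<in> range (eval3 x)"
  then obtain d where "\<Psi> (eval3 y q) = scal d" unfolding range_iff by blast
  then have e: "eval3 (\<Psi> y) q = scal d" by (simp only: eval3_comp[OF \<Psi> \<Psi>_const3])
  interpret S: comm_hom "scal :: 'k poly \<Rightarrow> _" by (rule scal_hom)
  interpret E: comm_hom "\<lambda>p. poly (map_poly scal p) (\<Psi> y)" by (rule S.eval_hom)
  let ?q = "map_poly (\<lambda>c. [:c:]) q"
  have "poly (map_poly scal ?q) (\<Psi> y) = eval3 (\<Psi> y) q"
    unfolding eval3_def by (simp add: map_poly_map_poly comp_def scal_def const3_def[abs_def])
  moreover have "poly (map_poly scal [:d:]) (\<Psi> y) = scal d" by (simp add: S.eval_pCons)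
  ultimately have "poly (map_poly scal (?q - [:d:])) (\<Psi> y) = 0" by (simp only: E.diff e) simp
  then have "?q - [:d:] = 0" using lex_deg_poly_scal(1) y range_iff by blast
  then have "coeff (?q - [:d:]) (degree q) = 0" by simp
  then have "lead_coeff q = 0"
    using q by (simp add: coeff_map_poly coeff_pCons del: leading_coeff_0_iff split: nat.splits)
  then show False using q by simp
qed

lemma irreducible_shift: "irreducible (x - const3 c)"
proof -
  have "prime_elem [:- c, 1:]" by (rule prime_elem_linear_field_poly) simp
  then have "prime_elem (scal [:- c, 1:])" unfolding scal_def by (intro lift_prime_elem_poly)
  then have "prime_elem (eval3 x [:- c, 1:])" by (rule prime_transport)
  moreover have "eval3 x [:- c, 1:] = x - const3 c"
    by (simp add: eval3_pCons comm_hom.uminus[OF const3_hom] comm_hom.one[OF const3_hom])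
  ultimately show ?thesis by (simp add: prime_elem_imp_irreducible)
qed

text \<open>If \<open>x = q(y)\<close> and \<open>c\<close> is the constant term of
  \<open>q\<close>, the irreducible element \<open>x - c\<close> is \<open>y\<close> times a
  polynomial in \<open>y\<close>. Since \<open>y\<close> is no unit, the other factor is a constant,
  and \<open>y\<close> lies in $k[x]$.\<close>

lemma not_in_range_sym:
  assumes y: "y \<notin> range (eval3 x)" shows "x \<notin> range (eval3 y)"
proof
  interpret C: comm_hom const3 by (rule const3_hom)
  assume "x \<in> range (eval3 y)"
  then obtain q where q: "x = eval3 y q" by blast
  obtain c r where cr: "q = pCons c r" by (cases q)
  have e: "x - const3 c = y * eval3 y r" by (simp add: q cr eval3_pCons)
  have const: "const3 d \<in> range (eval3 x)" for d by (metis eval3_const rangeI)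
  then have "\<not> y dvd 1" using y unit_const3 by blast
  then have "eval3 y r dvd 1" using comm_semiring_1_class.irreducibleD[OF irreducible_shift e] by blast
  then obtain d where d: "eval3 y r = const3 d" using unit_const3 by blast
  have "const3 d \<noteq> 0" using \<open>eval3 y r dvd 1\<close> d by auto
  then have "d \<noteq> 0" using C.zero by auto
  then have "y = const3 (inverse d) * (x - const3 c)"
    using C.mult[of "inverse d" d] by (simp add: e d C.one mult.left_commute mult.commute)
  also have "\<dots> = eval3 x ([:inverse d:] * ([:0, 1:] - [:c:]))"
    by (simp only: comm_hom.mult[OF eval3_hom] comm_hom.diff[OF eval3_hom] eval3_var eval3_const)
  finally show False using y by blast
qed

end

lemma coordinate_exists:
  assumes "adjoin scalars3 [x, y, z] = UNIV"
  shows "\<exists>\<Phi> \<Psi>. coordinate x \<Phi> \<Psi>"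
proof -
  obtain \<Phi> \<Psi> where "comm_hom \<Phi>" "comm_hom \<Psi>" "\<And>p. \<Phi> (\<Psi> p) = p" "\<And>p. \<Psi> (\<Phi> p) = p"
    "\<And>d. \<Phi> (scal d) = eval3 x d"
    using coordinate_automorphism[OF assms] by blast
  then show ?thesis unfolding coordinate_def by blast
qed

lemma degree_0_cancel:
  fixes f :: "'k::field poly"
  assumes "degree f = 0" "f \<noteq> 0" obtains c where "eval3 x f = const3 c" "const3 (inverse c) * const3 c = 1"
proof -
  interpret C: comm_hom "const3 :: 'k \<Rightarrow> _" by (rule const3_hom)
  obtain c where c: "f = [:c:]" "c \<noteq> 0" using nonzero_const_polyE[OF assms] .
  have "const3 (inverse c) * const3 c = 1" unfolding C.mult[symmetric] using c(2) by (simp add: C.one)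
  then show thesis using that c by (simp add: eval3_const)
qed

text \<open>If \<open>p(x)\<close> divided a prime factor \<open>\<pi>(y)\<close> of
  \<open>f(y)\<close>, the two would agree up to a constant, which would put \<open>\<pi>(y)\<close>
  into $k[x]$.\<close>

lemma prime_not_dvd_eval3:
  assumes co: "coordinate x \<Phi> \<Psi>" and y: "y \<notin> range (eval3 x)"
    and fac: "\<And>f. degree f > 0 \<Longrightarrow> \<exists>\<pi>. \<pi> dvd f \<and> degree \<pi> > 0 \<and> prime_elem (eval3 y \<pi>)"
    and p: "prime_elem (eval3 x p)" and "f \<noteq> 0"
  shows "\<not> eval3 x p dvd eval3 y f"
  using \<open>f \<noteq> 0\<close>
proof (induction "degree f" arbitrary: f rule: less_induct)
  case less
  interpret coordinate x \<Phi> \<Psi> by fact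
  show ?case
  proof (cases "degree f = 0")
    case True
    obtain c where "eval3 y f = const3 c" "const3 (inverse c) * const3 c = 1"
      by (rule degree_0_cancel[OF True less.prems]) (rule that)
    then have "eval3 y f dvd 1" by (metis dvd_triv_right)
    then show ?thesis using p by (meson dvd_trans prime_elem_not_unit)
  next
    case False
    then obtain \<pi> where \<pi>: "\<pi> dvd f" "degree \<pi> > 0" "prime_elem (eval3 y \<pi>)" using fac[of f] by blast
    obtain g where g: "f = \<pi> * g" using \<pi>(1) by (rule dvdE)
    have "\<not> eval3 x p dvd eval3 y \<pi>"
    proof
      assume "eval3 x p dvd eval3 y \<pi>"
      then obtain b where b: "eval3 y \<pi> = eval3 x p * b" by (rule dvdE)
      then have "b dvd 1"
        using comm_semiring_1_class.irreducibleD[OF prime_elem_imp_irreducible[OF \<pi>(3)] b] p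
          prime_elem_not_unit by blast
      then obtain c where "b = const3 c" using unit_const3 by blast
      then have "eval3 y \<pi> = eval3 x (p * [:c:])"
        unfolding b comm_hom.mult[OF eval3_hom] eval3_const by simp
      then show False using eval3_not_in_range[OF y \<pi>(2)] by blast
    qed
    moreover have "\<not> eval3 x p dvd eval3 y g"
      using less.hyps[of g] degree_dvd_less[OF \<pi>(2) g less.prems] by blast
    ultimately show ?thesis
      unfolding g comm_hom.mult[OF eval3_hom] using p by (simp add: prime_elem_dvd_mult_iff)
  qed
qed

section \<open>Actions on three-space with one or two invariant coordinates\<close>

locale action3 = iterative_hom \<delta>
  for \<delta> :: "'k::field poly poly poly \<Rightarrow> 'k poly poly poly poly" +
  assumes const3_inv: "const3 c \<in> invariants \<delta>"
    and nontriv: "invariants \<delta> \<noteq> UNIV"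
begin

lemma unital_subring_inv: "unital_subring A"
  by (simp add: unital_subring_def)

lemma adjoin_inv: "set xs \<subseteq> A \<Longrightarrow> adjoin scalars3 xs \<subseteq> A"
  by (rule adjoin_minimal[OF unital_subring_inv]) (auto simp: scalars3_eq const3_inv)

lemma eval3_inv: "x \<in> A \<Longrightarrow> eval3 x d \<in> A"
  using adjoin_inv[of "[x]"] unfolding adjoin_single by auto

text \<open>Conjugation by the coordinate automorphism turns \<open>x\<close> into \<open>X\<close>.
  Degrees, invariants and spans correspond under \<open>\<Phi>\<close>, so
  \<open>generator_and_slice\<close> can be carried back.\<close>

lemma coordinate_slice:
  assumes co: "coordinate x \<Phi> \<Psi>" and x: "x \<in> A" and nc: "\<not> A \<subseteq> range (eval3 x)"
  obtains P s where "P \<in> A" "A \<subseteq> adjoin scalars3 [x, P]"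
    "deg s = min_deg" "\<And>b. \<exists>f. f \<noteq> 0 \<and> eval3 x f * b \<in> A_span s"
    "\<And>f. degree f > 0 \<Longrightarrow> \<exists>\<pi>. \<pi> dvd f \<and> degree \<pi> > 0 \<and> prime_elem (eval3 x \<pi>)
       \<and> (\<forall>a1\<in>A. \<forall>a0\<in>A. \<forall>b. a1 * s + a0 = eval3 x \<pi> * b \<longrightarrow> eval3 x \<pi> dvd a1)"
proof -
  interpret coordinate x \<Phi> \<Psi> by fact
  define \<delta>' where "\<delta>' b = map_poly \<Psi> (\<delta> (\<Phi> b))" for b
  have \<Psi>0: "\<Psi> b = 0 \<longleftrightarrow> b = 0" for b by (metis \<Phi>\<Psi> \<Phi>.zero \<Psi>.zero)
  interpret D: iterative_hom \<delta>'
  proof (rule iterative_hom.intro)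
    show "comm_hom \<delta>'" unfolding \<delta>'_def by (rule comm_hom_comp[OF \<Psi>.map_poly_hom comm_hom_comp[OF hom \<Phi>]])
    show "coeff (\<delta>' b) 0 = b" for b by (simp add: \<delta>'_def coeff_map_poly \<Psi>.zero coeff_0)
    show "coeff (\<delta>' (coeff (\<delta>' b) i)) j = of_nat ((i + j) choose i) * coeff (\<delta>' b) (i + j)" for b i j
      by (simp add: \<delta>'_def coeff_map_poly \<Psi>.zero iterate \<Psi>.mult \<Psi>.of_nat)
  qed
  have deg': "D.deg b = deg (\<Phi> b)" for b
  proof (cases "\<delta> (\<Phi> b) = 0")
    case False
    then have "\<Psi> (lead_coeff (\<delta> (\<Phi> b))) \<noteq> 0" by (simp add: \<Psi>0 del: eq_0_iff)
    then show ?thesis unfolding \<delta>'_def by (rule map_poly_degree_eq)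
  qed (simp add: \<delta>'_def zero)
  have inv': "b \<in> D.A \<longleftrightarrow> \<Phi> b \<in> A" for b by (simp only: D.inv_iff inv_iff deg')
  have "(\<exists>b. D.deg b = m) \<longleftrightarrow> (\<exists>b. deg b = m)" for m unfolding deg' by (metis \<Phi>\<Psi>)
  then have min': "D.min_deg = min_deg" by (simp only: D.min_deg_def min_deg_def)
  have span': "\<Phi> b \<in> A_span (\<Phi> s)" if b: "b \<in> D.A_span s" for b s
  proof -
    obtain q where q: "b = poly q s" "\<And>i. coeff q i \<in> D.A" using b by (auto simp: poly_span_def)
    have "coeff (map_poly \<Phi> q) i \<in> A" for i using q(2)[of i] by (simp add: coeff_map_poly \<Phi>.zero inv')
    then show ?thesis unfolding q(1) \<Phi>.hom_poly by (rule A_spanI)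
  qed
  interpret D: space_action \<delta>'
  proof unfold_locales
    show "scal d \<in> D.A" for d using eval3_inv[OF x] by (simp add: inv' \<Phi>_scal)
    show "\<not> D.A \<subseteq> range scal"
    proof
      assume sub: "D.A \<subseteq> range scal"
      have "a \<in> range (eval3 x)" if "a \<in> A" for a
        unfolding range_iff using sub that inv'[of "\<Psi> a"] by auto
      then show False using nc by blast
    qed
    show "D.A \<noteq> UNIV" using nontriv inv' by (metis \<Phi>\<Psi> UNIV_eq_I UNIV_I)
  qed
  obtain P s where P: "P \<in> D.A" "\<And>a. a \<in> D.A \<Longrightarrow> \<exists>h. a = poly (map_poly scal h) P"
    and s: "D.deg s = D.min_deg" "\<And>b. \<exists>d. d \<noteq> 0 \<and> scal d * b \<in> D.A_span s"
    and \<pi>: "\<And>f. degree f > 0 \<Longrightarrow> \<exists>\<pi>. \<pi> dvd f \<and> degree \<pi> > 0 \<and> prime_elem (scal \<pi>)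
       \<and> (\<forall>a1\<in>D.A. \<forall>a0\<in>D.A. \<forall>b. a1 * s + a0 = scal \<pi> * b \<longrightarrow> scal \<pi> dvd a1)"
    by (rule D.generator_and_slice) (rule that)
  show thesis
  proof (rule that)
    show "\<Phi> P \<in> A" using P(1) inv' by simp
    show "A \<subseteq> adjoin scalars3 [x, \<Phi> P]"
    proof
      fix a assume "a \<in> A"
      then obtain h where h: "\<Psi> a = poly (map_poly scal h) P" using P(2)[of "\<Psi> a"] inv'[of "\<Psi> a"] by auto
      let ?T = "adjoin scalars3 [x, \<Phi> P]"
      have sub: "unital_subring ?T" by (rule unital_subring_adjoin)
      have mem: "x \<in> ?T" "\<Phi> P \<in> ?T" using adjoin_base(2)[of "[x, \<Phi> P]"] by auto
      have "a = \<Phi> (poly (map_poly scal h) P)" using h by (metis \<Phi>\<Psi>)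
      also have "\<dots> = poly (map_poly \<Phi> (map_poly scal h)) (\<Phi> P)" by (rule \<Phi>.hom_poly)
      also have "\<dots> \<in> ?T"
      proof (rule unital_subring_poly[OF sub _ mem(2)])
        fix i
        have "coeff (map_poly \<Phi> (map_poly scal h)) i = eval3 x (coeff h i)"
          by (simp add: coeff_map_poly \<Phi>.zero comm_hom.zero[OF scal_hom] \<Phi>_scal)
        also have "\<dots> \<in> adjoin scalars3 [x]" unfolding adjoin_single by simp
        also have "adjoin scalars3 [x] \<subseteq> ?T"
          by (rule adjoin_minimal[OF sub adjoin_base(1)]) (simp add: mem)
        finally show "coeff (map_poly \<Phi> (map_poly scal h)) i \<in> ?T" .
      qed
      finally show "a \<in> ?T" .
    qed
    show "deg (\<Phi> s) = min_deg" using s(1) by (simp add: deg' min')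
    show "\<exists>f. f \<noteq> 0 \<and> eval3 x f * b \<in> A_span (\<Phi> s)" for b
    proof -
      obtain d where d: "d \<noteq> 0" "scal d * \<Psi> b \<in> D.A_span s" using s(2) by blast
      then have "\<Phi> (scal d * \<Psi> b) \<in> A_span (\<Phi> s)" by (intro span')
      then show ?thesis using d(1) by (auto simp: \<Phi>.mult \<Phi>_scal)
    qed
    fix f :: "'k poly" assume "degree f > 0"
    from \<pi>[OF this] obtain \<pi> where p: "\<pi> dvd f" "degree \<pi> > 0" "prime_elem (scal \<pi>)"
      "\<And>a1 a0 b. a1 \<in> D.A \<Longrightarrow> a0 \<in> D.A \<Longrightarrow> a1 * s + a0 = scal \<pi> * b \<Longrightarrow> scal \<pi> dvd a1" by blast
    have "eval3 x \<pi> dvd a1" if a: "a1 \<in> A" "a0 \<in> A" "a1 * \<Phi> s + a0 = eval3 x \<pi> * b" for a1 a0 b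
    proof -
      have "\<Psi> a1 * s + \<Psi> a0 = \<Psi> (a1 * \<Phi> s + a0)" by (simp add: \<Psi>.mult \<Psi>.add)
      also have "\<dots> = scal \<pi> * \<Psi> b" unfolding a(3) by (simp add: \<Psi>.mult \<Psi>_eval3)
      finally have "scal \<pi> dvd \<Psi> a1" using p(4)[of "\<Psi> a1" "\<Psi> a0" "\<Psi> b"] a by (simp add: inv')
      then show ?thesis unfolding eval3_dvd_iff .
    qed
    then show "\<exists>\<pi>. \<pi> dvd f \<and> degree \<pi> > 0 \<and> prime_elem (eval3 x \<pi>)
       \<and> (\<forall>a1\<in>A. \<forall>a0\<in>A. \<forall>b. a1 * \<Phi> s + a0 = eval3 x \<pi> * b \<longrightarrow> eval3 x \<pi> dvd a1)"
      using p(1,2) prime_transport[OF p(3)] by blast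
  qed
qed

lemma dvd_inv:
  assumes "p \<in> A" "p \<noteq> 0" "a \<in> A" "p dvd a" obtains c where "c \<in> A" "a = p * c"
proof -
  obtain c where c: "a = p * c" using assms(4) by (rule dvdE)
  have "c \<in> A"
  proof (cases "c = 0")
    case False
    then show ?thesis using inv_factor(2)[of p c] assms(2,3) c by simp
  qed simp
  then show thesis by (rule that[OF _ c])
qed

text \<open>Some nonzero \<open>f(x)\<close> carries \<open>t\<close> into \<open>A_span s\<close>,
  and comparing degrees gives \<open>f(x) t = a1 s + a0\<close>. A prime factor of
  \<open>f(x)\<close> divides \<open>a1\<close> by the property of \<open>s\<close>, hence also
  \<open>a0\<close>, and cancels.\<close>

lemma slice_in_span:
  assumes co: "coordinate x \<Phi> \<Psi>" and x: "x \<in> A" and s: "deg s = min_deg" "\<And>b. \<exists>f. f \<noteq> 0 \<and> eval3 x f * b \<in> A_span s"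
    and \<pi>: "\<And>f. degree f > 0 \<Longrightarrow> \<exists>\<pi>. \<pi> dvd f \<and> degree \<pi> > 0 \<and> prime_elem (eval3 x \<pi>)
       \<and> (\<forall>a1\<in>A. \<forall>a0\<in>A. \<forall>b. a1 * s + a0 = eval3 x \<pi> * b \<longrightarrow> eval3 x \<pi> dvd a1)"
    and t: "deg t = min_deg"
  shows "t \<in> A_span s"
proof -
  interpret E: comm_hom "eval3 x" by (rule eval3_hom)
  have n: "min_deg > 0" using min_deg_witness nontriv by blast
  have ann: "\<exists>a1\<in>A. \<exists>a0\<in>A. eval3 x f * t = a1 * s + a0 \<Longrightarrow> f \<noteq> 0 \<Longrightarrow> t \<in> A_span s" for f
  proof (induction "degree f" arbitrary: f rule: less_induct)
    case less
    obtain a1 a0 where a: "a1 \<in> A" "a0 \<in> A" "eval3 x f * t = a1 * s + a0" using less.prems by blast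
    show ?case
    proof (cases "degree f = 0")
      case True
      obtain c where c: "eval3 x f = const3 c" "const3 (inverse c) * const3 c = 1"
        by (rule degree_0_cancel[OF True less.prems(2)]) (rule that)
      have "t = const3 (inverse c) * (const3 c * t)" by (simp only: mult.assoc[symmetric] c(2) mult_1_left)
      also have "\<dots> = const3 (inverse c) * (a1 * s + a0)" using a(3) c(1) by simp
      finally have "t = const3 (inverse c) * (a1 * s + a0)" .
      then show ?thesis using a by (simp add: A_span_add A_span_mult A_span_inv A_span_self const3_inv)
    next
      case False
      then obtain \<pi> where p: "\<pi> dvd f" "degree \<pi> > 0" "prime_elem (eval3 x \<pi>)"
        "\<And>a1 a0 b. a1 \<in> A \<Longrightarrow> a0 \<in> A \<Longrightarrow> a1 * s + a0 = eval3 x \<pi> * b \<Longrightarrow> eval3 x \<pi> dvd a1"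
        using \<pi>[of f] by blast
      let ?p = "eval3 x \<pi>"
      have p0: "?p \<in> A" "?p \<noteq> 0" using eval3_inv[OF x] p(3) by auto
      obtain g where g: "f = \<pi> * g" using p(1) by (rule dvdE)
      have eq: "a1 * s + a0 = ?p * (eval3 x g * t)" using a(3) by (simp add: g E.mult mult.assoc)
      then have "?p dvd a1" using p(4) a by blast
      then obtain c1 where c1: "c1 \<in> A" "a1 = ?p * c1" using dvd_inv[OF p0 a(1)] by blast
      have "a0 = ?p * (eval3 x g * t - c1 * s)" using eq by (simp add: c1 algebra_simps)
      then have "?p dvd a0" by simp
      then obtain c0 where c0: "c0 \<in> A" "a0 = ?p * c0" using dvd_inv[OF p0 a(2)] by blast
      have "?p * (eval3 x g * t) = ?p * (c1 * s + c0)" unfolding eq[symmetric] by (simp add: c1 c0 algebra_simps)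
      then have "eval3 x g * t = c1 * s + c0" using p0 by (simp only: mult_cancel_left) simp
      moreover have "g \<noteq> 0" "degree g < degree f" using degree_dvd_less[OF p(2) g less.prems(2)] by auto
      ultimately show ?thesis using less.hyps[of g] c1(1) c0(1) by blast
    qed
  qed
  obtain f where f: "f \<noteq> 0" "eval3 x f * t \<in> A_span s" using s(2) by blast
  then obtain q where q: "eval3 x f * t = poly q s" "\<And>i. coeff q i \<in> A" by (auto simp: poly_span_def)
  have e0: "eval3 x f \<noteq> 0" using coordinate.eval3_eq_0[OF co] f(1) by blast
  have t0: "t \<noteq> 0" using t n by (auto simp: zero)
  have "deg (eval3 x f * t) = min_deg"
    using deg_mult[OF e0 t0] eval3_inv[OF x, of f] t by (simp add: inv_iff)
  then have "degree q * min_deg = min_deg" using deg_poly_inv[OF q(2), of s] q(1) s(1) by simp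
  then have "degree q = 1" using n by simp
  then have "q = [:coeff q 0, coeff q 1:]" by (intro poly_eqI) (auto simp: coeff_pCons coeff_eq_0 split: nat.split)
  then have "poly q s = coeff q 1 * s + coeff q 0" by (metis add.commute mult.commute mult_zero_right add_0_right poly_0 poly_pCons)
  then show ?thesis using ann[OF _ f(1)] q by metis
qed

text \<open>The conclusion bounds the rank by 1. The slice \<open>t\<close> belonging to
  \<open>y\<close> lies in \<open>A_span s\<close>, so every \<open>b\<close> is carried into
  \<open>A_span s\<close> both by some \<open>f(x)\<close> and by some \<open>f'(y)\<close>.\<close>

lemma two_coordinates_imp_slice:
  assumes c1: "adjoin scalars3 [x, y1, z1] = UNIV" and c2: "adjoin scalars3 [y, x2, z2] = UNIV"
    and inv: "x \<in> A" "y \<in> A" and y: "y \<notin> adjoin scalars3 [x]"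
  shows "\<exists>P s. set [x, P] \<subseteq> A \<and> adjoin scalars3 [x, P, s] = UNIV"
proof -
  obtain \<Phi> \<Psi> where co: "coordinate x \<Phi> \<Psi>" using coordinate_exists[OF c1] by blast
  obtain \<Phi>' \<Psi>' where co': "coordinate y \<Phi>' \<Psi>'" using coordinate_exists[OF c2] by blast
  interpret C: coordinate x \<Phi> \<Psi> by fact
  have yr: "y \<notin> range (eval3 x)" using y by (simp add: adjoin_single)
  then have xr: "x \<notin> range (eval3 y)" by (rule C.not_in_range_sym)
  have nc: "\<not> A \<subseteq> range (eval3 x)" "\<not> A \<subseteq> range (eval3 y)" using inv xr yr by blast+
  obtain P s where P: "P \<in> A" "A \<subseteq> adjoin scalars3 [x, P]"
    and s: "deg s = min_deg" "\<And>b. \<exists>f. f \<noteq> 0 \<and> eval3 x f * b \<in> A_span s"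
    and s\<pi>: "\<And>f. degree f > 0 \<Longrightarrow> \<exists>\<pi>. \<pi> dvd f \<and> degree \<pi> > 0 \<and> prime_elem (eval3 x \<pi>)
       \<and> (\<forall>a1\<in>A. \<forall>a0\<in>A. \<forall>b. a1 * s + a0 = eval3 x \<pi> * b \<longrightarrow> eval3 x \<pi> dvd a1)"
    by (rule coordinate_slice[OF co inv(1) nc(1)]) (rule that)
  obtain P' t where t: "deg t = min_deg" "\<And>b. \<exists>f. f \<noteq> 0 \<and> eval3 y f * b \<in> A_span t"
    and t\<pi>: "\<And>f. degree f > 0 \<Longrightarrow> \<exists>\<pi>. \<pi> dvd f \<and> degree \<pi> > 0 \<and> prime_elem (eval3 y \<pi>)
       \<and> (\<forall>a1\<in>A. \<forall>a0\<in>A. \<forall>b. a1 * t + a0 = eval3 y \<pi> * b \<longrightarrow> eval3 y \<pi> dvd a1)"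
    by (rule coordinate_slice[OF co' inv(2) nc(2)]) (rule that)
  have xfac: "\<exists>\<pi>. \<pi> dvd f \<and> degree \<pi> > 0 \<and> prime_elem (eval3 x \<pi>)" if "degree f > 0" for f
    using s\<pi>[OF that] by (elim exE conjE) (intro exI conjI)
  have yfac: "\<exists>\<pi>. \<pi> dvd f \<and> degree \<pi> > 0 \<and> prime_elem (eval3 y \<pi>)" if "degree f > 0" for f
    using t\<pi>[OF that] by (elim exE conjE) (intro exI conjI)
  have ts: "t \<in> A_span s" by (rule slice_in_span[OF co inv(1) s s\<pi> t(1)])
  have sA: "s \<notin> A" using s(1) min_deg_witness nontriv by (auto simp: inv_iff)
  have span: "b \<in> A_span s" for b
  proof -
    obtain f' where f': "f' \<noteq> 0" "eval3 y f' * b \<in> A_span t" using t(2) by blast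
    then obtain q' where q': "eval3 y f' * b = poly q' s" "\<And>i. coeff q' i \<in> A"
      using A_span_trans[OF _ ts] by (fastforce simp: poly_span_def)
    obtain f where "f \<noteq> 0" "eval3 x f * b \<in> A_span s" using s(2) by blast
    then show ?thesis
    proof (induction "degree f" arbitrary: f rule: less_induct)
      case less
      show ?case
      proof (cases "degree f = 0")
        case True
        obtain c where c: "eval3 x f = const3 c" "const3 (inverse c) * const3 c = 1"
          by (rule degree_0_cancel[OF True less.prems(1)]) (rule that)
        have "const3 (inverse c) * (eval3 x f * b) \<in> A_span s"
          by (rule A_span_mult[OF A_span_inv[OF const3_inv] less.prems(2)])
        then show ?thesis unfolding c(1) by (simp only: mult.assoc[symmetric] c(2) mult_1_left)
      next
        case False
        then obtain \<pi> where \<pi>: "\<pi> dvd f" "degree \<pi> > 0" "prime_elem (eval3 x \<pi>)" using xfac[of f] by blast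
        let ?p = "eval3 x \<pi>"
        have p0: "?p \<in> A" "?p \<noteq> 0" using eval3_inv[OF inv(1)] \<pi>(3) by auto
        obtain g where g: "f = \<pi> * g" using \<pi>(1) by (rule dvdE)
        obtain q where q: "eval3 x f * b = poly q s" "\<And>i. coeff q i \<in> A"
          using less.prems(2) by (auto simp: poly_span_def)
        \<comment> \<open>As \<open>s\<close> is transcendental over \<open>A\<close>, the two
          expressions for \<open>f(x) f'(y) b\<close> agree coefficientwise. The prime
          \<open>?p\<close> does not divide \<open>f'(y)\<close>, so it divides every coefficient of
          \<open>q\<close>.\<close>
        let ?q = "smult (eval3 y f') q - smult (eval3 x f) q'"
        have "poly ?q s = 0" using q(1)[symmetric] q'(1)[symmetric] by (simp add: algebra_simps)
        moreover have "coeff ?q i \<in> A" for i using q(2) q'(2) eval3_inv inv by simp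
        ultimately have "?q = 0" using poly_inv_eq_0 sA by blast
        then have "eval3 y f' * coeff q i = eval3 x f * coeff q' i" for i
          by (metis coeff_diff coeff_smult eq_iff_diff_eq_0 Polynomial.coeff_0)
        then have "?p dvd eval3 y f' * coeff q i" for i
          by (simp add: g comm_hom.mult[OF eval3_hom])
        moreover have "\<not> ?p dvd eval3 y f'"
          by (rule prime_not_dvd_eval3[OF co yr yfac \<pi>(3) f'(1)])
        ultimately have "?p dvd coeff q i" for i using \<pi>(3) prime_elem_dvd_mult_iff by blast
        then have "[:?p:] dvd q" by (simp add: const_poly_dvd_iff)
        then obtain q1 where q1: "q = [:?p:] * q1" by (rule dvdE)
        have "coeff q1 i \<in> A" for i
          using inv_factor(2)[of ?p "coeff q1 i"] q(2)[of i] p0 by (cases "coeff q1 i = 0") (auto simp: q1)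
        moreover have "?p * (eval3 x g * b) = ?p * poly q1 s"
          using q(1) by (simp add: g q1 comm_hom.mult[OF eval3_hom] mult.assoc)
        then have "eval3 x g * b = poly q1 s" using p0 by simp
        ultimately have "eval3 x g * b \<in> A_span s" using A_spanI by metis
        then show ?thesis using less.hyps[of g] degree_dvd_less[OF \<pi>(2) g less.prems(1)] by blast
      qed
    qed
  qed
  let ?T = "adjoin scalars3 [x, P, s]"
  have sub: "unital_subring ?T" by (rule unital_subring_adjoin)
  have mem: "x \<in> ?T" "P \<in> ?T" "s \<in> ?T" using adjoin_base(2)[of "[x, P, s]"] by auto
  have "adjoin scalars3 [x, P] \<subseteq> ?T" by (rule adjoin_minimal[OF sub adjoin_base(1)]) (simp add: mem)
  then have AT: "A \<subseteq> ?T" using P(2) by blast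
  have "b \<in> ?T" for b
  proof -
    obtain q where q: "b = poly q s" "\<And>i. coeff q i \<in> A" using span[of b] by (auto simp: poly_span_def)
    show ?thesis unfolding q(1) by (rule unital_subring_poly[OF sub _ mem(3)]) (use q(2) AT in blast)
  qed
  then show ?thesis using inv P(1) by (intro exI[of _ P] exI[of _ s]) auto
qed

text \<open>Every element is a polynomial in \<open>z\<close> over $k[x,y]$, and \<open>z\<close> is
  not invariant because the action is nontrivial. As \<open>z\<close> is then transcendental over
  \<open>A\<close>, an invariant is the constant coefficient of its expression.\<close>

lemma invariants_two_coordinates:
  assumes "adjoin scalars3 [x, y, z] = UNIV" "x \<in> A" "y \<in> A"
  shows "A = adjoin scalars3 [x, y]"
proof
  let ?T = "adjoin scalars3 [x, y]"
  have sub: "unital_subring ?T" by (rule unital_subring_adjoin)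
  show TA: "?T \<subseteq> A" by (rule adjoin_inv) (simp add: assms)
  have span_sub: "unital_subring (poly_span ?T z)"
    unfolding unital_subring_def
  proof (intro conjI ballI)
    show "1 \<in> poly_span ?T z"
      unfolding poly_span_def
      by (auto intro!: exI[of _ 1] simp: unital_subringD[OF sub] coeff_1)
    fix u v assume "u \<in> poly_span ?T z" "v \<in> poly_span ?T z"
    then obtain p q where pq: "u = poly p z" "v = poly q z" "\<And>i. coeff p i \<in> ?T" "\<And>i. coeff q i \<in> ?T"
      by (auto simp: poly_span_def)
    have sum: "sum f I \<in> ?T" if "\<And>i. i \<in> I \<Longrightarrow> f i \<in> ?T" for f and I :: "nat set"
      using that by (induction I rule: infinite_finite_induct) (auto simp: unital_subringD[OF sub])
    have "coeff (p - q) i \<in> ?T" "coeff (p * q) i \<in> ?T" for i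
      using pq by (auto simp: coeff_mult unital_subringD[OF sub] intro!: sum)
    then have "poly (p - q) z \<in> poly_span ?T z" "poly (p * q) z \<in> poly_span ?T z"
      unfolding poly_span_def by blast+
    then show "u - v \<in> poly_span ?T z" "u * v \<in> poly_span ?T z" by (simp_all add: pq)
  qed
  have in_span: "a \<in> poly_span ?T z" if "a \<in> ?T" for a
    using that unfolding poly_span_def
    by (auto intro!: exI[of _ "[:a:]"] simp: coeff_pCons unital_subringD[OF sub] split: nat.split)
  have "z \<in> poly_span ?T z" unfolding poly_span_def
    by (auto intro!: exI[of _ "[:0, 1:]"] simp: coeff_pCons unital_subringD[OF sub] split: nat.split)
  moreover have "x \<in> ?T" "y \<in> ?T" using adjoin_base(2)[of "[x, y]"] by auto
  ultimately have "adjoin scalars3 [x, y, z] \<subseteq> poly_span ?T z"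
    using in_span adjoin_base(1)[of scalars3] by (intro adjoin_minimal[OF span_sub]) auto
  then have all: "b \<in> poly_span ?T z" for b using assms(1) by blast
  have "z \<notin> A"
  proof
    assume "z \<in> A"
    then have "adjoin scalars3 [x, y, z] \<subseteq> A" using assms by (intro adjoin_inv) simp
    then show False using assms(1) nontriv by blast
  qed
  show "A \<subseteq> ?T"
  proof
    fix a assume a: "a \<in> A"
    obtain q where q: "a = poly q z" "\<And>i. coeff q i \<in> ?T" using all[of a] by (auto simp: poly_span_def)
    let ?q = "q - [:a:]"
    have "coeff ?q i \<in> A" for i using q(2) TA a by (auto simp: coeff_pCons split: nat.split)
    then have "?q = 0" using poly_inv_eq_0[of ?q z] q(1) \<open>z \<notin> A\<close> by simp
    then have "coeff ?q 0 = 0" by simp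
    then have "a = coeff q 0" by simp
    then show "a \<in> ?T" using q(2)[of 0] by simp
  qed
qed

end

section \<open>Rigidity in each rank\<close>

lemma standard_coordinates:
  "adjoin scalars3 [[:[:[:0, 1:]:]:], [:[:0, 1:]:], [:0, 1 :: 'k::field poly poly:]] = UNIV"
proof -
  let ?x = "[:[:[:0, 1:]:]:] :: 'k poly poly poly" and ?y = "[:[:0, 1:]:] :: 'k poly poly poly"
  let ?z = "[:0, 1:] :: 'k poly poly poly"
  let ?T = "adjoin scalars3 [?x, ?y, ?z]"
  have sub: "unital_subring ?T" by (rule unital_subring_adjoin)
  have mem: "?x \<in> ?T" "?y \<in> ?T" "?z \<in> ?T" using adjoin_base(2)[of "[?x, ?y, ?z]"] by auto
  have c: "[:[:[:c:]:]:] \<in> ?T" for c using adjoin_base(1)[of scalars3] by (auto simp: scalars3_def)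
  have p1: "[:[:p:]:] \<in> ?T" for p
  proof (induction p)
    case (pCons a p)
    have "[:[:pCons a p:]:] = [:[:[:a:]:]:] + ?x * [:[:p:]:]" by simp
    then show ?case using pCons c mem by (metis unital_subringD(4,5)[OF sub])
  qed (simp add: unital_subringD[OF sub])
  have p2: "[:p:] \<in> ?T" for p
  proof (induction p)
    case (pCons a p)
    have "[:pCons a p:] = [:[:a:]:] + ?y * [:p:]" by simp
    then show ?case using pCons p1 mem by (metis unital_subringD(4,5)[OF sub])
  qed (simp add: unital_subringD[OF sub])
  have "p \<in> ?T" for p
  proof (induction p)
    case (pCons a p)
    have "pCons a p = [:a:] + ?z * p" by simp
    then show ?case using pCons p2 mem by (metis unital_subringD(4,5)[OF sub])
  qed (simp add: unital_subringD[OF sub])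
  then show ?thesis by blast
qed

theorem theorem4p6:
  fixes \<delta> :: "'k::field poly poly poly \<Rightarrow> 'k poly poly poly poly"
  assumes "\<delta> \<in> exp_maps scalars3"
  shows "rigid scalars3 3 \<delta>"
proof -
  interpret I: iterative_hom \<delta> by (rule exp_maps_iterative[OF assms])
  have const: "const3 c \<in> I.A" for c
    using assms by (auto simp: exp_maps_def invariants_def scalars3_eq)
  define r where "r = exp_rank scalars3 3 \<delta>"
  define ok where "ok r \<longleftrightarrow> r \<le> 3 \<and> (\<exists>Xs\<in>coord_systems scalars3 3. adjoin scalars3 (take (3 - r) Xs) \<subseteq> I.A)" for r
  have len3: "\<exists>x y z. Xs = [x, y, z]" if "Xs \<in> coord_systems scalars3 3" for Xs :: "'k poly poly poly list"
    using that by (auto simp: coord_systems_def numeral_3_eq_3 length_Suc_conv)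
  let ?S = "[[:[:[:0, 1:]:]:], [:[:0, 1:]:], [:0, 1:]] :: 'k poly poly poly list"
  have std: "?S \<in> coord_systems scalars3 3" by (simp add: coord_systems_def standard_coordinates)
  have "unital_subring I.A" by (simp add: unital_subring_def)
  \<comment> \<open>For \<open>r = 3\<close> only \<open>k\<close> has to be invariant, so the
    \<open>LEAST\<close> in the definition of the rank is attained.\<close>
  then have "adjoin scalars3 [] \<subseteq> I.A" by (rule adjoin_minimal) (auto simp: scalars3_eq const)
  then have "ok 3" unfolding ok_def using std by auto
  moreover have "r = (LEAST i. ok i)" by (simp only: r_def exp_rank_def ok_def)
  ultimately have r: "ok r" and r_le: "\<And>i. ok i \<Longrightarrow> r \<le> i"
    using LeastI[of ok 3] Least_le[of ok] by simp_all
  have eq: "adjoin scalars3 (take (3 - r) Xs) = adjoin scalars3 (take (3 - r) Ys)"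
    if Xs: "Xs \<in> coord_systems scalars3 3" "adjoin scalars3 (take (3 - r) Xs) \<subseteq> I.A"
      and Ys: "Ys \<in> coord_systems scalars3 3" "adjoin scalars3 (take (3 - r) Ys) \<subseteq> I.A" for Xs Ys
  proof -
    obtain x y z where x: "Xs = [x, y, z]" using len3[OF Xs(1)] by blast
    obtain x' y' z' where y: "Ys = [x', y', z']" using len3[OF Ys(1)] by blast
    have cx: "adjoin scalars3 [x, y, z] = UNIV" and cy: "adjoin scalars3 [x', y', z'] = UNIV"
      using Xs(1) Ys(1) by (auto simp: coord_systems_def x y)
    have mem: "set (take (3 - r) Xs) \<subseteq> I.A" "set (take (3 - r) Ys) \<subseteq> I.A"
      using Xs(2) Ys(2) adjoin_base(2) by blast+
    have "r = 0 \<or> r = 1 \<or> r = 2 \<or> r = 3" using r by (auto simp: ok_def)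
    moreover have nontriv: "I.A \<noteq> UNIV" if "r \<noteq> 0"
    proof
      assume "I.A = UNIV"
      then have "ok 0" unfolding ok_def using std by auto
      then show False using r_le that by fastforce
    qed
    have action: "action3 \<delta>" if "r \<noteq> 0"
      using nontriv[OF that] const by unfold_locales
    \<comment> \<open>Ranks 0 and 3 compare the whole ring and \<open>k\<close> with themselves; in
      rank 1 both subrings are the ring of invariants. Only rank 2 needs the comparison of two
      slices.\<close>
    ultimately consider "r = 0" | "r = 1" | "r = 2" | "r = 3" by blast
    then show ?thesis
    proof cases
      case 1
      then show ?thesis using cx cy by (simp add: x y)
    next
      case 2
      then interpret action3 \<delta> using action by simp
      have "I.A = adjoin scalars3 [x, y]"
        by (rule invariants_two_coordinates[OF cx]) (use mem in \<open>simp_all add: 2 x y\<close>)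
      moreover have "I.A = adjoin scalars3 [x', y']"
        by (rule invariants_two_coordinates[OF cy]) (use mem in \<open>simp_all add: 2 x y\<close>)
      ultimately show ?thesis by (simp add: 2 x y)
    next
      case 3
      then interpret action3 \<delta> using action by simp
      have inv: "x \<in> I.A" "x' \<in> I.A" using mem by (simp_all add: 3 x y)
      \<comment> \<open>In rank 2 no coordinate system starts with two invariant members, so each of
        \<open>x\<close> and \<open>x'\<close> must be a polynomial in the other.\<close>
      have one: False if "set [u, P] \<subseteq> I.A" "adjoin scalars3 [u, P, s] = UNIV" for u P s
      proof -
        have "[u, P, s] \<in> coord_systems scalars3 3" using that by (simp add: coord_systems_def)
        moreover have "adjoin scalars3 [u, P] \<subseteq> I.A" using that by (intro adjoin_inv)
        ultimately have "ok 1" unfolding ok_def by (intro conjI bexI[of _ "[u, P, s]"]) simp_all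
        then show False using r_le 3 by fastforce
      qed
      have "x' \<in> adjoin scalars3 [x]" using two_coordinates_imp_slice[OF cx cy inv] one by blast
      moreover have "x \<in> adjoin scalars3 [x']" using two_coordinates_imp_slice[OF cy cx inv(2,1)] one by blast
      ultimately have "adjoin scalars3 [x] = adjoin scalars3 [x']"
        by (intro antisym adjoin_minimal unital_subring_adjoin adjoin_base(1)) auto
      then show ?thesis by (simp add: 3 x y)
    next
      case 4
      then show ?thesis by simp
    qed
  qed
  show ?thesis
    unfolding rigid_def adapted_coord_systems_def r_def[symmetric] using eq by blast
qed

end
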